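(* Fix $K>0$ and $\varepsilon>0$, and let $(P_t^{\partial B})_{t\ge0}$ be the Markov semigroup associated with the stochastic differential equation $dh=K(1-h^2)\,dt+\sqrt2\,i\,\varepsilon\,h\circ dW$ on $\partial B$. There exist $C,\gamma_*>0$ such that $$\|\delta_xP_t^{\partial B}-\mu_{K,\varepsilon}\|_{\mathrm{TV}}\le Ce^{-\gamma_*t}$$ for every $x\in\partial B$ and all $t\ge1$.
   Context: $\partial B=\{z\in\mathbb{C}:|z|=1\}$. $W$ is a one-dimensional real Brownian motion; $\circ$ is the Stratonovich product. For $x\in\partial B$, $h^x$ is the unique solution with $h^x(0)=x$; it stays in $\partial B$ for all times. $P_t^{\partial B}f(x)=\mathbb{E}(f(h^x(t)))$ for bounded Borel $f$ on $\partial B$, and $\delta_xP_t^{\partial B}$ is the law of $h^x(t)$. $\mu_{K,\varepsilon}$ is the unique invariant probability measure of $(P_t^{\partial B})_{t\ge0}$ (that is, $\int P_t^{\partial B}f\,d\mu=\int f\,d\mu$ for all $t\ge 0$ and bounded Borel $f$). The total variation distance is $\|\mu_1-\mu_2\|_{\mathrm{TV}}=\sup\{|\mu_1(\Gamma)-\mu_2(\Gamma)|:\Gamma\subset\partial B\text{ Borel}\}$. *)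

theory Defs
  imports "HOL-Probability.Probability"
begin

section \<open>Brownian motion\<close>

text \<open>Standard real Brownian motion with respect to a filtration \<open>F\<close>. Only times \<open>t \<ge> 0\<close> matter;
  the library's filtrations are indexed by a whole order type, here the reals.\<close>

locale brownian_motion = prob_space M + filtration "space M" F
  for M :: "'a measure" and F :: "real \<Rightarrow> 'a measure" +
  fixes W :: "real \<Rightarrow> 'a \<Rightarrow> real"
  assumes subalgebra_F: "\<And>t. subalgebra M (F t)"
    and adapted: "\<And>t. 0 \<le> t \<Longrightarrow> W t \<in> borel_measurable (F t)"
    and start: "AE \<omega> in M. W 0 \<omega> = 0"
    and continuous_paths: "AE \<omega> in M. continuous_on {0..} (\<lambda>t. W t \<omega>)"
    and increment_distributed: "\<And>s t. 0 \<le> s \<Longrightarrow> s < t \<Longrightarrow>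
      distributed M lborel (\<lambda>\<omega>. W t \<omega> - W s \<omega>) (normal_density 0 (sqrt (t - s)))"
    and increment_indep: "\<And>s t. 0 \<le> s \<Longrightarrow> s < t \<Longrightarrow>
      indep_set (sets (F s)) {(\<lambda>\<omega>. W t \<omega> - W s \<omega>) -` B \<inter> space M | B. B \<in> sets borel}"

section \<open>Stochastic integrals against \<open>W\<close>\<close>

definition is_partition :: "real \<Rightarrow> nat \<Rightarrow> (nat \<Rightarrow> real) \<Rightarrow> bool" where
  "is_partition t n p \<longleftrightarrow> p 0 = 0 \<and> p n = t \<and> (\<forall>k<n. p k < p (Suc k))"

text \<open>The data \<open>n, p, \<xi>\<close> encode the simple process \<open>\<Sum>k<n. \<xi> k \<cdot> 1\<^bsub>(p k, p (k+1)]\<^esub>\<close> on \<open>[0, t]\<close>.\<close>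

definition simple_integrand ::
    "(real \<Rightarrow> 'a measure) \<Rightarrow> real \<Rightarrow> nat \<Rightarrow> (nat \<Rightarrow> real) \<Rightarrow> (nat \<Rightarrow> 'a \<Rightarrow> complex) \<Rightarrow> bool" where
  "simple_integrand F t n p \<xi> \<longleftrightarrow> is_partition t n p \<and>
     (\<forall>k<n. \<xi> k \<in> borel_measurable (F (p k)) \<and> bounded (\<xi> k ` space (F (p k))))"

definition simple_process ::
    "nat \<Rightarrow> (nat \<Rightarrow> real) \<Rightarrow> (nat \<Rightarrow> 'a \<Rightarrow> complex) \<Rightarrow> real \<Rightarrow> 'a \<Rightarrow> complex" where
  "simple_process n p \<xi> s \<omega> = (\<Sum>k<n. indicator {p k<..p (Suc k)} s * \<xi> k \<omega>)"

definition simple_integral ::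
    "(real \<Rightarrow> 'a \<Rightarrow> real) \<Rightarrow> nat \<Rightarrow> (nat \<Rightarrow> real) \<Rightarrow> (nat \<Rightarrow> 'a \<Rightarrow> complex) \<Rightarrow> 'a \<Rightarrow> complex" where
  "simple_integral W n p \<xi> \<omega> = (\<Sum>k<n. \<xi> k \<omega> * of_real (W (p (Suc k)) \<omega> - W (p k) \<omega>))"

text \<open>\<open>J\<close> is (a version of) the Ito integral of \<open>Y\<close> over \<open>[0, t]\<close>: the \<open>L\<^sup>2\<close> limit of the integrals of
  simple processes that approximate \<open>Y\<close> in \<open>L\<^sup>2([0, t] \<times> \<Omega>)\<close>.\<close>

definition is_ito_integral ::
    "'a measure \<Rightarrow> (real \<Rightarrow> 'a measure) \<Rightarrow> (real \<Rightarrow> 'a \<Rightarrow> real) \<Rightarrow> (real \<Rightarrow> 'a \<Rightarrow> complex) \<Rightarrow>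
      real \<Rightarrow> ('a \<Rightarrow> complex) \<Rightarrow> bool" where
  "is_ito_integral M F W Y t J \<longleftrightarrow> J \<in> borel_measurable M \<and>
     (\<exists>n p \<xi>. (\<forall>m. simple_integrand F t (n m) (p m) (\<xi> m)) \<and>
        (\<lambda>m. \<integral>\<^sup>+ \<omega>. (\<integral>\<^sup>+ s\<in>{0..t}.
            ennreal ((cmod (simple_process (n m) (p m) (\<xi> m) s \<omega> - Y s \<omega>))\<^sup>2) \<partial>lborel) \<partial>M)
          \<longlonglongrightarrow> 0 \<and>
        (\<lambda>m. \<integral>\<^sup>+ \<omega>. ennreal ((cmod (simple_integral W (n m) (p m) (\<xi> m) \<omega> - J \<omega>))\<^sup>2) \<partial>M)
          \<longlonglongrightarrow> 0)"

text \<open>\<open>V\<close> is the covariation process \<open>[Y, W]\<close>: a continuous process of locally finite variation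
  such that the sums of products of increments over partitions of \<open>[0, t]\<close> converge to \<open>V t\<close> in
  probability as the mesh tends to 0. It exists if \<open>Y\<close> is a continuous semimartingale.\<close>

definition is_covariation ::
    "'a measure \<Rightarrow> (real \<Rightarrow> 'a \<Rightarrow> real) \<Rightarrow> (real \<Rightarrow> 'a \<Rightarrow> complex) \<Rightarrow> (real \<Rightarrow> 'a \<Rightarrow> complex) \<Rightarrow> bool" where
  "is_covariation M W Y V \<longleftrightarrow>
     (\<forall>t\<ge>0. V t \<in> borel_measurable M) \<and>
     (AE \<omega> in M. continuous_on {0..} (\<lambda>t. V t \<omega>)) \<and>
     (AE \<omega> in M. \<forall>t\<ge>0. \<exists>B. \<forall>n p. is_partition t n p \<longrightarrow>
        (\<Sum>k<n. cmod (V (p (Suc k)) \<omega> - V (p k) \<omega>)) \<le> B) \<and>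
     (\<forall>t\<ge>0. \<forall>a>0. \<forall>r>0. \<exists>\<delta>>0. \<forall>n p.
        is_partition t n p \<and> (\<forall>k<n. p (Suc k) - p k < \<delta>) \<longrightarrow>
        measure M {\<omega> \<in> space M.
          cmod ((\<Sum>k<n. (Y (p (Suc k)) \<omega> - Y (p k) \<omega>) * of_real (W (p (Suc k)) \<omega> - W (p k) \<omega>))
            - V t \<omega>) > a} < r)"

text \<open>Stratonovich integral: \<open>\<integral>\<^sub>0\<^sup>t Y \<circ> dW = \<integral>\<^sub>0\<^sup>t Y dW + [Y, W]\<^sub>t / 2\<close>.\<close>

definition is_stratonovich_integral ::
    "'a measure \<Rightarrow> (real \<Rightarrow> 'a measure) \<Rightarrow> (real \<Rightarrow> 'a \<Rightarrow> real) \<Rightarrow> (real \<Rightarrow> 'a \<Rightarrow> complex) \<Rightarrow>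
      (real \<Rightarrow> 'a \<Rightarrow> complex) \<Rightarrow> bool" where
  "is_stratonovich_integral M F W Y I \<longleftrightarrow>
     (\<exists>J V. (\<forall>t\<ge>0. is_ito_integral M F W Y t (J t)) \<and> is_covariation M W Y V \<and>
        (\<forall>t\<ge>0. AE \<omega> in M. I t \<omega> = J t \<omega> + V t \<omega> / 2))"

section \<open>The equation on the circle\<close>

abbreviation circle :: "complex set" where
  "circle \<equiv> sphere 0 1"

abbreviation circle_borel :: "complex measure" where
  "circle_borel \<equiv> restrict_space borel circle"

text \<open>\<open>h\<close> is a circle-valued solution of \<open>dh = K (1 - h\<^sup>2) dt + \<surd>2 \<i> \<epsilon> h \<circ> dW\<close> with \<open>h(0) = x\<close>.
  By the equation, \<open>h\<close> is then a semimartingale, so its Stratonovich integral above is the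
  usual one.\<close>

definition circle_sde_solution ::
    "real \<Rightarrow> real \<Rightarrow> 'a measure \<Rightarrow> (real \<Rightarrow> 'a measure) \<Rightarrow> (real \<Rightarrow> 'a \<Rightarrow> real) \<Rightarrow>
      complex \<Rightarrow> (real \<Rightarrow> 'a \<Rightarrow> complex) \<Rightarrow> bool" where
  "circle_sde_solution K \<epsilon> M F W x h \<longleftrightarrow>
     (\<forall>t\<ge>0. h t \<in> borel_measurable (F t)) \<and>
     (\<forall>t\<ge>0. \<forall>\<omega>\<in>space M. h t \<omega> \<in> circle) \<and>
     (AE \<omega> in M. continuous_on {0..} (\<lambda>t. h t \<omega>)) \<and>
     (AE \<omega> in M. h 0 \<omega> = x) \<and>
     (\<exists>I. is_stratonovich_integral M F W h I \<and>
        (\<forall>t\<ge>0. AE \<omega> in M.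
           h t \<omega> = x + integral {0..t} (\<lambda>s. of_real K * (1 - (h s \<omega>)\<^sup>2))
                     + of_real (sqrt 2) * \<i> * of_real \<epsilon> * I t \<omega>))"

section \<open>Semigroup, invariant measures, total variation\<close>

text \<open>In what follows \<open>h x\<close> is the solution started at \<open>x\<close>.\<close>

definition transition_op ::
    "'a measure \<Rightarrow> (complex \<Rightarrow> real \<Rightarrow> 'a \<Rightarrow> complex) \<Rightarrow> real \<Rightarrow> (complex \<Rightarrow> real) \<Rightarrow> complex \<Rightarrow> real" where
  "transition_op M h t f x = (\<integral>\<omega>. f (h x t \<omega>) \<partial>M)"

definition transition_law ::
    "'a measure \<Rightarrow> (complex \<Rightarrow> real \<Rightarrow> 'a \<Rightarrow> complex) \<Rightarrow> real \<Rightarrow> complex \<Rightarrow> complex measure" where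
  "transition_law M h t x = distr M circle_borel (h x t)"

definition invariant_prob ::
    "'a measure \<Rightarrow> (complex \<Rightarrow> real \<Rightarrow> 'a \<Rightarrow> complex) \<Rightarrow> complex measure \<Rightarrow> bool" where
  "invariant_prob M h \<mu> \<longleftrightarrow> prob_space \<mu> \<and> sets \<mu> = sets circle_borel \<and>
     (\<forall>t\<ge>0. \<forall>f\<in>borel_measurable circle_borel. bounded (f ` circle) \<longrightarrow>
        (\<integral>x. transition_op M h t f x \<partial>\<mu>) = (\<integral>x. f x \<partial>\<mu>))"

definition tv_dist :: "'b measure \<Rightarrow> 'b measure \<Rightarrow> real" where
  "tv_dist \<mu> \<nu> = (SUP \<Gamma>\<in>sets \<mu>. \<bar>measure \<mu> \<Gamma> - measure \<nu> \<Gamma>\<bar>)"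

end

theory Submission
  imports Defs
begin

text \<open>Write \<open>h = exp (\<i> \<theta>)\<close> and \<open>\<sigma> = \<surd>2 \<epsilon>\<close>, so that \<open>d\<theta> = - 2 K sin \<theta> dt + \<sigma> dW\<close>. All quantitative estimates are made
  for the Euler scheme of this equation with step \<open>\<tau>\<close>, whose increments are independent Gaussians: no Markov
  property, no strong uniqueness and no Girsanov theorem is needed for the equation itself.

  The Euler chains started at two angles can be driven together by shifting their Gaussian increments, so that
  their distance decreases linearly to \<open>0\<close> within a time span in \<open>[1, 2]\<close>; the total relative entropy of the
  shifts is bounded uniformly in \<open>\<tau>\<close>. The resulting log-Harnack inequality
  \<open>P\<^sup>N (ln g) (y) \<le> ln (P\<^sup>N g (x)) + S\<close>, applied to \<open>g = exp (a f)\<close> with a large constant \<open>a\<close>, shows that \<open>P\<^sup>N\<close>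
  contracts the oscillation of periodic functions by a factor \<open>1 - \<delta>\<close> independent of \<open>\<tau>\<close>.

  The Ito isometry identifies the covariation of \<open>h\<close> and \<open>W\<close> as \<open>\<i> \<sigma> \<integral> h dt\<close>, and with it \<open>h\<close> as the \<open>L\<^sup>2\<close> limit
  of the Euler schemes. Hence \<open>E f(h(t))\<close> oscillates by at most \<open>(1 - \<delta>)\<^sup>m\<close>, \<open>m = \<lfloor>t\<rfloor>\<close>, over all starting points, for
  Lipschitz \<open>f\<close> with values in \<open>[0, 1]\<close>. Integrating against the invariant measure and approximating Borel
  sets from inside by compact sets gives the total variation bound.\<close>

section \<open>Gaussian steps and the log-Harnack inequality\<close>

text \<open>Each starting point comes with nothing but its own equation: no semigroup law for
  \<open>h\<close>, no measurable dependence on \<open>x\<close>, and a filtration that need not be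
  complete. The discrete chain supplies what is missing. Its operators can be iterated, so time is
  cut into blocks on the level of the chain, and they are measurable in the starting angle, so E
  f(h(t)) is measurable in \<open>x\<close> as a limit. The price is that the contraction must not
  degenerate with \<tau>. The overlap of the laws after a single step does; the entropy spent over a
  block of fixed duration does not. The contraction is proved for angles because the noise is
  additive there: shifting a Gaussian increment moves the next point by a fixed amount. The
  convergence is proved in the plane, where the coefficients are polynomial and no path has to be
  lifted. The covariation in the Stratonovich integral is at first an unknown of the equation;
  having finite variation, it does not contribute to its own defining sums, and this makes it
  computable.\<close>

definition gauss :: "real \<Rightarrow> real measure" where
  "gauss \<tau> = density lborel (\<lambda>w. ennreal (normal_density 0 (sqrt \<tau>) w))"

lemma prob_space_gauss: "0 < \<tau> \<Longrightarrow> prob_space (gauss \<tau>)"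
  unfolding gauss_def by (rule prob_space_normal_density) simp

lemma sets_gauss [simp, measurable_cong]: "sets (gauss \<tau>) = sets borel"
  and space_gauss [simp]: "space (gauss \<tau>) = UNIV"
  by (simp_all add: gauss_def)

lemma integral_gauss:
  fixes f :: "real \<Rightarrow> real"
  assumes "f \<in> borel_measurable borel"
  shows "(\<integral>w. f w \<partial>gauss \<tau>) = (\<integral>w. normal_density 0 (sqrt \<tau>) w * f w \<partial>lborel)"
  unfolding gauss_def using assms by (subst integral_density) auto

lemma integrable_gauss:
  fixes f :: "real \<Rightarrow> real"
  assumes "f \<in> borel_measurable borel"
  shows "integrable (gauss \<tau>) f \<longleftrightarrow> integrable lborel (\<lambda>w. normal_density 0 (sqrt \<tau>) w * f w)"
  unfolding gauss_def using assms by (subst integrable_density) auto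

lemma integrable_gauss_bounded:
  fixes f :: "real \<Rightarrow> real"
  assumes "0 < \<tau>" "f \<in> borel_measurable borel" "\<And>x. \<bar>f x\<bar> \<le> B"
  shows "integrable (gauss \<tau>) f"
proof -
  interpret prob_space "gauss \<tau>" by (rule prob_space_gauss) fact
  show ?thesis using assms by (intro integrable_const_bound[where B=B]) auto
qed

lemma gauss_moments:
  assumes "0 < \<tau>"
  shows "integrable (gauss \<tau>) (\<lambda>w. w ^ k)"
    and "(\<integral>w. w \<partial>gauss \<tau>) = 0"
    and "(\<integral>w. w\<^sup>2 \<partial>gauss \<tau>) = \<tau>"
    and "(\<integral>w. w ^ 4 \<partial>gauss \<tau>) = 3 * \<tau>\<^sup>2"
    and "(\<integral>w. w ^ 6 \<partial>gauss \<tau>) = 15 * \<tau> ^ 3"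
proof -
  have pos: "0 < sqrt \<tau>" using assms by simp
  show "integrable (gauss \<tau>) (\<lambda>w. w ^ k)"
    using integrable_normal_moment[OF pos, of 0 k] by (simp add: integrable_gauss)
  show "(\<integral>w. w \<partial>gauss \<tau>) = 0"
    using integral_normal_moment_odd[OF pos, of 0 0] by (simp add: integral_gauss)
  show "(\<integral>w. w\<^sup>2 \<partial>gauss \<tau>) = \<tau>"
    using integral_normal_moment_even[OF pos, of 0 1] assms by (simp add: integral_gauss fact_numeral)
  show "(\<integral>w. w ^ 4 \<partial>gauss \<tau>) = 3 * \<tau>\<^sup>2"
    using integral_normal_moment_even[OF pos, of 0 2] assms
    by (simp add: integral_gauss fact_numeral power_divide)
  show "(\<integral>w. w ^ 6 \<partial>gauss \<tau>) = 15 * \<tau> ^ 3"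
    using integral_normal_moment_even[OF pos, of 0 3] assms
    by (simp add: integral_gauss fact_numeral power_divide)
qed

text \<open>Mean zero and a second moment of order \<open>\<tau>\<^sup>2\<close> are what
  \<open>martingale_sum\<close> asks of \<open>w\<^sup>2 - \<tau>\<close>: replacing squared
  increments by \<tau> over \<open>T / \<tau>\<close> steps then costs only order \<tau> in squared
  mean.\<close>

lemma square_compensator:
  assumes "0 < \<tau>"
  shows "integrable (gauss \<tau>) (\<lambda>w. w\<^sup>2 - \<tau>)" "integrable (gauss \<tau>) (\<lambda>w. (w\<^sup>2 - \<tau>)\<^sup>2)"
    "(\<integral>w. w\<^sup>2 - \<tau> \<partial>gauss \<tau>) = 0" "(\<integral>w. (w\<^sup>2 - \<tau>)\<^sup>2 \<partial>gauss \<tau>) = 2 * \<tau>\<^sup>2"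
proof -
  interpret G: prob_space "gauss \<tau>" by (rule prob_space_gauss) fact
  have p: "G.prob UNIV = 1" using G.prob_space by simp
  note m = gauss_moments[OF assms]
  have eq: "(\<lambda>w::real. (w\<^sup>2 - \<tau>)\<^sup>2) = (\<lambda>w. w ^ 4 - 2 * \<tau> * w\<^sup>2 + \<tau>\<^sup>2)"
    by (auto simp: power2_diff power_mult[symmetric] algebra_simps)
  show "integrable (gauss \<tau>) (\<lambda>w. w\<^sup>2 - \<tau>)" using m(1)[of 2] by simp
  show "(\<integral>w. w\<^sup>2 - \<tau> \<partial>gauss \<tau>) = 0" using m(1)[of 2] m(3) p by simp
  show "integrable (gauss \<tau>) (\<lambda>w. (w\<^sup>2 - \<tau>)\<^sup>2)" unfolding eq using m(1)[of 2] m(1)[of 4] by simp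
  show "(\<integral>w. (w\<^sup>2 - \<tau>)\<^sup>2 \<partial>gauss \<tau>) = 2 * \<tau>\<^sup>2"
    unfolding eq using m(1)[of 2] m(1)[of 4] m(3,4) p by (simp add: power2_eq_square)
qed

text \<open>Gibbs variational inequality for two Gaussians of variance \<tau> whose means differ by
  \<open>v\<close>; their relative entropy is \<open>v\<^sup>2 / (2 * \<tau>)\<close>.\<close>

lemma gauss_shift_entropy:
  fixes U :: "real \<Rightarrow> real"
  assumes \<tau>: "0 < \<tau>" and [measurable]: "U \<in> borel_measurable borel"
    and U: "\<And>x. lo \<le> U x" "\<And>x. U x \<le> hi" and lo: "0 < lo"
  shows "(\<integral>w. ln (U (w + v)) \<partial>gauss \<tau>) \<le> ln (\<integral>w. U w \<partial>gauss \<tau>) + v\<^sup>2 / (2 * \<tau>)"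
proof -
  interpret G: prob_space "gauss \<tau>" by (rule prob_space_gauss) fact
  define n where "n = normal_density 0 (sqrt \<tau>)"
  have n_pos: "n w > 0" for w unfolding n_def using \<tau> by (intro normal_density_pos) simp
  have [measurable]: "n \<in> borel_measurable borel" unfolding n_def by simp
  have absU: "\<bar>U x\<bar> \<le> hi" for x using U(1)[of x] U(2)[of x] lo by auto
  have Upos: "0 < U x" for x using U(1)[of x] lo by linarith
  have intU: "integrable (gauss \<tau>) U"
    using \<tau> absU by (intro integrable_gauss_bounded) auto
  define m where "m = (\<integral>w. U w \<partial>gauss \<tau>)"
  have "lo \<le> m" unfolding m_def using intU U(1) by (intro G.integral_ge_const) auto
  with lo have m: "0 < m" by simp
  have lnU: "\<bar>ln (U x)\<bar> \<le> max \<bar>ln lo\<bar> \<bar>ln hi\<bar>" for x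
  proof -
    have "ln lo \<le> ln (U x)" "ln (U x) \<le> ln hi" using U(1)[of x] U(2)[of x] lo by auto
    then show ?thesis by auto
  qed
  have int1: "integrable (gauss \<tau>) (\<lambda>w. ln (U (w + v)))"
    using \<tau> lnU by (intro integrable_gauss_bounded) auto
  \<comment> \<open>The exponential is the ratio of the densities at \<open>w + v\<close> and
    \<open>w\<close>. Multiplied by it, \<open>U (w + v)\<close> has mean \<open>m\<close> under
    \<open>gauss \<tau>\<close>, by translation invariance of Lebesgue measure.\<close>
  have n_sh: "n (w + v) = n w * exp (- (2 * w * v + v\<^sup>2) / (2 * \<tau>))" for w
    unfolding n_def normal_density_def using \<tau>
    by (simp add: exp_add[symmetric] field_simps power2_eq_square)
  have intw: "integrable (gauss \<tau>) (\<lambda>w. w)" "(\<integral>w. w \<partial>gauss \<tau>) = 0"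
    using normal_moment_nz_1[of "sqrt \<tau>" 0] \<tau>
    by (auto simp: integrable_gauss integral_gauss has_bochner_integral_iff)
  have shift: "integrable lborel (\<lambda>w. n w * U w)" "(\<integral>w. n w * U w \<partial>lborel) = m"
    using intU by (auto simp: integrable_gauss n_def m_def integral_gauss)
  have shift1: "integrable lborel (\<lambda>w. n (w + v) * U (w + v))"
    using lborel_integrable_real_affine[OF shift(1), of 1 v] by (simp add: add.commute)
  have shift2: "(\<integral>w. n (w + v) * U (w + v) \<partial>lborel) = m"
    using lborel_integral_real_affine[of 1 "\<lambda>w. n w * U w" v] shift(2) by (simp add: add.commute)
  have intE: "integrable (gauss \<tau>) (\<lambda>w. U (w + v) * exp (- (2 * w * v + v\<^sup>2) / (2 * \<tau>)))"
    using shift1 by (simp add: integrable_gauss n_sh mult_ac n_def[symmetric])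
  have E: "(\<integral>w. U (w + v) * exp (- (2 * w * v + v\<^sup>2) / (2 * \<tau>)) \<partial>gauss \<tau>) = m"
    using shift2 by (simp add: integral_gauss n_sh mult_ac n_def[symmetric])
  \<comment> \<open>\<open>ln r \<le> r - 1\<close> for the quotient \<open>r\<close> of mean 1 just
    prepared. The logarithm of the density ratio, moved to the right, integrates to the
    entropy.\<close>
  have pw: "ln (U (w + v)) \<le> ln m + ((2 * w * v + v\<^sup>2) / (2 * \<tau>)
      + (U (w + v) * exp (- (2 * w * v + v\<^sup>2) / (2 * \<tau>)) / m - 1))" for w
  proof -
    let ?e = "- (2 * w * v + v\<^sup>2) / (2 * \<tau>)"
    have "ln (U (w + v) * exp ?e / m) \<le> U (w + v) * exp ?e / m - 1"
      using Upos m by (intro ln_le_minus_one) simp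
    also have "ln (U (w + v) * exp ?e / m) = ln (U (w + v)) + ?e - ln m"
      using Upos[of "w + v"] m by (simp add: ln_div ln_mult)
    finally have *: "ln (U (w + v)) + ?e - ln m \<le> U (w + v) * exp ?e / m - 1" .
    have "?e = - ((2 * w * v + v\<^sup>2) / (2 * \<tau>))" by (rule minus_divide_left[symmetric])
    with * show ?thesis by linarith
  qed
  have intL: "integrable (gauss \<tau>) (\<lambda>w. (2 * w * v + v\<^sup>2) / (2 * \<tau>))"
    using intw(1) by auto
  have "(\<integral>w. ln (U (w + v)) \<partial>gauss \<tau>) \<le> (\<integral>w. ln m + ((2 * w * v + v\<^sup>2) / (2 * \<tau>)
      + (U (w + v) * exp (- (2 * w * v + v\<^sup>2) / (2 * \<tau>)) / m - 1)) \<partial>gauss \<tau>)"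
    using intL intE int1 by (intro integral_mono pw) auto
  also have "\<dots> = ln m + (v\<^sup>2 / (2 * \<tau>) + (m / m - 1))"
    using intL intE intw m E G.prob_space by simp
  finally show ?thesis using m by (simp add: m_def)
qed

lemma abs_sin_diff_le: "\<bar>sin y - sin x\<bar> \<le> \<bar>y - x\<bar>" for x y :: real
proof -
  have "\<bar>sin y - sin x\<bar> = 2 * \<bar>sin ((y - x) / 2)\<bar> * \<bar>cos ((y + x) / 2)\<bar>"
    by (simp add: sin_diff_sin abs_mult)
  also have "\<dots> \<le> 2 * \<bar>(y - x) / 2\<bar> * 1"
    by (intro mult_mono abs_sin_x_le_abs_x) auto
  finally show ?thesis by simp
qed

section \<open>Transition operators of the Euler chain of angles\<close>

definition step_op :: "real \<Rightarrow> real \<Rightarrow> real \<Rightarrow> (real \<Rightarrow> real) \<Rightarrow> real \<Rightarrow> real" where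
  "step_op K \<sigma> \<tau> f x = (\<integral>w. f (x - 2 * K * \<tau> * sin x + \<sigma> * w) \<partial>gauss \<tau>)"

locale euler_step =
  fixes K \<sigma> \<tau> :: real
  assumes K: "0 < K" and \<sigma>: "0 < \<sigma>" and \<tau>: "0 < \<tau>"
begin

abbreviation "P \<equiv> step_op K \<sigma> \<tau>"

sublocale G: prob_space "gauss \<tau>" by (rule prob_space_gauss) (rule \<tau>)

lemma measurable_step [measurable (raw)]:
  assumes [measurable]: "f \<in> borel_measurable borel"
  shows "P f \<in> borel_measurable borel"
  unfolding step_op_def[abs_def] by measurable

lemma measurable_iterate [measurable (raw)]:
  "f \<in> borel_measurable borel \<Longrightarrow> (P ^^ n) f \<in> borel_measurable borel"
  by (induction n) auto

lemma integrable_step: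
  fixes f :: "real \<Rightarrow> real"
  assumes [measurable]: "f \<in> borel_measurable borel" and "\<And>x. f x \<in> {lo..hi}"
  shows "integrable (gauss \<tau>) (\<lambda>w. f (c + \<sigma> * w))"
proof (rule integrable_gauss_bounded[OF \<tau>, where B="max \<bar>lo\<bar> \<bar>hi\<bar>"])
  show "\<bar>f (c + \<sigma> * w)\<bar> \<le> max \<bar>lo\<bar> \<bar>hi\<bar>" for w
    using assms(2)[of "c + \<sigma> * w"] by auto
qed simp

lemma step_bounds:
  assumes [measurable]: "f \<in> borel_measurable borel" and f: "\<And>x. f x \<in> {lo..hi}"
  shows "P f x \<in> {lo..hi}"
  using integrable_step[OF assms] f unfolding step_op_def
  by (auto intro!: G.integral_ge_const G.integral_le_const)

lemma iterate_bounds: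
  assumes "f \<in> borel_measurable borel" "\<And>x. f x \<in> {lo..hi}"
  shows "(P ^^ n) f x \<in> {lo..hi}"
  using assms
proof (induction n arbitrary: x)
  case (Suc n)
  then show ?case by (simp add: step_bounds measurable_iterate del: atLeastAtMost_iff)
qed auto

lemma step_affine:
  assumes "f \<in> borel_measurable borel" "\<And>x. f x \<in> {lo..hi}"
  shows "P (\<lambda>x. a + b * f x) x = a + b * P f x"
  using integrable_step[OF assms] G.prob_space by (simp add: step_op_def)

lemma iterate_affine:
  assumes "f \<in> borel_measurable borel" "\<And>x. f x \<in> {lo..hi}"
  shows "(P ^^ n) (\<lambda>x. a + b * f x) x = a + b * (P ^^ n) f x"
proof (induction n arbitrary: x)
  case (Suc n)
  have "(P ^^ n) (\<lambda>x. a + b * f x) = (\<lambda>x. a + b * (P ^^ n) f x)" using Suc by auto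
  then show ?case
    using step_affine[OF measurable_iterate[OF assms(1)] iterate_bounds[OF assms]] by simp
qed auto

lemma step_mono:
  assumes "f \<in> borel_measurable borel" "\<And>x. f x \<in> {lo..hi}"
    and "g \<in> borel_measurable borel" "\<And>x. g x \<in> {lo'..hi'}" and "\<And>x. f x \<le> g x"
  shows "P f x \<le> P g x"
  unfolding step_op_def
  using integrable_step[OF assms(1,2)] integrable_step[OF assms(3,4)] assms(5)
  by (intro integral_mono) auto

lemma iterate_mono:
  assumes "f \<in> borel_measurable borel" "\<And>x. f x \<in> {lo..hi}"
    and "g \<in> borel_measurable borel" "\<And>x. g x \<in> {lo'..hi'}" and "\<And>x. f x \<le> g x"
  shows "(P ^^ n) f x \<le> (P ^^ n) g x"
proof (induction n arbitrary: x)
  case (Suc n)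
  then show ?case
    using assms by (auto intro!: step_mono measurable_iterate iterate_bounds simp del: atLeastAtMost_iff)
qed (use assms in auto)

text \<open>On periodic functions the chain of angles is a chain on the circle, so starting angles
  may later be moved by multiples of \<open>2 * pi\<close>.\<close>

lemma iterate_periodic:
  assumes "\<And>x. f (x + 2 * pi) = f x"
  shows "(P ^^ n) f (x + 2 * pi) = (P ^^ n) f x"
proof (induction n arbitrary: x)
  case (Suc n)
  have "(P ^^ n) f (x + 2 * pi - 2 * K * \<tau> * sin (x + 2 * pi) + \<sigma> * w) =
      (P ^^ n) f (x - 2 * K * \<tau> * sin x + \<sigma> * w)" for w
    using Suc[of "x - 2 * K * \<tau> * sin x + \<sigma> * w"]
    by (simp only: sin_periodic) (simp add: algebra_simps)
  then show ?case unfolding funpow.simps o_def step_op_def[of _ _ _ "(P ^^ n) f"] by simp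
qed (use assms in auto)

text \<open>The two starting points are \<open>c n\<close> apart and the noise is shifted so
  that the distance drops by \<open>c\<close> in each step. Every shift costs a relative entropy of at most \<open>\<kappa>\<close>.\<close>

lemma log_harnack:
  assumes f: "f \<in> borel_measurable borel" "\<And>x. f x \<in> {lo..hi}"
    and "n \<le> N"
    and \<kappa>: "(\<bar>c\<bar> * (1 + 2 * K * \<tau> * N) / \<sigma>)\<^sup>2 / (2 * \<tau>) \<le> \<kappa>"
  shows "(P ^^ n) f (x + c * n) \<le> ln ((P ^^ n) (\<lambda>x. exp (f x)) x) + n * \<kappa>"
  using \<open>n \<le> N\<close>
proof (induction n arbitrary: x)
  case (Suc n)
  let ?V = "(P ^^ n) f" and ?U = "(P ^^ n) (\<lambda>x. exp (f x))"
  define y where "y = x + c * Suc n"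
  \<comment> \<open>The shift that makes the chain from \<open>y\<close> with noise \<open>w\<close>
    land exactly \<open>c * n\<close> beyond the chain from \<open>x\<close> with noise
    \<open>w + v\<close>: it takes \<open>c\<close> off the distance and cancels the difference of
    the drifts.\<close>
  define v where "v = (c - 2 * K * \<tau> * (sin y - sin x)) / \<sigma>"
  have ef: "(\<lambda>x. exp (f x)) \<in> borel_measurable borel" "\<And>x. exp (f x) \<in> {exp lo..exp hi}"
    using f by auto
  have U: "exp lo \<le> ?U x" "?U x \<le> exp hi" for x
    using iterate_bounds[OF ef] by auto
  have [measurable]: "?U \<in> borel_measurable borel" "?V \<in> borel_measurable borel"
    using f ef by (auto intro: measurable_iterate)
  have "\<bar>sin y - sin x\<bar> \<le> \<bar>y - x\<bar>" by (rule abs_sin_diff_le)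
  also have "\<dots> = \<bar>c\<bar> * Suc n" by (simp add: y_def abs_mult)
  \<comment> \<open>Estimating the current distance by \<open>\<bar>c\<bar> * N\<close>, the largest
    one that can occur, makes the cost \<open>\<kappa>\<close> the same for all steps.\<close>
  also have "\<dots> \<le> \<bar>c\<bar> * N" using Suc.prems by (intro mult_left_mono) auto
  finally have "2 * K * \<tau> * \<bar>sin y - sin x\<bar> \<le> 2 * K * \<tau> * (\<bar>c\<bar> * N)"
    using K \<tau> by (intro mult_left_mono) auto
  moreover have "\<bar>c - 2 * K * \<tau> * (sin y - sin x)\<bar> \<le> \<bar>c\<bar> + 2 * K * \<tau> * \<bar>sin y - sin x\<bar>"
    using abs_triangle_ineq4[of c "2 * K * \<tau> * (sin y - sin x)"] K \<tau> by (simp add: abs_mult)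
  ultimately have "\<bar>c - 2 * K * \<tau> * (sin y - sin x)\<bar> \<le> \<bar>c\<bar> * (1 + 2 * K * \<tau> * N)"
    by (simp add: algebra_simps)
  then have "\<bar>v\<bar> \<le> \<bar>c\<bar> * (1 + 2 * K * \<tau> * N) / \<sigma>"
    unfolding v_def using \<sigma> by (simp add: divide_right_mono)
  then have "v\<^sup>2 \<le> (\<bar>c\<bar> * (1 + 2 * K * \<tau> * N) / \<sigma>)\<^sup>2"
    by (metis abs_ge_zero power2_abs power_mono)
  then have v: "v\<^sup>2 / (2 * \<tau>) \<le> \<kappa>"
    using \<kappa> \<tau> divide_right_mono[of "v\<^sup>2" _ "2 * \<tau>"] by fastforce
  have lnU: "ln (?U z) \<in> {lo..hi}" for z
  proof -
    have "0 < ?U z" using U(1)[of z] exp_gt_zero[of lo] by linarith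
    then show ?thesis
      using U[of z] ln_le_cancel_iff[of "?U z" "exp hi"] by (simp add: ln_ge_iff)
  qed
  let ?z = "x - 2 * K * \<tau> * sin x"
  have "(P ^^ Suc n) f y = (\<integral>w. ?V (?z + \<sigma> * (w + v) + c * n) \<partial>gauss \<tau>)"
  proof -
    have "\<sigma> * v = c - 2 * K * \<tau> * (sin y - sin x)" using \<sigma> by (simp add: v_def)
    then have "y - 2 * K * \<tau> * sin y + \<sigma> * w = ?z + \<sigma> * (w + v) + c * n" for w
      by (simp add: y_def algebra_simps)
    then show ?thesis by (simp add: step_op_def[of K \<sigma> \<tau> ?V])
  qed
  also have "\<dots> \<le> (\<integral>w. ln (?U (?z + \<sigma> * (w + v))) + n * \<kappa> \<partial>gauss \<tau>)"
  proof (rule integral_mono)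
    show "integrable (gauss \<tau>) (\<lambda>w. ?V (?z + \<sigma> * (w + v) + c * n))"
      using integrable_step[OF measurable_iterate[OF f(1)] iterate_bounds[OF f], of n "?z + \<sigma> * v + c * n"]
      by (simp add: algebra_simps)
    show "integrable (gauss \<tau>) (\<lambda>w. ln (?U (?z + \<sigma> * (w + v))) + n * \<kappa>)"
      using integrable_step[of "\<lambda>x. ln (?U x)" lo hi "?z + \<sigma> * v"] lnU
      by (simp add: algebra_simps)
  qed (use Suc in auto)
  also have "\<dots> = (\<integral>w. ln (?U (?z + \<sigma> * (w + v))) \<partial>gauss \<tau>) + n * \<kappa>"
    using integrable_step[of "\<lambda>x. ln (?U x)" lo hi "?z + \<sigma> * v"] lnU
    using G.prob_space by (simp add: algebra_simps)
  \<comment> \<open>The induction hypothesis was applied at the point reached with the shifted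
    noise. Now the shift is paid for in entropy, and the unshifted chain from \<open>x\<close>
    remains.\<close>
  also have "\<dots> \<le> ln (\<integral>w. ?U (?z + \<sigma> * w) \<partial>gauss \<tau>) + v\<^sup>2 / (2 * \<tau>) + n * \<kappa>"
    using gauss_shift_entropy[OF \<tau>, of "\<lambda>w. ?U (?z + \<sigma> * w)" "exp lo" "exp hi" v] U
    by (simp add: algebra_simps)
  also have "\<dots> \<le> ln ((P ^^ Suc n) (\<lambda>x. exp (f x)) x) + Suc n * \<kappa>"
    using v by (simp add: step_op_def[of K \<sigma> \<tau> ?U] algebra_simps)
  finally show ?case by (simp add: y_def)
qed simp

text \<open>If \<open>f\<close> has a small mean at \<open>x\<close>, the log-Harnack inequality for
  \<open>exp (a * f)\<close> keeps its mean at \<open>y\<close> away from 1; if its mean at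
  \<open>x\<close> is not small, the difference is bounded because \<open>f \<le> 1\<close>.\<close>

lemma contraction_unit:
  assumes f: "f \<in> borel_measurable borel" "\<And>x. f x \<in> {0..1}"
    and S: "N * ((\<bar>y - x\<bar> / N * (1 + 2 * K * \<tau> * N) / \<sigma>)\<^sup>2 / (2 * \<tau>)) \<le> S" and N: "0 < N"
  shows "(P ^^ N) f y - (P ^^ N) f x \<le> 1 - exp (- 2 * (S + ln 2))"
proof -
  \<comment> \<open>Chosen so that \<open>(S + ln 2) / a = 1/2\<close>. The threshold between the
    two cases below is \<open>exp (- a)\<close>.\<close>
  define a where "a = 2 * (S + ln 2)"
  define \<kappa> where "\<kappa> = (\<bar>y - x\<bar> / N * (1 + 2 * K * \<tau> * N) / \<sigma>)\<^sup>2 / (2 * \<tau>)"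
  have "0 \<le> \<kappa>" unfolding \<kappa>_def using \<tau> by simp
  then have "0 \<le> S" using S unfolding \<kappa>_def[symmetric] by (meson mult_nonneg_nonneg of_nat_0_le_iff order_trans)
  then have a: "2 * ln 2 \<le> a" by (simp add: a_def)
  have ln2: "0 < ln (2::real)" by simp
  have a0: "0 < a" using a ln2 by linarith
  define p q where "p = (P ^^ N) f y" and "q = (P ^^ N) f x"
  have pq: "p \<in> {0..1}" "q \<in> {0..1}"
    unfolding p_def q_def using iterate_bounds[OF f] by auto
  have af: "(\<lambda>x. a * f x) \<in> borel_measurable borel" "\<And>x. a * f x \<in> {0..a}"
    using f a0 by (auto simp: mult_left_le)
  have ef: "(\<lambda>x. exp (a * f x)) \<in> borel_measurable borel" "\<And>x. exp (a * f x) \<in> {exp 0..exp a}"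
    using af by auto
  have lf: "(\<lambda>x. 1 + (exp a - 1) * f x) \<in> borel_measurable borel" 
    "\<And>x. 1 + (exp a - 1) * f x \<in> {1..exp a}"
  proof -
    show "1 + (exp a - 1) * f x \<in> {1..exp a}" for x
    proof -
      have "0 \<le> (exp a - 1) * f x" "(exp a - 1) * f x \<le> (exp a - 1) * 1"
        using f(2)[of x] a0 by (auto intro!: mult_nonneg_nonneg mult_left_mono)
      then show ?thesis by auto
    qed
  qed (use f in auto)
  have "a * p = (P ^^ N) (\<lambda>x. a * f x) y"
    using iterate_affine[OF f, of N 0 a y] by (simp add: p_def)
  also have "\<dots> \<le> ln ((P ^^ N) (\<lambda>x. exp (a * f x)) x) + N * \<kappa>"
    using log_harnack[OF af, of N N "(y - x) / N" \<kappa> x] N by (simp add: \<kappa>_def)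
  also have "\<dots> \<le> ln ((P ^^ N) (\<lambda>x. 1 + (exp a - 1) * f x) x) + S"
  proof (intro add_mono)
    \<comment> \<open>By convexity the exponential lies below its chord on the range of
      \<open>f\<close>, so its mean is at most an affine function of \<open>q\<close>.\<close>
    have "(P ^^ N) (\<lambda>x. exp (a * f x)) x \<le> (P ^^ N) (\<lambda>x. 1 + (exp a - 1) * f x) x"
    proof (rule iterate_mono[OF ef lf])
      fix x
      show "exp (a * f x) \<le> 1 + (exp a - 1) * f x"
        using convex_onD[OF exp_convex, of "f x" 0 a] f(2)[of x] by (simp add: algebra_simps)
    qed
    moreover have "0 < (P ^^ N) (\<lambda>x. exp (a * f x)) x"
      using iterate_bounds[OF ef, of N x] by auto
    ultimately show "ln ((P ^^ N) (\<lambda>x. exp (a * f x)) x) \<le> ln ((P ^^ N) (\<lambda>x. 1 + (exp a - 1) * f x) x)"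
      by simp
  qed (use S in \<open>simp add: \<kappa>_def\<close>)
  also have "\<dots> = ln (1 + (exp a - 1) * q) + S"
    using iterate_affine[OF f] by (simp add: q_def)
  finally have main: "a * p \<le> ln (1 + (exp a - 1) * q) + S" .
  \<comment> \<open>For \<open>q\<close> below the threshold the logarithm in \<open>main\<close> is
    at most \<open>ln 2\<close>, so \<open>p \<le> 1/2\<close>, while
    \<open>exp (- a) \<le> 1/2\<close>. Otherwise \<open>p \<le> 1\<close> is enough.\<close>
  have "p - q \<le> 1 - exp (- a)"
  proof (cases "q \<le> exp (- a)")
    case True
    have "(exp a - 1) * q \<le> exp a * exp (- a)"
      using True pq a0 by (intro mult_mono) auto
    then have "1 + (exp a - 1) * q \<le> 2" by (simp add: exp_minus_inverse)
    moreover have "0 \<le> (exp a - 1) * q" using pq a0 by auto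
    ultimately have "ln (1 + (exp a - 1) * q) \<le> ln 2" by (subst ln_le_cancel_iff) auto
    with main have "a * p \<le> a * (1/2)" by (simp add: a_def)
    then have "p \<le> 1/2" using a0 by simp
    moreover have "exp (- a) \<le> exp (- ln 2)" using a ln2 by (subst exp_le_cancel_iff) linarith
    then have "exp (- a) \<le> 1/2" by (simp add: exp_minus)
    ultimately show ?thesis using pq by auto
  qed (use pq in auto)
  then show ?thesis by (simp add: p_def q_def a_def algebra_simps)
qed

end

text \<open>The bound on the total entropy cost for starting points at distance at most \<open>2 \<pi>\<close> and a time span
  \<open>N \<tau> \<in> [1, 2]\<close>.\<close>

definition entropy_cost :: "real \<Rightarrow> real \<Rightarrow> real" where
  "entropy_cost K \<sigma> = (2 * pi * (1 + 4 * K) / \<sigma>)\<^sup>2 / 2"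

text \<open>The \<delta> of the contraction factor \<open>1 - \<delta>\<close>: it is
  \<open>exp (- a)\<close> for the \<open>a\<close> of \<open>contraction_unit\<close>, with
  \<open>entropy_cost\<close> as \<open>S\<close>.\<close>

definition overlap :: "real \<Rightarrow> real \<Rightarrow> real" where
  "overlap K \<sigma> = exp (- 2 * (entropy_cost K \<sigma> + ln 2))"

lemma overlap: "0 < overlap K \<sigma>" "overlap K \<sigma> < 1"
proof -
  have "0 \<le> entropy_cost K \<sigma>" by (simp add: entropy_cost_def)
  moreover have "0 < ln (2::real)" by simp
  ultimately have "0 < entropy_cost K \<sigma> + ln 2" by (rule add_nonneg_pos)
  then have "- 2 * (entropy_cost K \<sigma> + ln 2) < 0" by (simp del: minus_add_distrib)
  then show "overlap K \<sigma> < 1" by (simp add: overlap_def del: mult_minus_left minus_add_distrib)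
qed (simp add: overlap_def)

context euler_step
begin

text \<open>Rescaling reduces an arbitrary oscillation to the range \<open>{0..1}\<close>, and
  periodicity reduces arbitrary angles to angles at most \<open>2 * pi\<close> apart, the distance
  covered by \<open>entropy_cost\<close>.\<close>

lemma contraction:
  assumes f: "f \<in> borel_measurable borel" "\<And>x. f (x + 2 * pi) = f x"
    and osc: "\<And>y x. f y - f x \<le> w" and w: "0 < w"
    and N: "1 \<le> N * \<tau>" "N * \<tau> \<le> 2"
  shows "(P ^^ N) f y - (P ^^ N) f x \<le> (1 - overlap K \<sigma>) * w"
proof -
  have N0: "0 < N" using N \<tau> by (cases N) auto
  define lo where "lo = (INF x. f x)"
  have bdd: "bdd_below (range f)"
    using osc[of 0] by (intro bdd_belowI[where m="f 0 - w"]) (auto simp: algebra_simps)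
  define g where "g x = (f x - lo) / w" for x
  have g: "g \<in> borel_measurable borel" "g x \<in> {0..1}" for x
  proof -
    have "lo \<le> f x" unfolding lo_def using bdd by (rule cINF_lower) simp
    moreover have "f x - w \<le> lo" unfolding lo_def
      using osc[of x] by (intro cINF_greatest) (auto simp: algebra_simps)
    ultimately show "g x \<in> {0..1}" using w by (simp add: g_def)
  qed (use f in \<open>simp add: g_def[abs_def]\<close>)
  have fg: "f = (\<lambda>x. lo + w * g x)" using w by (auto simp: g_def)
  have near: "(P ^^ N) f y - (P ^^ N) f x \<le> (1 - overlap K \<sigma>) * w" if "\<bar>y - x\<bar> \<le> 2 * pi" for x y
  proof -
    define s where "s = N * \<tau>"
    have s: "1 \<le> s" "s \<le> 2" using N by (auto simp: s_def)
    \<comment> \<open>A shift of order \<open>1 / N\<close> costs entropy of order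
      \<open>1 / (N\<^sup>2 * \<tau>)\<close>, and there are \<open>N\<close> of them: the total
      depends on \<open>N\<close> and \<tau> only through the duration \<open>s\<close>. This is
      what makes the contraction uniform in the step size.\<close>
    have "N * ((\<bar>y - x\<bar> / N * (1 + 2 * K * \<tau> * N) / \<sigma>)\<^sup>2 / (2 * \<tau>)) = (\<bar>y - x\<bar> * (1 + 2 * K * s) / \<sigma>)\<^sup>2 / (2 * s)"
    proof -
      have "real N * (u\<^sup>2 / (2 * \<tau>)) = (N * u)\<^sup>2 / (2 * s)" for u :: real
        using N0 \<tau> by (simp add: s_def power2_eq_square divide_simps)
      moreover have "N * (\<bar>y - x\<bar> / N * (1 + 2 * K * \<tau> * N) / \<sigma>) = \<bar>y - x\<bar> * (1 + 2 * K * s) / \<sigma>"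
        using N0 by (simp add: s_def mult_ac)
      ultimately show ?thesis by simp
    qed
    also have "\<dots> \<le> (2 * pi * (1 + 4 * K) / \<sigma>)\<^sup>2 / 2"
      using s that K \<sigma> by (intro frac_le power_mono divide_right_mono mult_mono) auto
    finally have "(P ^^ N) g y - (P ^^ N) g x \<le> 1 - overlap K \<sigma>"
      unfolding overlap_def entropy_cost_def by (rule contraction_unit[OF g _ N0])
    then have "w * ((P ^^ N) g y - (P ^^ N) g x) \<le> w * (1 - overlap K \<sigma>)"
      using w by (intro mult_left_mono) auto
    then show ?thesis using iterate_affine[OF g] by (simp add: fg algebra_simps)
  qed
  have per: "(P ^^ N) f (z + of_int k * (2 * pi)) = (P ^^ N) f z" for z k
  proof -
    have nat: "(P ^^ N) f (z + real n * (2 * pi)) = (P ^^ N) f z" for z n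
    proof (induction n)
      case (Suc n)
      then show ?case
        using iterate_periodic[of f N "z + real n * (2 * pi)"] f(2) by (simp add: algebra_simps)
    qed simp
    show ?thesis
    proof (cases k)
      case (neg n)
      have "z + of_int k * (2 * pi) + real (Suc n) * (2 * pi) = z"
        unfolding neg by (simp add: algebra_simps)
      then show ?thesis using nat[of "z + of_int k * (2 * pi)" "Suc n"] by metis
    qed (use nat in auto)
  qed
  \<comment> \<open>Rounding down moves \<open>y\<close> to a point at most \<open>x\<close> and
    less than one period below it.\<close>
  define k where "k = \<lfloor>(x - y) / (2 * pi)\<rfloor>"
  have "of_int k \<le> (x - y) / (2 * pi)" "(x - y) / (2 * pi) < of_int k + 1"
    unfolding k_def by linarith+
  then have "of_int k * (2 * pi) \<le> x - y" "x - y < (of_int k + 1) * (2 * pi)"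
    by (simp_all add: pos_le_divide_eq pos_divide_less_eq)
  then have "\<bar>(y + of_int k * (2 * pi)) - x\<bar> \<le> 2 * pi" by (auto simp: algebra_simps)
  from near[OF this] show ?thesis by (simp add: per)
qed

text \<open>The iterate over \<open>m\<close> blocks is again periodic, so the oscillation bound of
  the induction hypothesis can be fed into one more block.\<close>

lemma contraction_iterate:
  assumes f: "f \<in> borel_measurable borel" "\<And>x. f (x + 2 * pi) = f x"
    and osc: "\<And>x. f x \<in> {0..1}"
    and N: "1 \<le> N * \<tau>" "N * \<tau> \<le> 2"
  shows "(P ^^ (N * m)) f y - (P ^^ (N * m)) f x \<le> (1 - overlap K \<sigma>) ^ m"
proof (induction m arbitrary: x y)
  case 0
  then show ?case using osc[of x] osc[of y] by auto
next
  case (Suc m)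
  have "(P ^^ N) ((P ^^ (N * m)) f) y - (P ^^ N) ((P ^^ (N * m)) f) x \<le> (1 - overlap K \<sigma>) * (1 - overlap K \<sigma>) ^ m"
    using Suc overlap[of K \<sigma>] N f iterate_periodic[of f]
    by (intro contraction) (auto intro: measurable_iterate)
  moreover have "(P ^^ (N * Suc m)) f = (P ^^ N) ((P ^^ (N * m)) f)"
    by (simp add: funpow_add o_def)
  ultimately show ?case by simp
qed

end

section \<open>Brownian increments\<close>

context brownian_motion
begin

lemma space_F [simp]: "space (F t) = space M"
  using subalgebra_F[of t] by (simp add: subalgebra_def)

lemma measurable_F: "f \<in> measurable (F t) N \<Longrightarrow> f \<in> measurable M N"
  using measurable_from_subalg[OF subalgebra_F] .

lemma measurable_F_mono:
  assumes "s \<le> t" "f \<in> measurable (F s) N"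
  shows "f \<in> measurable (F t) N"
  using assms sets_F_mono[OF assms(1)] by (auto simp: measurable_def)

lemma measurable_W: "0 \<le> t \<Longrightarrow> W t \<in> borel_measurable M"
  using adapted measurable_F by blast

lemma measurable_W_F: "0 \<le> s \<Longrightarrow> s \<le> t \<Longrightarrow> W s \<in> borel_measurable (F t)"
  using adapted measurable_F_mono by blast

lemma distr_increment:
  assumes "0 \<le> s" "s < t"
  shows "distr M borel (\<lambda>\<omega>. W t \<omega> - W s \<omega>) = gauss (t - s)"
  using distributed_distr_eq_density[OF increment_distributed[OF assms]]
  by (simp add: gauss_def distr_cong[of M M borel lborel])

text \<open>The locale assumes independence of two families of events. Both are stable under
  intersection, so it passes to the generated sigma-algebras and from there to every
  \<open>X\<close> measurable at time \<open>s\<close>.\<close>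

lemma indep_increment:
  assumes st: "0 \<le> s" "s < t" and X: "X \<in> measurable (F s) N"
  shows "indep_var N X borel (\<lambda>\<omega>. W t \<omega> - W s \<omega>)"
  unfolding indep_var_eq
proof (intro conjI)
  let ?Y = "\<lambda>\<omega>. W t \<omega> - W s \<omega>"
  show "random_variable N X" using X by (rule measurable_F)
  show Y: "random_variable borel ?Y"
    using st by (auto intro!: borel_measurable_diff measurable_W)
  have "indep_set (sigma_sets (space M) (sets (F s)))
      (sigma_sets (space M) {?Y -` B \<inter> space M |B. B \<in> sets borel})"
  proof (rule indep_set_sigma_sets[OF increment_indep[OF st]])
    show "Int_stable (sets (F s))" by (auto simp: Int_stable_def)
    show "Int_stable {?Y -` B \<inter> space M |B. B \<in> sets borel}"
    proof (rule Int_stableI, safe)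
      fix A B :: "real set" assume "A \<in> sets borel" "B \<in> sets borel"
      then show "\<exists>C. ?Y -` A \<inter> space M \<inter> (?Y -` B \<inter> space M) = ?Y -` C \<inter> space M \<and> C \<in> sets borel"
        by (intro exI[of _ "A \<inter> B"]) auto
    qed
  qed
  moreover have "sigma_sets (space M) {X -` A \<inter> space M |A. A \<in> sets N} \<subseteq> sigma_sets (space M) (sets (F s))"
    using measurable_sets[OF X] by (intro sigma_sets_mono') auto
  ultimately show "indep_set (sigma_sets (space M) {X -` A \<inter> space M |A. A \<in> sets N})
      (sigma_sets (space M) {?Y -` B \<inter> space M |B. B \<in> sets borel})"
    unfolding indep_set_def by (elim indep_sets_mono_sets) (auto split: bool.split)
qed

lemma integral_increment:
  fixes g :: "real \<Rightarrow> real"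
  assumes "0 \<le> s" "s < t" "g \<in> borel_measurable borel"
  shows "(\<integral>\<omega>. g (W t \<omega> - W s \<omega>) \<partial>M) = (\<integral>w. g w \<partial>gauss (t - s))"
    and "integrable M (\<lambda>\<omega>. g (W t \<omega> - W s \<omega>)) \<longleftrightarrow> integrable (gauss (t - s)) g"
proof -
  have "(\<lambda>\<omega>. W t \<omega> - W s \<omega>) \<in> borel_measurable M"
    using assms by (auto intro!: borel_measurable_diff measurable_W)
  then show "(\<integral>\<omega>. g (W t \<omega> - W s \<omega>) \<partial>M) = (\<integral>w. g w \<partial>gauss (t - s))"
    "integrable M (\<lambda>\<omega>. g (W t \<omega> - W s \<omega>)) \<longleftrightarrow> integrable (gauss (t - s)) g"
    using assms by (simp_all add: distr_increment[symmetric] integral_distr integrable_distr_eq)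
qed

lemma integral_times_increment:
  fixes X :: "'a \<Rightarrow> real"
  assumes st: "0 \<le> s" "s < t" and X: "X \<in> borel_measurable (F s)" "integrable M X"
    and g: "g \<in> borel_measurable borel" "integrable (gauss (t - s)) g"
  shows "(\<integral>\<omega>. X \<omega> * g (W t \<omega> - W s \<omega>) \<partial>M) = (\<integral>\<omega>. X \<omega> \<partial>M) * (\<integral>w. g w \<partial>gauss (t - s))"
    and "integrable M (\<lambda>\<omega>. X \<omega> * g (W t \<omega> - W s \<omega>))"
proof -
  have ind: "indep_var borel X borel (\<lambda>\<omega>. g (W t \<omega> - W s \<omega>))"
    using indep_var_compose[OF indep_increment[OF st X(1)] measurable_ident_sets[OF refl] g(1)]
    by (simp add: o_def id_def)
  have int: "integrable M (\<lambda>\<omega>. g (W t \<omega> - W s \<omega>))"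
    using integral_increment(2)[OF st g(1)] g by simp
  show "(\<integral>\<omega>. X \<omega> * g (W t \<omega> - W s \<omega>) \<partial>M) = (\<integral>\<omega>. X \<omega> \<partial>M) * (\<integral>w. g w \<partial>gauss (t - s))"
    using indep_var_lebesgue_integral[OF ind X(2) int] integral_increment(1)[OF st g(1)] by simp
  show "integrable M (\<lambda>\<omega>. X \<omega> * g (W t \<omega> - W s \<omega>))"
    by (rule indep_var_integrable[OF ind X(2) int])
qed

text \<open>Since \<open>X\<close> and the increment are independent, their joint law is a product,
  and Fubini integrates the increment out with \<open>X\<close> held fixed. This acts as the Markov
  property of the Euler chain.\<close>

lemma integral_fun_increment:
  fixes f :: "real \<times> real \<Rightarrow> real"
  assumes st: "0 \<le> s" "s < t" and X: "X \<in> borel_measurable (F s)"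
    and f[measurable]: "f \<in> borel_measurable (borel \<Otimes>\<^sub>M borel)" and B: "\<And>z. \<bar>f z\<bar> \<le> B"
  shows "(\<integral>\<omega>. f (X \<omega>, W t \<omega> - W s \<omega>) \<partial>M) = (\<integral>\<omega>. (\<integral>w. f (X \<omega>, w) \<partial>gauss (t - s)) \<partial>M)"
proof -
  let ?Y = "\<lambda>\<omega>. W t \<omega> - W s \<omega>"
  have [measurable]: "X \<in> borel_measurable M" using X by (rule measurable_F)
  have [measurable]: "?Y \<in> borel_measurable M"
    using st by (auto intro!: borel_measurable_diff measurable_W)
  interpret X: prob_space "distr M borel X" by (rule prob_space_distr) simp
  interpret Y: prob_space "gauss (t - s)" using st by (intro prob_space_gauss) simp
  interpret XY: pair_prob_space "distr M borel X" "gauss (t - s)" ..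
  have eq: "distr M borel X \<Otimes>\<^sub>M gauss (t - s) = distr M (borel \<Otimes>\<^sub>M borel) (\<lambda>\<omega>. (X \<omega>, ?Y \<omega>))"
    using indep_increment[OF st X] distr_increment[OF st] by (simp add: indep_var_distribution_eq)
  have "(\<integral>\<omega>. f (X \<omega>, ?Y \<omega>) \<partial>M) = (\<integral>z. f z \<partial>(distr M borel X \<Otimes>\<^sub>M gauss (t - s)))"
    unfolding eq by (subst integral_distr) auto
  also have "\<dots> = (\<integral>x. (\<integral>w. f (x, w) \<partial>gauss (t - s)) \<partial>distr M borel X)"
    using B by (intro XY.integral_fst'[symmetric] XY.P.integrable_const_bound[where B=B]) auto
  also have "\<dots> = (\<integral>\<omega>. (\<integral>w. f (X \<omega>, w) \<partial>gauss (t - s)) \<partial>M)"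
    by (subst integral_distr) auto
  finally show ?thesis .
qed

end

text \<open>The chain is driven by the given \<open>W\<close> at the grid times. It is thus a Markov
  chain with operator \<open>step_op\<close> and at the same time a pathwise approximation of the
  solution driven by the same \<open>W\<close>.\<close>

primrec euler_angle ::
    "real \<Rightarrow> real \<Rightarrow> (real \<Rightarrow> 'a \<Rightarrow> real) \<Rightarrow> real \<Rightarrow> real \<Rightarrow> nat \<Rightarrow> 'a \<Rightarrow> real" where
  "euler_angle K \<sigma> W \<tau> \<theta> 0 \<omega> = \<theta>"
| "euler_angle K \<sigma> W \<tau> \<theta> (Suc k) \<omega> =
     euler_angle K \<sigma> W \<tau> \<theta> k \<omega> - 2 * K * \<tau> * sin (euler_angle K \<sigma> W \<tau> \<theta> k \<omega>)
       + \<sigma> * (W (real (Suc k) * \<tau>) \<omega> - W (real k * \<tau>) \<omega>)"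

context brownian_motion
begin

lemma measurable_euler_angle:
  assumes "0 < \<tau>"
  shows "euler_angle K \<sigma> W \<tau> \<theta> k \<in> borel_measurable (F (k * \<tau>))"
proof (induction k)
  case (Suc k)
  have 1[measurable]: "euler_angle K \<sigma> W \<tau> \<theta> k \<in> borel_measurable (F (Suc k * \<tau>))"
    using assms by (intro measurable_F_mono[OF _ Suc]) (simp add: algebra_simps)
  have 2[measurable]: "W (Suc k * \<tau>) \<in> borel_measurable (F (Suc k * \<tau>))" "W (k * \<tau>) \<in> borel_measurable (F (Suc k * \<tau>))"
    using assms by (auto intro!: measurable_W_F mult_right_mono)
  show ?case unfolding euler_angle.simps[abs_def] by measurable
qed (simp add: euler_angle.simps[abs_def])

text \<open>The last step is integrated out first and turns \<open>f\<close> into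
  \<open>step_op K \<sigma> \<tau> f\<close>, so the induction hypothesis is needed for all bounded
  functions.\<close>

lemma expectation_euler_angle:
  assumes pos: "0 < K" "0 < \<sigma>" "0 < \<tau>" and f: "f \<in> borel_measurable borel" "\<And>x. f x \<in> {lo..hi}"
  shows "(\<integral>\<omega>. f (euler_angle K \<sigma> W \<tau> \<theta> k \<omega>) \<partial>M) = (step_op K \<sigma> \<tau> ^^ k) f \<theta>"
  using f
proof (induction k arbitrary: f)
  case 0
  then show ?case by (simp add: prob_space)
next
  case (Suc k)
  interpret euler_step K \<sigma> \<tau> using pos by unfold_locales
  note [measurable] = Suc.prems(1)
  let ?\<theta> = "euler_angle K \<sigma> W \<tau> \<theta> k"
  let ?f = "\<lambda>(x, w). f (x - 2 * K * \<tau> * sin x + \<sigma> * w)"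
  have "(\<integral>\<omega>. f (euler_angle K \<sigma> W \<tau> \<theta> (Suc k) \<omega>) \<partial>M) = (\<integral>\<omega>. ?f (?\<theta> \<omega>, W (Suc k * \<tau>) \<omega> - W (k * \<tau>) \<omega>) \<partial>M)"
    by simp
  also have "\<dots> = (\<integral>\<omega>. (\<integral>w. ?f (?\<theta> \<omega>, w) \<partial>gauss (Suc k * \<tau> - k * \<tau>)) \<partial>M)"
  proof (rule integral_fun_increment)
    show "\<bar>?f z\<bar> \<le> max \<bar>lo\<bar> \<bar>hi\<bar>" for z
      using Suc.prems(2)[of "fst z - 2 * K * \<tau> * sin (fst z) + \<sigma> * snd z"] by (auto simp: case_prod_beta)
  qed (use pos measurable_euler_angle in \<open>auto simp: algebra_simps\<close>)
  also have "\<dots> = (\<integral>\<omega>. step_op K \<sigma> \<tau> f (?\<theta> \<omega>) \<partial>M)"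
    by (simp add: step_op_def algebra_simps)
  also have "\<dots> = (step_op K \<sigma> \<tau> ^^ k) (step_op K \<sigma> \<tau> f) \<theta>"
    using Suc.prems by (intro Suc.IH measurable_step step_bounds)
  finally show ?case by (simp add: funpow_swap1)
qed

section \<open>Mixed moments of Brownian increments\<close>

lemma integral_times_increment_power:
  fixes X :: "'a \<Rightarrow> real"
  assumes st: "0 \<le> s" "s \<le> t" and X: "X \<in> borel_measurable (F s)" "integrable M X"
  shows "integrable M (\<lambda>\<omega>. X \<omega> * (W t \<omega> - W s \<omega>) ^ k)"
    and "(\<integral>\<omega>. X \<omega> * (W t \<omega> - W s \<omega>) \<partial>M) = 0"
    and "(\<integral>\<omega>. X \<omega> * (W t \<omega> - W s \<omega>)\<^sup>2 \<partial>M) = (\<integral>\<omega>. X \<omega> \<partial>M) * (t - s)"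
proof -
  \<comment> \<open>The degenerate interval is treated apart: the law of the increment is given only
    for \<open>s < t\<close>.\<close>
  consider "s = t" | "s < t" using st by linarith
  then have "integrable M (\<lambda>\<omega>. X \<omega> * (W t \<omega> - W s \<omega>) ^ k) \<and>
    (\<integral>\<omega>. X \<omega> * (W t \<omega> - W s \<omega>) \<partial>M) = 0 \<and>
    (\<integral>\<omega>. X \<omega> * (W t \<omega> - W s \<omega>)\<^sup>2 \<partial>M) = (\<integral>\<omega>. X \<omega> \<partial>M) * (t - s)"
  proof cases
    case 1
    then show ?thesis using X(2) by (cases "k = 0") auto
  next
    case 2
    have "0 < t - s" using 2 by simp
    note m = gauss_moments[OF this] and i = integral_times_increment[OF st(1) 2 X]
    show ?thesis
      using i(2)[OF _ m(1)[of k]] i(1)[OF _ m(1)[of 1, simplified]] i(1)[OF _ m(1)[of 2]] m(2,3)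
      by simp
  qed
  then show "integrable M (\<lambda>\<omega>. X \<omega> * (W t \<omega> - W s \<omega>) ^ k)"
    "(\<integral>\<omega>. X \<omega> * (W t \<omega> - W s \<omega>) \<partial>M) = 0"
    "(\<integral>\<omega>. X \<omega> * (W t \<omega> - W s \<omega>)\<^sup>2 \<partial>M) = (\<integral>\<omega>. X \<omega> \<partial>M) * (t - s)"
    by auto
qed

lemma integrable_bounded:
  fixes X :: "'a \<Rightarrow> 'b :: {banach, second_countable_topology}"
  assumes "X \<in> borel_measurable M" "\<And>\<omega>. \<omega> \<in> space M \<Longrightarrow> norm (X \<omega>) \<le> B"
  shows "integrable M X"
  using assms by (intro integrable_const_bound[where B=B]) auto

text \<open>Beyond \<open>b\<close> the longer increment is centred and independent of everything up
  to \<open>b\<close>, so only the square over the common part survives.\<close>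

lemma increment_product_common_start:
  fixes X :: "'a \<Rightarrow> real"
  assumes le: "0 \<le> c" "c \<le> b" "b \<le> d"
    and X: "X \<in> borel_measurable (F c)" "integrable M X"
  shows "integrable M (\<lambda>\<omega>. X \<omega> * (W b \<omega> - W c \<omega>) * (W d \<omega> - W c \<omega>))"
    and "(\<integral>\<omega>. X \<omega> * (W b \<omega> - W c \<omega>) * (W d \<omega> - W c \<omega>) \<partial>M) = (\<integral>\<omega>. X \<omega> \<partial>M) * (b - c)"
proof -
  note i1 = integral_times_increment_power[OF le(1,2) X]
  have Xb: "(\<lambda>\<omega>. X \<omega> * (W b \<omega> - W c \<omega>)) \<in> borel_measurable (F b)"
    using le by (intro borel_measurable_times borel_measurable_diff measurable_W_F
      measurable_F_mono[OF le(2) X(1)]) auto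
  have "0 \<le> b" using le by simp
  note i2 = integral_times_increment_power[OF this le(3) Xb i1(1)[of 1, simplified]]
  have eq: "(\<lambda>\<omega>. X \<omega> * (W b \<omega> - W c \<omega>) * (W d \<omega> - W c \<omega>)) =
     (\<lambda>\<omega>. X \<omega> * (W b \<omega> - W c \<omega>)\<^sup>2 + X \<omega> * (W b \<omega> - W c \<omega>) * (W d \<omega> - W b \<omega>))"
    by (auto simp: algebra_simps power2_eq_square)
  show "integrable M (\<lambda>\<omega>. X \<omega> * (W b \<omega> - W c \<omega>) * (W d \<omega> - W c \<omega>))"
    "(\<integral>\<omega>. X \<omega> * (W b \<omega> - W c \<omega>) * (W d \<omega> - W c \<omega>) \<partial>M) = (\<integral>\<omega>. X \<omega> \<partial>M) * (b - c)"
    unfolding eq using i1(1)[of 2] i1(3) i2(1)[of 1] i2(2) by simp_all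
qed

text \<open>The part of the first increment before \<open>c\<close> is known at time
  \<open>c\<close> and meets a centred increment, so it contributes nothing. What is left of it
  starts at \<open>c\<close> together with the second one.\<close>

lemma increment_product_ordered:
  fixes X :: "'a \<Rightarrow> real"
  assumes le: "0 \<le> a" "a \<le> b" "a \<le> c" "c \<le> d"
    and X: "X \<in> borel_measurable (F c)" "\<And>\<omega>. \<omega> \<in> space M \<Longrightarrow> \<bar>X \<omega>\<bar> \<le> B"
  shows "integrable M (\<lambda>\<omega>. X \<omega> * (W b \<omega> - W a \<omega>) * (W d \<omega> - W c \<omega>)) \<and>
    (\<integral>\<omega>. X \<omega> * (W b \<omega> - W a \<omega>) * (W d \<omega> - W c \<omega>) \<partial>M) =
      (\<integral>\<omega>. X \<omega> \<partial>M) * measure lborel ({a<..b} \<inter> {c<..d})"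
proof -
  have X': "integrable M X" using X measurable_F[OF X(1)] by (intro integrable_bounded) auto
  have c: "0 \<le> c" using le by simp
  have past: "integrable M (\<lambda>\<omega>. X \<omega> * (W e \<omega> - W a \<omega>) * (W d \<omega> - W c \<omega>))"
    "(\<integral>\<omega>. X \<omega> * (W e \<omega> - W a \<omega>) * (W d \<omega> - W c \<omega>) \<partial>M) = 0" if e: "a \<le> e" "e \<le> c" for e
  proof -
    have Wm: "W e \<in> borel_measurable (F c)" "W a \<in> borel_measurable (F c)"
      using e le by (auto intro!: measurable_W_F)
    have 1: "(\<lambda>\<omega>. X \<omega> * (W e \<omega> - W a \<omega>)) \<in> borel_measurable (F c)"
      by (intro borel_measurable_times borel_measurable_diff X(1) Wm)
    have inc: "integrable M (\<lambda>\<omega>. W e \<omega> - W a \<omega>)"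
      using integral_times_increment_power(1)[OF le(1) e(1) borel_measurable_const[of 1] integrable_const, of 1]
      by (simp only: mult_1_left power_one_right)
    have 2: "integrable M (\<lambda>\<omega>. X \<omega> * (W e \<omega> - W a \<omega>))"
    proof (rule Bochner_Integration.integrable_bound[OF integrable_mult_right[OF inc, of "\<bar>B\<bar>"]])
      show "AE \<omega> in M. norm (X \<omega> * (W e \<omega> - W a \<omega>)) \<le> norm (\<bar>B\<bar> * (W e \<omega> - W a \<omega>))"
      proof (rule AE_I2)
        fix \<omega> assume "\<omega> \<in> space M"
        from X(2)[OF this] have "\<bar>X \<omega>\<bar> \<le> \<bar>B\<bar>" by linarith
        then show "norm (X \<omega> * (W e \<omega> - W a \<omega>)) \<le> norm (\<bar>B\<bar> * (W e \<omega> - W a \<omega>))"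
          by (simp add: abs_mult mult_right_mono)
      qed
    qed (rule measurable_F[OF 1])
    note i = integral_times_increment_power[OF c le(4) 1 2]
    show "integrable M (\<lambda>\<omega>. X \<omega> * (W e \<omega> - W a \<omega>) * (W d \<omega> - W c \<omega>))"
      "(\<integral>\<omega>. X \<omega> * (W e \<omega> - W a \<omega>) * (W d \<omega> - W c \<omega>) \<partial>M) = 0"
      using i(1)[of 1] i(2) by simp_all
  qed
  show ?thesis
  proof (cases "b \<le> c")
    case True
    then have e: "{a<..b} \<inter> {c<..d} = {}" by auto
    show ?thesis unfolding e using past[OF le(2) True] by simp
  next
    case False
    have meas: "measure lborel ({a<..b} \<inter> {c<..d}) = min b d - c"
    proof -
      have "{a<..b} \<inter> {c<..d} = {c<..min b d}" using le by auto
      then show ?thesis using False le by simp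
    qed
    have now: "integrable M (\<lambda>\<omega>. X \<omega> * (W b \<omega> - W c \<omega>) * (W d \<omega> - W c \<omega>))
      \<and> (\<integral>\<omega>. X \<omega> * (W b \<omega> - W c \<omega>) * (W d \<omega> - W c \<omega>) \<partial>M) = (\<integral>\<omega>. X \<omega> \<partial>M) * (min b d - c)"
    proof (cases "b \<le> d")
      case True
      then show ?thesis
        using increment_product_common_start[OF c _ True X(1) X'] False by simp
    next
      case F: False
      have sw: "X \<omega> * (W b \<omega> - W c \<omega>) * (W d \<omega> - W c \<omega>) = X \<omega> * (W d \<omega> - W c \<omega>) * (W b \<omega> - W c \<omega>)" for \<omega>
        by (simp add: mult_ac)
      show ?thesis unfolding sw
        using increment_product_common_start[OF c le(4) _ X(1) X', of b] F by (simp add: min_def)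
    qed
    have eq: "(\<lambda>\<omega>. X \<omega> * (W b \<omega> - W a \<omega>) * (W d \<omega> - W c \<omega>)) =
      (\<lambda>\<omega>. X \<omega> * (W c \<omega> - W a \<omega>) * (W d \<omega> - W c \<omega>) + X \<omega> * (W b \<omega> - W c \<omega>) * (W d \<omega> - W c \<omega>))"
      by (auto simp: algebra_simps)
    show ?thesis unfolding eq meas using now past[OF le(3) order_refl] by simp
  qed
qed

text \<open>\<open>X\<close> is a product of two coefficients, each known at the start of its own
  interval, hence the maximum. Exchanging the intervals reduces to the ordered case.\<close>

lemma increment_product:
  fixes X :: "'a \<Rightarrow> real"
  assumes le: "0 \<le> a" "a \<le> b" "0 \<le> c" "c \<le> d"
    and X: "X \<in> borel_measurable (F (max a c))" "\<And>\<omega>. \<omega> \<in> space M \<Longrightarrow> \<bar>X \<omega>\<bar> \<le> B"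
  shows "integrable M (\<lambda>\<omega>. X \<omega> * (W b \<omega> - W a \<omega>) * (W d \<omega> - W c \<omega>)) \<and>
    (\<integral>\<omega>. X \<omega> * (W b \<omega> - W a \<omega>) * (W d \<omega> - W c \<omega>) \<partial>M) =
      (\<integral>\<omega>. X \<omega> \<partial>M) * measure lborel ({a<..b} \<inter> {c<..d})"
proof (cases "a \<le> c")
  case True
  then show ?thesis using increment_product_ordered[of a b c d X B] le X by (simp add: max_def)
next
  case False
  then have "max a c = a" by simp
  then have *: "integrable M (\<lambda>\<omega>. X \<omega> * (W d \<omega> - W c \<omega>) * (W b \<omega> - W a \<omega>)) \<and>
    (\<integral>\<omega>. X \<omega> * (W d \<omega> - W c \<omega>) * (W b \<omega> - W a \<omega>) \<partial>M) =
      (\<integral>\<omega>. X \<omega> \<partial>M) * measure lborel ({c<..d} \<inter> {a<..b})"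
    using le X False by (intro increment_product_ordered[where B=B]) auto
  have sw: "X \<omega> * (W b \<omega> - W a \<omega>) * (W d \<omega> - W c \<omega>) = X \<omega> * (W d \<omega> - W c \<omega>) * (W b \<omega> - W a \<omega>)" for \<omega>
    by (simp add: mult_ac)
  show ?thesis unfolding sw Int_commute[of "{a<..b}"] by (rule *)
qed

text \<open>Orthogonality of martingale differences, for a general centred function \<open>g\<close>
  of the increments: it is applied to \<open>w\<close> and to \<open>w\<^sup>2 - \<tau>\<close>.
  Measurability of \<open>S n\<close> at time \<open>n * \<tau>\<close> belongs to the induction,
  because the cross term is killed by independence from that time on.\<close>

lemma martingale_sum:
  fixes c :: "nat \<Rightarrow> 'a \<Rightarrow> complex"
  assumes \<tau>: "0 < \<tau>" and g: "g \<in> borel_measurable borel" "integrable (gauss \<tau>) g" "integrable (gauss \<tau>) (\<lambda>w. (g w)\<^sup>2)"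
    and g0: "(\<integral>w. g w \<partial>gauss \<tau>) = 0" and v: "(\<integral>w. (g w)\<^sup>2 \<partial>gauss \<tau>) = v"
    and c: "\<And>k. c k \<in> borel_measurable (F (real k * \<tau>))" "\<And>k \<omega>. \<omega> \<in> space M \<Longrightarrow> cmod (c k \<omega>) \<le> B"
  defines "S \<equiv> \<lambda>n \<omega>. \<Sum>k<n. c k \<omega> * of_real (g (W (real (Suc k) * \<tau>) \<omega> - W (real k * \<tau>) \<omega>))"
  shows "S n \<in> borel_measurable (F (real n * \<tau>))"
    and "integrable M (\<lambda>\<omega>. (cmod (S n \<omega>))\<^sup>2)"
    and "(\<integral>\<omega>. (cmod (S n \<omega>))\<^sup>2 \<partial>M) = v * (\<Sum>k<n. \<integral>\<omega>. (cmod (c k \<omega>))\<^sup>2 \<partial>M)"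
proof -
  have "S n \<in> borel_measurable (F (real n * \<tau>)) \<and> integrable M (\<lambda>\<omega>. (cmod (S n \<omega>))\<^sup>2) \<and>
    (\<integral>\<omega>. (cmod (S n \<omega>))\<^sup>2 \<partial>M) = v * (\<Sum>k<n. \<integral>\<omega>. (cmod (c k \<omega>))\<^sup>2 \<partial>M)"
  proof (induction n)
    case 0
    then show ?case by (simp add: S_def)
  next
    case (Suc n)
    let ?s = "real n * \<tau>" and ?t = "real (Suc n) * \<tau>"
    have st: "0 \<le> ?s" "?s < ?t" and ts: "?t - ?s = \<tau>" using \<tau> by (auto simp: algebra_simps)
    define Z where "Z \<omega> = g (W ?t \<omega> - W ?s \<omega>)" for \<omega>
    have S_Suc: "S (Suc n) = (\<lambda>\<omega>. S n \<omega> + Z \<omega> *\<^sub>R c n \<omega>)"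
      by (auto simp: S_def Z_def scaleR_conv_of_real mult.commute)
    have [measurable]: "S n \<in> borel_measurable (F ?s)" "c n \<in> borel_measurable (F ?s)"
      using Suc c by auto
    \<comment> \<open>The inner product is that of the plane over the reals. The middle term has
      mean zero, since \<open>Z\<close> is centred and independent of \<open>F ?s\<close>.\<close>
    have sq: "(cmod (S (Suc n) \<omega>))\<^sup>2 = (cmod (S n \<omega>))\<^sup>2 + 2 * ((S n \<omega> \<bullet> c n \<omega>) * Z \<omega>) + (cmod (c n \<omega>))\<^sup>2 * (Z \<omega>)\<^sup>2" for \<omega>
      unfolding S_Suc power2_norm_eq_inner
      by (simp add: inner_add_left inner_add_right inner_commute algebra_simps power2_eq_square)
    have i0: "integrable M (\<lambda>\<omega>. (cmod (S n \<omega>))\<^sup>2)" using Suc by simp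
    have i1: "integrable M (\<lambda>\<omega>. (cmod (c n \<omega>))\<^sup>2)"
    proof (rule integrable_bounded[where B="B\<^sup>2"])
      show "(\<lambda>\<omega>. (cmod (c n \<omega>))\<^sup>2) \<in> borel_measurable M" using measurable_F[OF c(1)[of n]] by measurable
    qed (use c(2) in \<open>auto intro!: power_mono\<close>)
    have i2: "integrable M (\<lambda>\<omega>. S n \<omega> \<bullet> c n \<omega>)"
    proof (rule Bochner_Integration.integrable_bound[OF Bochner_Integration.integrable_add[OF i0 i1]])
      show "(\<lambda>\<omega>. S n \<omega> \<bullet> c n \<omega>) \<in> borel_measurable M" by (rule measurable_F[of _ ?s]) measurable
      show "AE \<omega> in M. norm (S n \<omega> \<bullet> c n \<omega>) \<le> norm ((cmod (S n \<omega>))\<^sup>2 + (cmod (c n \<omega>))\<^sup>2)"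
      proof (rule AE_I2)
        fix \<omega>
        have "\<bar>S n \<omega> \<bullet> c n \<omega>\<bar> \<le> cmod (S n \<omega>) * cmod (c n \<omega>)" by (rule Cauchy_Schwarz_ineq2)
        also have "\<dots> \<le> 2 * (cmod (S n \<omega>) * cmod (c n \<omega>))" by simp
        also have "\<dots> \<le> (cmod (S n \<omega>))\<^sup>2 + (cmod (c n \<omega>))\<^sup>2"
          using sum_squares_bound[of "cmod (S n \<omega>)" "cmod (c n \<omega>)"] by simp
        finally show "norm (S n \<omega> \<bullet> c n \<omega>) \<le> norm ((cmod (S n \<omega>))\<^sup>2 + (cmod (c n \<omega>))\<^sup>2)" by simp
      qed
    qed
    have j1: "integrable M (\<lambda>\<omega>. (S n \<omega> \<bullet> c n \<omega>) * Z \<omega>)" "(\<integral>\<omega>. (S n \<omega> \<bullet> c n \<omega>) * Z \<omega> \<partial>M) = 0"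
      using integral_times_increment[OF st _ i2, unfolded ts, OF _ g(1,2)] g0
      by (simp_all add: Z_def)
    have j2: "integrable M (\<lambda>\<omega>. (cmod (c n \<omega>))\<^sup>2 * (Z \<omega>)\<^sup>2)"
       "(\<integral>\<omega>. (cmod (c n \<omega>))\<^sup>2 * (Z \<omega>)\<^sup>2 \<partial>M) = (\<integral>\<omega>. (cmod (c n \<omega>))\<^sup>2 \<partial>M) * v"
      using integral_times_increment[OF st _ i1, unfolded ts, of "\<lambda>w. (g w)\<^sup>2"] g(1,3) v
      by (simp_all add: Z_def)
    have "S (Suc n) \<in> borel_measurable (F ?t)"
    proof -
      have [measurable]: "S n \<in> borel_measurable (F ?t)" "c n \<in> borel_measurable (F ?t)"
        using Suc c st by (auto intro: measurable_F_mono[of ?s])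
      have [measurable]: "W ?t \<in> borel_measurable (F ?t)" "W ?s \<in> borel_measurable (F ?t)"
        using st by (auto intro!: measurable_W_F)
      note [measurable] = g(1)
      show ?thesis unfolding S_Suc Z_def by measurable
    qed
    then show ?case
      unfolding sq using Suc j1 j2 by (simp add: distrib_left mult.commute[of _ v])
  qed
  then show "S n \<in> borel_measurable (F (real n * \<tau>))" "integrable M (\<lambda>\<omega>. (cmod (S n \<omega>))\<^sup>2)"
    "(\<integral>\<omega>. (cmod (S n \<omega>))\<^sup>2 \<partial>M) = v * (\<Sum>k<n. \<integral>\<omega>. (cmod (c k \<omega>))\<^sup>2 \<partial>M)" by auto
qed

end

section \<open>The Ito isometry\<close>

text \<open>The squared norm of \<open>L\<^sup>2\<close> as an extended real, so that estimates can
  be chained before any integrability is known.\<close>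

definition sq :: "'b measure \<Rightarrow> ('b \<Rightarrow> complex) \<Rightarrow> ennreal" where
  "sq N f = (\<integral>\<^sup>+z. ennreal ((cmod (f z))\<^sup>2) \<partial>N)"

lemma sq_mono_AE:
  "(AE z in N. cmod (f z) \<le> cmod (g z)) \<Longrightarrow> sq N f \<le> sq N g"
  unfolding sq_def by (rule nn_integral_mono_AE) (auto elim!: eventually_mono intro!: ennreal_leI power_mono)

lemma sq_cong_AE: "(AE z in N. f z = g z) \<Longrightarrow> sq N f = sq N g"
  unfolding sq_def by (rule nn_integral_cong_AE) (auto elim!: eventually_mono)

lemma sq_add:
  assumes [measurable]: "f \<in> borel_measurable N" "g \<in> borel_measurable N"
  shows "sq N (\<lambda>z. f z + g z) \<le> 2 * sq N f + 2 * sq N g"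
proof -
  have "(cmod (u + v))\<^sup>2 \<le> 2 * (cmod u)\<^sup>2 + 2 * (cmod v)\<^sup>2" for u v :: complex
  proof -
    have "(cmod (u + v))\<^sup>2 \<le> (cmod u + cmod v)\<^sup>2" by (intro power_mono norm_triangle_ineq) auto
    also have "\<dots> \<le> 2 * (cmod u)\<^sup>2 + 2 * (cmod v)\<^sup>2"
      using sum_squares_bound[of "cmod u" "cmod v"] by (simp add: power2_sum)
    finally show ?thesis .
  qed
  then have "sq N (\<lambda>z. f z + g z) \<le> (\<integral>\<^sup>+z. ennreal (2 * (cmod (f z))\<^sup>2 + 2 * (cmod (g z))\<^sup>2) \<partial>N)"
    unfolding sq_def by (intro nn_integral_mono ennreal_leI)
  also have "\<dots> = 2 * sq N f + 2 * sq N g"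
    unfolding sq_def by (simp add: ennreal_mult' nn_integral_add nn_integral_cmult)
  finally show ?thesis .
qed

lemma sq_diff:
  assumes "f \<in> borel_measurable N" "g \<in> borel_measurable N"
  shows "sq N (\<lambda>z. f z - g z) \<le> 2 * sq N f + 2 * sq N g"
  using sq_add[of f N "\<lambda>z. - g z"] assms by (simp add: sq_def)

lemma sq_cmult:
  assumes [measurable]: "f \<in> borel_measurable N"
  shows "sq N (\<lambda>z. c * f z) = ennreal ((cmod c)\<^sup>2) * sq N f"
  unfolding sq_def by (simp add: norm_mult power_mult_distrib ennreal_mult' nn_integral_cmult)

lemma sq_sum:
  assumes [measurable]: "\<And>j. j < n \<Longrightarrow> f j \<in> borel_measurable N"
  shows "sq N (\<lambda>z. \<Sum>j<n. f j z) \<le> of_nat n * (\<Sum>j<n. sq N (f j))"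
proof -
  have "(cmod (\<Sum>j<n. f j z))\<^sup>2 \<le> real n * (\<Sum>j<n. (cmod (f j z))\<^sup>2)" for z
  proof -
    have "(cmod (\<Sum>j<n. f j z))\<^sup>2 \<le> (\<Sum>j<n. cmod (f j z))\<^sup>2" by (intro power_mono norm_sum) auto
    also have "\<dots> \<le> (\<Sum>j<n. (cmod (f j z))\<^sup>2) * (\<Sum>j<n. 1\<^sup>2)"
      using Cauchy_Schwarz_ineq_sum[of "\<lambda>j. cmod (f j z)" "\<lambda>_. 1" "{..<n}"] by simp
    finally show ?thesis by (simp add: mult.commute)
  qed
  then have "sq N (\<lambda>z. \<Sum>j<n. f j z) \<le> (\<integral>\<^sup>+z. ennreal (real n * (\<Sum>j<n. (cmod (f j z))\<^sup>2)) \<partial>N)"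
    unfolding sq_def by (intro nn_integral_mono ennreal_leI)
  also have "\<dots> = (\<integral>\<^sup>+z. of_nat n * (\<Sum>j<n. ennreal ((cmod (f j z))\<^sup>2)) \<partial>N)"
    by (simp add: ennreal_mult' ennreal_of_nat_eq_real_of_nat)
  also have "\<dots> = of_nat n * (\<Sum>j<n. sq N (f j))"
    unfolding sq_def by (subst nn_integral_cmult, measurable, subst nn_integral_sum) auto
  finally show ?thesis .
qed

lemma sq_eq_integral:
  assumes "integrable N (\<lambda>z. (cmod (f z))\<^sup>2)"
  shows "sq N f = ennreal (\<integral>z. (cmod (f z))\<^sup>2 \<partial>N)"
  unfolding sq_def using assms by (intro nn_integral_eq_integral) auto

lemma integral_double_sum:
  fixes f :: "nat \<Rightarrow> nat \<Rightarrow> 'b \<Rightarrow> real"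
  assumes "\<And>i j. i < n \<Longrightarrow> j < n \<Longrightarrow> integrable N (f i j)"
  shows "integrable N (\<lambda>z. \<Sum>i<n. \<Sum>j<n. f i j z)"
    and "(\<integral>z. (\<Sum>i<n. \<Sum>j<n. f i j z) \<partial>N) = (\<Sum>i<n. \<Sum>j<n. \<integral>z. f i j z \<partial>N)"
proof -
  have row: "integrable N (\<lambda>z. \<Sum>j<n. f i j z)" "(\<integral>z. (\<Sum>j<n. f i j z) \<partial>N) = (\<Sum>j<n. \<integral>z. f i j z \<partial>N)"
    if "i < n" for i
    using assms that by (auto intro!: Bochner_Integration.integrable_sum Bochner_Integration.integral_sum)
  show "integrable N (\<lambda>z. \<Sum>i<n. \<Sum>j<n. f i j z)"
    by (rule Bochner_Integration.integrable_sum) (use row in auto)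
  have "(\<integral>z. (\<Sum>i<n. \<Sum>j<n. f i j z) \<partial>N) = (\<Sum>i<n. \<integral>z. (\<Sum>j<n. f i j z) \<partial>N)"
    by (rule Bochner_Integration.integral_sum) (use row in auto)
  then show "(\<integral>z. (\<Sum>i<n. \<Sum>j<n. f i j z) \<partial>N) = (\<Sum>i<n. \<Sum>j<n. \<integral>z. f i j z \<partial>N)"
    by (simp add: row)
qed

context brownian_motion
begin

text \<open>The intervals may overlap and come in any order. Differences of elementary processes are
  then concatenations of lists, without a common refinement; the isometry pays for this with a
  double sum.\<close>

definition elementary ::
    "nat \<Rightarrow> (nat \<Rightarrow> real) \<Rightarrow> (nat \<Rightarrow> real) \<Rightarrow> (nat \<Rightarrow> 'a \<Rightarrow> complex) \<Rightarrow> bool" where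
  "elementary n a b \<xi> \<longleftrightarrow> (\<forall>k<n. 0 \<le> a k \<and> a k \<le> b k \<and> \<xi> k \<in> borel_measurable (F (a k)) \<and>
     bounded (\<xi> k ` space M))"

definition step_process ::
    "nat \<Rightarrow> (nat \<Rightarrow> real) \<Rightarrow> (nat \<Rightarrow> real) \<Rightarrow> (nat \<Rightarrow> 'a \<Rightarrow> complex) \<Rightarrow> 'a \<times> real \<Rightarrow> complex" where
  "step_process n a b \<xi> z = (\<Sum>k<n. indicator {a k<..b k} (snd z) * \<xi> k (fst z))"

definition step_integral ::
    "nat \<Rightarrow> (nat \<Rightarrow> real) \<Rightarrow> (nat \<Rightarrow> real) \<Rightarrow> (nat \<Rightarrow> 'a \<Rightarrow> complex) \<Rightarrow> 'a \<Rightarrow> complex" where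
  "step_integral n a b \<xi> \<omega> = (\<Sum>k<n. \<xi> k \<omega> * of_real (W (b k) \<omega> - W (a k) \<omega>))"

abbreviation Q :: "('a \<times> real) measure" where
  "Q \<equiv> M \<Otimes>\<^sub>M lborel"

lemma measurable_step_process [measurable]:
  assumes "elementary n a b \<xi>"
  shows "step_process n a b \<xi> \<in> borel_measurable Q"
proof -
  have [measurable]: "\<xi> k \<in> borel_measurable M" if "k < n" for k
    using assms that by (auto simp: elementary_def intro: measurable_F)
  show ?thesis unfolding step_process_def[abs_def] by measurable
qed

lemma measurable_step_integral [measurable]:
  assumes "elementary n a b \<xi>"
  shows "step_integral n a b \<xi> \<in> borel_measurable M"
proof -
  have [measurable]: "\<xi> k \<in> borel_measurable M" "W (a k) \<in> borel_measurable M" "W (b k) \<in> borel_measurable M"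
    if "k < n" for k
  proof -
    have k: "0 \<le> a k" "a k \<le> b k" "\<xi> k \<in> borel_measurable (F (a k))"
      using assms that by (auto simp: elementary_def)
    then show "\<xi> k \<in> borel_measurable M" "W (a k) \<in> borel_measurable M" "W (b k) \<in> borel_measurable M"
      by (auto intro!: measurable_W intro: measurable_F)
  qed
  show ?thesis unfolding step_integral_def[abs_def] by measurable
qed

text \<open>Both sides expand into the double sum \<open>R\<close>. The length of the overlap of two
  intervals is the expected product of the increments on the left and the time integral of the
  product of the indicators on the right.\<close>

lemma isometry:
  assumes el: "elementary n a b \<xi>"
  shows "sq M (step_integral n a b \<xi>) = sq Q (step_process n a b \<xi>)"
proof -
  define G where "G i j \<omega> = \<xi> i \<omega> \<bullet> \<xi> j \<omega>" for i j \<omega>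
  define A where "A i j = {a i<..b i} \<inter> {a j<..b j}" for i j
  define l where "l i j = measure lborel (A i j)" for i j
  have fin: "emeasure lborel (A i j) < \<infinity>" and A: "A i j \<in> sets lborel" for i j
  proof -
    have "emeasure lborel (A i j) \<le> emeasure lborel {a i<..b i}"
      unfolding A_def by (intro emeasure_mono) auto
    also have "\<dots> \<le> emeasure lborel {a i..b i}" by (intro emeasure_mono) auto
    also have "\<dots> < \<infinity>" by (simp add: emeasure_lborel_Icc_eq)
    finally show "emeasure lborel (A i j) < \<infinity>" .
    show "A i j \<in> sets lborel" by (simp add: A_def)
  qed
  obtain B where B: "\<And>k \<omega>. k < n \<Longrightarrow> \<omega> \<in> space M \<Longrightarrow> cmod (\<xi> k \<omega>) \<le> B k"
    using el unfolding elementary_def bounded_iff by (metis image_eqI)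
  have Gb: "\<bar>G i j \<omega>\<bar> \<le> B i * B j" if "i < n" "j < n" "\<omega> \<in> space M" for i j \<omega>
  proof -
    have "\<bar>G i j \<omega>\<bar> \<le> cmod (\<xi> i \<omega>) * cmod (\<xi> j \<omega>)" unfolding G_def by (rule Cauchy_Schwarz_ineq2)
    also have "\<dots> \<le> B i * B j"
      using B that order_trans[OF norm_ge_zero B[of i \<omega>]] by (intro mult_mono) auto
    finally show ?thesis .
  qed
  have prod: "integrable M (\<lambda>\<omega>. G i j \<omega> * (W (b i) \<omega> - W (a i) \<omega>) * (W (b j) \<omega> - W (a j) \<omega>)) \<and>
    (\<integral>\<omega>. G i j \<omega> * (W (b i) \<omega> - W (a i) \<omega>) * (W (b j) \<omega> - W (a j) \<omega>) \<partial>M) = (\<integral>\<omega>. G i j \<omega> \<partial>M) * l i j"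
    and intG: "integrable M (G i j)"
    if ij: "i < n" "j < n" for i j
  proof -
    have [measurable]: "\<xi> i \<in> borel_measurable (F (max (a i) (a j)))" "\<xi> j \<in> borel_measurable (F (max (a i) (a j)))"
      using el ij measurable_F_mono[of "a i" "max (a i) (a j)" "\<xi> i"] measurable_F_mono[of "a j" "max (a i) (a j)" "\<xi> j"]
      by (auto simp: elementary_def)
    have m: "G i j \<in> borel_measurable (F (max (a i) (a j)))" unfolding G_def by measurable
    show "integrable M (G i j)"
      using measurable_F[OF m] Gb[OF ij] by (intro integrable_bounded[where B="B i * B j"]) auto
    show "integrable M (\<lambda>\<omega>. G i j \<omega> * (W (b i) \<omega> - W (a i) \<omega>) * (W (b j) \<omega> - W (a j) \<omega>)) \<and>
      (\<integral>\<omega>. G i j \<omega> * (W (b i) \<omega> - W (a i) \<omega>) * (W (b j) \<omega> - W (a j) \<omega>) \<partial>M) = (\<integral>\<omega>. G i j \<omega> \<partial>M) * l i j"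
      unfolding l_def A_def using el ij m Gb[OF ij] by (intro increment_product[where B="B i * B j"]) (auto simp: elementary_def)
  qed
  define R where "R = (\<Sum>i<n. \<Sum>j<n. (\<integral>\<omega>. G i j \<omega> \<partial>M) * l i j)"
  \<comment> \<open>One expansion for both sides: \<open>r\<close> will be the increments of
    \<open>W\<close> and the indicators of the intervals.\<close>
  have cm: "(cmod (\<Sum>k<n. of_real (r k) * \<xi> k \<omega>))\<^sup>2 = (\<Sum>i<n. \<Sum>j<n. G i j \<omega> * r i * r j)" for r \<omega>
    unfolding power2_norm_eq_inner inner_sum_left inner_sum_right
    by (intro sum.cong refl) (simp add: G_def scaleR_conv_of_real[symmetric] inner_commute mult_ac)
  have "sq M (step_integral n a b \<xi>) = ennreal R"
  proof -
    have eq: "(cmod (step_integral n a b \<xi> \<omega>))\<^sup>2 =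
        (\<Sum>i<n. \<Sum>j<n. G i j \<omega> * (W (b i) \<omega> - W (a i) \<omega>) * (W (b j) \<omega> - W (a j) \<omega>))" for \<omega>
      using cm[of "\<lambda>k. W (b k) \<omega> - W (a k) \<omega>" \<omega>] by (simp add: step_integral_def mult.commute)
    show ?thesis
      using integral_double_sum[of n M "\<lambda>i j \<omega>. G i j \<omega> * (W (b i) \<omega> - W (a i) \<omega>) * (W (b j) \<omega> - W (a j) \<omega>)"] prod
      by (subst sq_eq_integral) (simp_all add: eq R_def)
  qed
  moreover have "sq Q (step_process n a b \<xi>) = ennreal R"
  proof -
    note [measurable] = el
    have eq: "(cmod (step_process n a b \<xi> (\<omega>, s)))\<^sup>2 =
        (\<Sum>i<n. \<Sum>j<n. G i j \<omega> * indicator (A i j) s)" for \<omega> s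
      using cm[of "\<lambda>k. indicator {a k<..b k} s" \<omega>]
      by (simp only: A_def step_process_def indicator_inter_arith mult.assoc of_real_indicator fst_conv snd_conv)
    have i: "integrable lborel (\<lambda>s. G i j \<omega> * indicator (A i j) s)" for i j \<omega>
      using fin A by (intro integrable_mult_right integrable_real_indicator) auto
    have inner: "integrable lborel (\<lambda>s. (cmod (step_process n a b \<xi> (\<omega>, s)))\<^sup>2)"
      "(\<integral>s. (cmod (step_process n a b \<xi> (\<omega>, s)))\<^sup>2 \<partial>lborel) = (\<Sum>i<n. \<Sum>j<n. G i j \<omega> * l i j)" for \<omega>
    proof -
      have lij: "(\<integral>s. G i j \<omega> * indicator (A i j) s \<partial>lborel) = G i j \<omega> * l i j" for i j
        unfolding l_def using A by (subst integral_mult_right_zero) simp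
      show "integrable lborel (\<lambda>s. (cmod (step_process n a b \<xi> (\<omega>, s)))\<^sup>2)"
        unfolding eq by (rule integral_double_sum(1)) (rule i)
      show "(\<integral>s. (cmod (step_process n a b \<xi> (\<omega>, s)))\<^sup>2 \<partial>lborel) = (\<Sum>i<n. \<Sum>j<n. G i j \<omega> * l i j)"
        unfolding eq by (subst integral_double_sum(2), rule i, simp only: lij)
    qed
    have "sq Q (step_process n a b \<xi>) = (\<integral>\<^sup>+\<omega>. \<integral>\<^sup>+s. ennreal ((cmod (step_process n a b \<xi> (\<omega>, s)))\<^sup>2) \<partial>lborel \<partial>M)"
      unfolding sq_def by (subst lborel.nn_integral_fst[symmetric]) auto
    also have "\<dots> = (\<integral>\<^sup>+\<omega>. ennreal (\<Sum>i<n. \<Sum>j<n. G i j \<omega> * l i j) \<partial>M)"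
    proof (rule nn_integral_cong)
      fix \<omega>
      have "(\<integral>\<^sup>+s. ennreal ((cmod (step_process n a b \<xi> (\<omega>, s)))\<^sup>2) \<partial>lborel) =
          ennreal (\<integral>s. (cmod (step_process n a b \<xi> (\<omega>, s)))\<^sup>2 \<partial>lborel)"
        using inner(1) by (intro nn_integral_eq_integral) auto
      then show "(\<integral>\<^sup>+s. ennreal ((cmod (step_process n a b \<xi> (\<omega>, s)))\<^sup>2) \<partial>lborel) =
          ennreal (\<Sum>i<n. \<Sum>j<n. G i j \<omega> * l i j)" by (simp only: inner(2))
    qed
    also have "\<dots> = ennreal (\<integral>\<omega>. (\<Sum>i<n. \<Sum>j<n. G i j \<omega> * l i j) \<partial>M)"
    proof (rule nn_integral_eq_integral)
      show "integrable M (\<lambda>\<omega>. \<Sum>i<n. \<Sum>j<n. G i j \<omega> * l i j)"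
        using intG by (intro integral_double_sum) auto
      \<comment> \<open>The double sum is not visibly nonnegative; it is because it equals a time
        integral of squares.\<close>
      show "AE \<omega> in M. 0 \<le> (\<Sum>i<n. \<Sum>j<n. G i j \<omega> * l i j)"
      proof (rule AE_I2)
        fix \<omega>
        have "0 \<le> (\<integral>s. (cmod (step_process n a b \<xi> (\<omega>, s)))\<^sup>2 \<partial>lborel)" by simp
        also have "\<dots> = (\<Sum>i<n. \<Sum>j<n. G i j \<omega> * l i j)" by (rule inner(2))
        finally show "0 \<le> (\<Sum>i<n. \<Sum>j<n. G i j \<omega> * l i j)" .
      qed
    qed
    also have "\<dots> = ennreal R"
      using integral_double_sum(2)[of n M "\<lambda>i j \<omega>. G i j \<omega> * l i j"] intG by (simp add: R_def)
    finally show ?thesis .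
  qed
  ultimately show ?thesis by simp
qed

text \<open>The closure of the elementary integral in \<open>L\<^sup>2\<close>. The time interval is
  part of the integrand instead of being fixed by a partition, so integrals over different times can
  be subtracted.\<close>

definition ito :: "('a \<times> real \<Rightarrow> complex) \<Rightarrow> ('a \<Rightarrow> complex) \<Rightarrow> bool" where
  "ito Y J \<longleftrightarrow> Y \<in> borel_measurable Q \<and> J \<in> borel_measurable M \<and>
     (\<forall>e>0. \<exists>n a b \<xi>. elementary n a b \<xi> \<and> sq Q (\<lambda>z. step_process n a b \<xi> z - Y z) \<le> ennreal e \<and>
        sq M (\<lambda>\<omega>. step_integral n a b \<xi> \<omega> - J \<omega>) \<le> ennreal e)"

lemma ito_step: "elementary n a b \<xi> \<Longrightarrow> ito (step_process n a b \<xi>) (step_integral n a b \<xi>)"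
  unfolding ito_def by (intro conjI allI impI exI[of _ n] exI[of _ a] exI[of _ b] exI[of _ \<xi>])
    (auto simp: sq_def measurable_step_process measurable_step_integral)

text \<open>The isometry is carried to \<open>J\<close> by approximation. Splitting squares with a
  factor 2 before and after it gives the constant 4 in place of 1, which is enough for
  limits.\<close>

lemma ito_bound:
  assumes "ito Y J"
  shows "sq M J \<le> 4 * sq Q Y"
proof (rule ennreal_le_epsilon)
  fix e :: real assume "0 < e"
  \<comment> \<open>Six copies of the error occur: two from the integral and four from the
    integrand.\<close>
  then have "0 < e / 6" by simp
  then obtain n a b \<xi> where el: "elementary n a b \<xi>"
    and Y: "sq Q (\<lambda>z. step_process n a b \<xi> z - Y z) \<le> ennreal (e/6)"
    and J: "sq M (\<lambda>\<omega>. step_integral n a b \<xi> \<omega> - J \<omega>) \<le> ennreal (e/6)"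
    using assms unfolding ito_def by blast
  note [measurable] = el
  have [measurable]: "Y \<in> borel_measurable Q" "J \<in> borel_measurable M"
    using assms by (auto simp: ito_def)
  have 1: "sq M J \<le> 2 * sq M (step_integral n a b \<xi>) + 2 * sq M (\<lambda>\<omega>. step_integral n a b \<xi> \<omega> - J \<omega>)"
    using sq_diff[of "step_integral n a b \<xi>" M "\<lambda>\<omega>. step_integral n a b \<xi> \<omega> - J \<omega>"] by simp
  have 2: "sq Q (step_process n a b \<xi>) \<le> 2 * sq Q (\<lambda>z. step_process n a b \<xi> z - Y z) + 2 * sq Q Y"
    using sq_add[of "\<lambda>z. step_process n a b \<xi> z - Y z" Q Y] by simp
  have "sq M J \<le> 2 * (2 * ennreal (e/6) + 2 * sq Q Y) + 2 * ennreal (e/6)"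
    using 1 unfolding isometry[OF el]
    by (rule order_trans) (intro add_mono mult_left_mono order_trans[OF 2] Y J order_refl; simp)
  also have "\<dots> = 4 * sq Q Y + (2 * (2 * ennreal (e/6)) + 2 * ennreal (e/6))"
    by (simp add: distrib_left mult.assoc[symmetric] add_ac)
  also have "2 * (2 * ennreal (e/6)) + 2 * ennreal (e/6) = ennreal e"
    using \<open>0 < e\<close> by (simp add: ennreal_mult'[symmetric] ennreal_plus[symmetric] 
      ennreal_numeral[symmetric] del: ennreal_plus ennreal_numeral)
  finally show "sq M J \<le> 4 * sq Q Y + ennreal e" .
qed

lemma ito_diff:
  assumes 1: "ito Y1 J1" and 2: "ito Y2 J2"
  shows "ito (\<lambda>z. Y1 z - Y2 z) (\<lambda>\<omega>. J1 \<omega> - J2 \<omega>)"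
  unfolding ito_def
proof (intro conjI allI impI)
  have [measurable]: "Y1 \<in> borel_measurable Q" "J1 \<in> borel_measurable M"
    "Y2 \<in> borel_measurable Q" "J2 \<in> borel_measurable M"
    using assms by (auto simp: ito_def)
  show "(\<lambda>z. Y1 z - Y2 z) \<in> borel_measurable Q" "(\<lambda>\<omega>. J1 \<omega> - J2 \<omega>) \<in> borel_measurable M" by measurable
  fix e :: real assume e: "0 < e"
  then have "0 < e / 4" by simp
  with 1 obtain n1 a1 b1 \<xi>1 where el1[measurable]: "elementary n1 a1 b1 \<xi>1"
    and Y1: "sq Q (\<lambda>z. step_process n1 a1 b1 \<xi>1 z - Y1 z) \<le> ennreal (e/4)"
    and J1: "sq M (\<lambda>\<omega>. step_integral n1 a1 b1 \<xi>1 \<omega> - J1 \<omega>) \<le> ennreal (e/4)"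
    unfolding ito_def by blast
  from \<open>0 < e / 4\<close> 2 obtain n2 a2 b2 \<xi>2 where el2[measurable]: "elementary n2 a2 b2 \<xi>2"
    and Y2: "sq Q (\<lambda>z. step_process n2 a2 b2 \<xi>2 z - Y2 z) \<le> ennreal (e/4)"
    and J2: "sq M (\<lambda>\<omega>. step_integral n2 a2 b2 \<xi>2 \<omega> - J2 \<omega>) \<le> ennreal (e/4)"
    unfolding ito_def by blast
  \<comment> \<open>The second list is appended with the opposite sign. An error of
    \<open>e / 4\<close> in each part becomes \<open>e\<close> through the factors 2 in
    \<open>sq_diff\<close>.\<close>
  define a b \<xi> where "a k = (if k < n1 then a1 k else a2 (k - n1))"
    and "b k = (if k < n1 then b1 k else b2 (k - n1))"
    and "\<xi> k = (if k < n1 then \<xi>1 k else (\<lambda>\<omega>. - \<xi>2 (k - n1) \<omega>))" for k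
  have split: "(\<Sum>k<n1 + n2. f k) = (\<Sum>k<n1. f k) + (\<Sum>k<n2. f (n1 + k))" for f :: "nat \<Rightarrow> complex"
    by (induction n2) (simp_all add: add.assoc)
  have el: "elementary (n1 + n2) a b \<xi>"
    unfolding elementary_def
  proof (intro allI impI)
    fix k assume k: "k < n1 + n2"
    show "0 \<le> a k \<and> a k \<le> b k \<and> \<xi> k \<in> borel_measurable (F (a k)) \<and> bounded (\<xi> k ` space M)"
    proof (cases "k < n1")
      case True
      then show ?thesis using el1 by (simp add: a_def b_def \<xi>_def elementary_def)
    next
      case False
      then have "k - n1 < n2" using k by simp
      then have "0 \<le> a2 (k - n1) \<and> a2 (k - n1) \<le> b2 (k - n1) \<and> \<xi>2 (k - n1) \<in> borel_measurable (F (a2 (k - n1))) \<and>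
          bounded (\<xi>2 (k - n1) ` space M)" using el2 by (simp add: elementary_def)
      then show ?thesis using False by (auto simp: a_def b_def \<xi>_def bounded_iff)
    qed
  qed
  have P: "step_process (n1 + n2) a b \<xi> z = step_process n1 a1 b1 \<xi>1 z - step_process n2 a2 b2 \<xi>2 z" for z
    unfolding step_process_def split by (simp add: a_def b_def \<xi>_def sum_negf)
  have I: "step_integral (n1 + n2) a b \<xi> \<omega> = step_integral n1 a1 b1 \<xi>1 \<omega> - step_integral n2 a2 b2 \<xi>2 \<omega>" for \<omega>
    unfolding step_integral_def split by (simp add: a_def b_def \<xi>_def sum_negf)
  have ee: "2 * ennreal (e/4) + 2 * ennreal (e/4) = ennreal e"
    using e by (simp add: ennreal_mult'[symmetric] ennreal_plus[symmetric] 
      ennreal_numeral[symmetric] del: ennreal_plus ennreal_numeral)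
  have "sq Q (\<lambda>z. step_process (n1 + n2) a b \<xi> z - (Y1 z - Y2 z)) =
     sq Q (\<lambda>z. (step_process n1 a1 b1 \<xi>1 z - Y1 z) - (step_process n2 a2 b2 \<xi>2 z - Y2 z))"
    by (simp add: P algebra_simps)
  also have "\<dots> \<le> 2 * ennreal (e/4) + 2 * ennreal (e/4)"
    by (rule order_trans[OF sq_diff]) (auto intro!: add_mono mult_left_mono Y1 Y2)
  finally have A: "sq Q (\<lambda>z. step_process (n1 + n2) a b \<xi> z - (Y1 z - Y2 z)) \<le> ennreal e"
    by (simp only: ee)
  have "sq M (\<lambda>\<omega>. step_integral (n1 + n2) a b \<xi> \<omega> - (J1 \<omega> - J2 \<omega>)) =
     sq M (\<lambda>\<omega>. (step_integral n1 a1 b1 \<xi>1 \<omega> - J1 \<omega>) - (step_integral n2 a2 b2 \<xi>2 \<omega> - J2 \<omega>))"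
    by (simp add: I algebra_simps)
  also have "\<dots> \<le> 2 * ennreal (e/4) + 2 * ennreal (e/4)"
    by (rule order_trans[OF sq_diff]) (auto intro!: add_mono mult_left_mono J1 J2)
  finally have "sq M (\<lambda>\<omega>. step_integral (n1 + n2) a b \<xi> \<omega> - (J1 \<omega> - J2 \<omega>)) \<le> ennreal e"
    by (simp only: ee)
  with el A show "\<exists>n a b \<xi>. elementary n a b \<xi> \<and> sq Q (\<lambda>z. step_process n a b \<xi> z - (Y1 z - Y2 z)) \<le> ennreal e \<and>
        sq M (\<lambda>\<omega>. step_integral n a b \<xi> \<omega> - (J1 \<omega> - J2 \<omega>)) \<le> ennreal e" by blast
qed

text \<open>\<open>Z\<close> is a jointly measurable stand-in for \<open>Y\<close>, needed to speak
  of a norm on the product space. It may differ at \<open>s = 0\<close>, which is null for the time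
  integral.\<close>

lemma ito_of_is_ito_integral:
  assumes I: "is_ito_integral M F W Y t J"
    and [measurable]: "Z \<in> borel_measurable Q" and eq: "AE \<omega> in M. \<forall>s\<in>{0<..t}. Y s \<omega> = Z (\<omega>, s)"
  shows "ito (\<lambda>z. indicator {0<..t} (snd z) * Z z) J"
  unfolding ito_def
proof (intro conjI allI impI)
  show "(\<lambda>z. indicator {0<..t} (snd z) * Z z) \<in> borel_measurable Q" by measurable
  show "J \<in> borel_measurable M" using I by (simp add: is_ito_integral_def)
  fix e :: real assume e: "0 < e"
  obtain n p \<xi> where si: "\<And>m. simple_integrand F t (n m) (p m) (\<xi> m)"
    and L1: "(\<lambda>m. \<integral>\<^sup>+ \<omega>. (\<integral>\<^sup>+ s\<in>{0..t}.
            ennreal ((cmod (simple_process (n m) (p m) (\<xi> m) s \<omega> - Y s \<omega>))\<^sup>2) \<partial>lborel) \<partial>M) \<longlonglongrightarrow> 0"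
    and L2: "(\<lambda>m. \<integral>\<^sup>+ \<omega>. ennreal ((cmod (simple_integral W (n m) (p m) (\<xi> m) \<omega> - J \<omega>))\<^sup>2) \<partial>M) \<longlonglongrightarrow> 0"
    using I unfolding is_ito_integral_def by blast
  have e': "0 < ennreal e" using e by simp
  obtain m where
    m1: "(\<integral>\<^sup>+ \<omega>. (\<integral>\<^sup>+ s\<in>{0..t}.
            ennreal ((cmod (simple_process (n m) (p m) (\<xi> m) s \<omega> - Y s \<omega>))\<^sup>2) \<partial>lborel) \<partial>M) < ennreal e"
    and m2: "(\<integral>\<^sup>+ \<omega>. ennreal ((cmod (simple_integral W (n m) (p m) (\<xi> m) \<omega> - J \<omega>))\<^sup>2) \<partial>M) < ennreal e"
    using eventually_happens'[OF sequentially_bot eventually_conj[OF order_tendstoD(2)[OF L1 e'] order_tendstoD(2)[OF L2 e']]]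
    by blast
  let ?a = "p m" and ?b = "\<lambda>k. p m (Suc k)"
  have part: "p m 0 = 0" "p m (n m) = t" "\<And>k. k < n m \<Longrightarrow> p m k < p m (Suc k)"
    using si[of m] by (auto simp: simple_integrand_def is_partition_def)
  have nonneg: "0 \<le> p m k" if "k \<le> n m" for k
    using that
  proof (induction k)
    case (Suc k)
    then show ?case using part(3)[of k] by simp
  qed (simp add: part)
  have le_t: "p m k \<le> t" if "k \<le> n m" for k
    using that
  proof (induction rule: inc_induct)
    case (step k)
    then show ?case using part(3)[of k] by simp
  qed (simp add: part)
  have el: "elementary (n m) ?a ?b (\<xi> m)"
    unfolding elementary_def using si[of m] nonneg part
    by (auto simp: simple_integrand_def less_imp_le)
  note [measurable] = el
  let ?P = "\<lambda>z. step_process (n m) ?a ?b (\<xi> m) z - indicator {0<..t} (snd z) * Z z"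
  have sp: "step_process (n m) ?a ?b (\<xi> m) (\<omega>, s) = simple_process (n m) (p m) (\<xi> m) s \<omega>" for \<omega> s
    by (simp add: step_process_def simple_process_def)
  \<comment> \<open>Simple processes on a partition of \<open>[0, t]\<close> vanish outside that
    interval, so the norm over all times is the one in the definition of the Ito integral.\<close>
  have sp0: "simple_process (n m) (p m) (\<xi> m) s \<omega> = 0" if "s \<notin> {0..t}" for s \<omega>
    unfolding simple_process_def
  proof (rule sum.neutral, safe)
    fix k assume "k < n m"
    then have "s \<notin> {p m k<..p m (Suc k)}" using that nonneg[of k] le_t[of "Suc k"] by auto
    then show "indicator {p m k<..p m (Suc k)} s * \<xi> m k \<omega> = 0" by simp
  qed
  have "sq Q ?P = (\<integral>\<^sup>+\<omega>. \<integral>\<^sup>+s. ennreal ((cmod (?P (\<omega>, s)))\<^sup>2) \<partial>lborel \<partial>M)"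
    unfolding sq_def by (subst lborel.nn_integral_fst[symmetric]) auto
  also have "\<dots> = (\<integral>\<^sup>+ \<omega>. (\<integral>\<^sup>+ s\<in>{0..t}.
            ennreal ((cmod (simple_process (n m) (p m) (\<xi> m) s \<omega> - Y s \<omega>))\<^sup>2) \<partial>lborel) \<partial>M)"
  proof (rule nn_integral_cong_AE, use eq in eventually_elim)
    fix \<omega> assume \<omega>: "\<forall>s\<in>{0<..t}. Y s \<omega> = Z (\<omega>, s)"
    show "(\<integral>\<^sup>+s. ennreal ((cmod (?P (\<omega>, s)))\<^sup>2) \<partial>lborel) =
      (\<integral>\<^sup>+ s\<in>{0..t}. ennreal ((cmod (simple_process (n m) (p m) (\<xi> m) s \<omega> - Y s \<omega>))\<^sup>2) \<partial>lborel)"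
    proof (rule nn_integral_cong_AE, use AE_lborel_singleton[of 0] in eventually_elim)
      fix s :: real assume "s \<noteq> 0"
      then show "ennreal ((cmod (?P (\<omega>, s)))\<^sup>2) =
        ennreal ((cmod (simple_process (n m) (p m) (\<xi> m) s \<omega> - Y s \<omega>))\<^sup>2) * indicator {0..t} s"
        using \<omega> sp0[of s \<omega>] by (cases "s \<in> {0..t}") (auto simp: sp indicator_def)
    qed
  qed
  finally have "sq Q ?P \<le> ennreal e" using m1 by simp
  moreover have "sq M (\<lambda>\<omega>. step_integral (n m) ?a ?b (\<xi> m) \<omega> - J \<omega>) \<le> ennreal e"
    using m2 by (simp add: sq_def step_integral_def simple_integral_def)
  ultimately show "\<exists>n a b \<xi>. elementary n a b \<xi> \<and>
      sq Q (\<lambda>z. step_process n a b \<xi> z - indicator {0<..t} (snd z) * Z z) \<le> ennreal e \<and>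
        sq M (\<lambda>\<omega>. step_integral n a b \<xi> \<omega> - J \<omega>) \<le> ennreal e" using el by blast
qed

end

section \<open>Solutions with continuous paths\<close>

text \<open>Continuity of every path, on the whole line, yields joint measurability and lets
  pathwise integrals be formed without exceptional sets.\<close>

lemma (in prob_space) continuous_version:
  fixes h :: "real \<Rightarrow> 'a \<Rightarrow> complex"
  assumes meas: "\<And>t. 0 \<le> t \<Longrightarrow> h t \<in> borel_measurable M"
    and cont: "AE \<omega> in M. continuous_on {0..} (\<lambda>t. h t \<omega>)"
    and circ: "\<And>t \<omega>. 0 \<le> t \<Longrightarrow> \<omega> \<in> space M \<Longrightarrow> h t \<omega> \<in> circle"
  obtains H where "\<And>t. H t \<in> borel_measurable M"
    "\<And>\<omega>. \<omega> \<in> space M \<Longrightarrow> continuous_on UNIV (\<lambda>t. H t \<omega>)"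
    "\<And>t \<omega>. \<omega> \<in> space M \<Longrightarrow> H t \<omega> \<in> circle" "AE \<omega> in M. \<forall>t\<ge>0. H t \<omega> = h t \<omega>"
proof -
  obtain N where N: "{\<omega> \<in> space M. \<not> continuous_on {0..} (\<lambda>t. h t \<omega>)} \<subseteq> N" "emeasure M N = 0" "N \<in> sets M"
    using cont by (rule AE_E)
  \<comment> \<open>The constant 1 keeps the exceptional paths on the circle. Negative times repeat
    time 0, which matters because \<open>grid_before\<close> can be negative.\<close>
  define H where "H t \<omega> = (if \<omega> \<in> N then 1 else h (max 0 t) \<omega>)" for t \<omega>
  show thesis
  proof
    show "H t \<in> borel_measurable M" for t
    proof -
      note [measurable] = N(3) meas[of "max 0 t", simplified]
      show ?thesis unfolding H_def by measurable
    qed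
    show "continuous_on UNIV (\<lambda>t. H t \<omega>)" if "\<omega> \<in> space M" for \<omega>
    proof (cases "\<omega> \<in> N")
      case False
      with N(1) that have "continuous_on {0..} (\<lambda>t. h t \<omega>)" by auto
      then have "continuous_on UNIV (\<lambda>t. h (max 0 t) \<omega>)"
        by (rule continuous_on_compose2) (auto intro!: continuous_intros)
      then show ?thesis using False by (simp add: H_def)
    qed (simp add: H_def)
    show "H t \<omega> \<in> circle" if "\<omega> \<in> space M" for t \<omega>
      using circ[of "max 0 t" \<omega>] that by (simp add: H_def)
    show "AE \<omega> in M. \<forall>t\<ge>0. H t \<omega> = h t \<omega>"
      using N(2,3) by (intro AE_I'[of N]) (auto simp: H_def null_sets_def)
  qed
qed

text \<open>The ceiling minus one, not the floor: on a left-open cell, its right end included, the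
  value is the left end, in agreement with the cells of step processes.\<close>

definition grid_before :: "real \<Rightarrow> real \<Rightarrow> real" where
  "grid_before \<tau> s = (of_int \<lceil>s / \<tau>\<rceil> - 1) * \<tau>"

lemma grid_before_bounds:
  assumes "0 < \<tau>"
  shows "grid_before \<tau> s < s" "s - \<tau> \<le> grid_before \<tau> s"
proof -
  have "s \<le> of_int \<lceil>s / \<tau>\<rceil> * \<tau>"
    using pos_divide_le_eq[OF assms] le_of_int_ceiling by blast
  moreover have "of_int \<lceil>s / \<tau>\<rceil> - 1 < s / \<tau>" by linarith
  then have "(of_int \<lceil>s / \<tau>\<rceil> - 1) * \<tau> < s"
    using assms by (simp add: pos_less_divide_eq)
  ultimately show "grid_before \<tau> s < s" "s - \<tau> \<le> grid_before \<tau> s"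
    by (simp_all add: grid_before_def algebra_simps)
qed

lemma grid_before_eq:
  assumes "0 < \<tau>" "s \<in> {real k * \<tau><..real (Suc k) * \<tau>}"
  shows "grid_before \<tau> s = real k * \<tau>"
proof -
  have "real k < s / \<tau>" "s / \<tau> \<le> real k + 1" using assms by (auto simp: field_simps)
  then have "\<lceil>s / \<tau>\<rceil> = int k + 1" by linarith
  then show ?thesis by (simp add: grid_before_def)
qed

lemma grid_before_tendsto:
  assumes "\<And>n. 0 < \<tau> n" "\<tau> \<longlonglongrightarrow> 0"
  shows "(\<lambda>n. grid_before (\<tau> n) s) \<longlonglongrightarrow> s"
proof (rule tendsto_sandwich[of "\<lambda>n. s - \<tau> n" _ _ "\<lambda>_. s"])
  show "(\<lambda>n. s - \<tau> n) \<longlonglongrightarrow> s" using tendsto_diff[OF tendsto_const assms(2), of s] by simp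
qed (auto intro!: always_eventually simp: grid_before_bounds assms less_imp_le)

lemma sum_indicator_grid:
  assumes "0 < \<tau>"
  shows "(\<Sum>j<k. indicator {real j * \<tau><..real (Suc j) * \<tau>} s) = (indicator {0<..real k * \<tau>} s :: 'b :: comm_semiring_1)"
proof (induction k)
  case (Suc k)
  have "0 \<le> real k * \<tau>" "real k * \<tau> < real (Suc k) * \<tau>" using assms by simp_all
  then show ?case unfolding sum.lessThan_Suc Suc by (auto simp: indicator_def)
qed simp

lemma measurable_grid_process:
  assumes "\<And>t. H t \<in> borel_measurable M"
  shows "(\<lambda>z. H (grid_before \<tau> (snd z)) (fst z)) \<in> borel_measurable (M \<Otimes>\<^sub>M lborel)"
  unfolding grid_before_def
proof (rule measurable_compose_countable[where f="\<lambda>i z. H ((of_int i - 1) * \<tau>) (fst z)" and g="\<lambda>z. \<lceil>snd z / \<tau>\<rceil>"])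
  show "(\<lambda>z. H ((real_of_int i - 1) * \<tau>) (fst z)) \<in> borel_measurable (M \<Otimes>\<^sub>M lborel)" for i
    using assms[of "(real_of_int i - 1) * \<tau>"] by measurable
  show "(\<lambda>z. \<lceil>snd z / \<tau>\<rceil>) \<in> measurable (M \<Otimes>\<^sub>M lborel) (count_space UNIV)" by measurable
qed

text \<open>A continuous process is the pointwise limit of its samplings on finer and finer grids,
  and a sampling is jointly measurable because it uses countably many times.\<close>

lemma measurable_continuous_process:
  fixes H :: "real \<Rightarrow> 'a \<Rightarrow> complex"
  assumes "\<And>t. H t \<in> borel_measurable M" "\<And>\<omega>. \<omega> \<in> space M \<Longrightarrow> continuous_on UNIV (\<lambda>t. H t \<omega>)"
  shows "(\<lambda>z. H (snd z) (fst z)) \<in> borel_measurable (M \<Otimes>\<^sub>M lborel)"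
proof (rule borel_measurable_LIMSEQ_metric)
  let ?\<tau> = "\<lambda>n. inverse (real (Suc n))"
  show "(\<lambda>z. H (grid_before (?\<tau> n) (snd z)) (fst z)) \<in> borel_measurable (M \<Otimes>\<^sub>M lborel)" for n
    by (rule measurable_grid_process) (rule assms)
  fix z :: "'a \<times> real" assume "z \<in> space (M \<Otimes>\<^sub>M lborel)"
  then have "isCont (\<lambda>t. H t (fst z)) (snd z)"
    using assms(2)[of "fst z"] by (auto simp: space_pair_measure continuous_on_eq_continuous_at)
  moreover have "(\<lambda>n. grid_before (?\<tau> n) (snd z)) \<longlonglongrightarrow> snd z"
    by (rule grid_before_tendsto[OF _ LIMSEQ_inverse_real_of_nat]) simp
  ultimately show "(\<lambda>n. H (grid_before (?\<tau> n) (snd z)) (fst z)) \<longlonglongrightarrow> H (snd z) (fst z)"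
    by (rule isCont_tendsto_compose)
qed

text \<open>\<open>H\<close> is a version of \<open>h\<close> all of whose paths are continuous; unlike \<open>h\<close> it need not be adapted,
  because the filtration is not assumed to be complete.\<close>

locale circle_sde = brownian_motion M F W
  for M :: "'a measure" and F :: "real \<Rightarrow> 'a measure" and W :: "real \<Rightarrow> 'a \<Rightarrow> real" +
  fixes K \<sigma> :: real and x :: complex and h H J V :: "real \<Rightarrow> 'a \<Rightarrow> complex"
  assumes K: "0 < K" and \<sigma>: "0 < \<sigma>" and x: "x \<in> circle"
    and h_adapted: "\<And>t. 0 \<le> t \<Longrightarrow> h t \<in> borel_measurable (F t)"
    and h_circle: "\<And>t \<omega>. 0 \<le> t \<Longrightarrow> \<omega> \<in> space M \<Longrightarrow> h t \<omega> \<in> circle"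
    and h_0: "AE \<omega> in M. h 0 \<omega> = x"
    and H_measurable: "\<And>t. H t \<in> borel_measurable M"
    and H_continuous: "\<And>\<omega>. \<omega> \<in> space M \<Longrightarrow> continuous_on UNIV (\<lambda>t. H t \<omega>)"
    and H_circle: "\<And>t \<omega>. \<omega> \<in> space M \<Longrightarrow> H t \<omega> \<in> circle"
    and H_eq: "AE \<omega> in M. \<forall>t\<ge>0. H t \<omega> = h t \<omega>"
    and J_ito: "\<And>t. 0 \<le> t \<Longrightarrow> ito (\<lambda>z. indicator {0<..t} (snd z) * H (snd z) (fst z)) (J t)"
    and V_covariation: "is_covariation M W h V"
    and h_eq: "\<And>t. 0 \<le> t \<Longrightarrow> AE \<omega> in M. h t \<omega> = x + integral {0..t} (\<lambda>s. of_real K * (1 - (H s \<omega>)\<^sup>2))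
      + \<i> * of_real \<sigma> * (J t \<omega> + V t \<omega> / 2)"

lemma circle_sde_exists:
  assumes "0 < K" "0 < \<epsilon>" "x \<in> circle" "brownian_motion M F W" and sol: "circle_sde_solution K \<epsilon> M F W x h"
  obtains H J V where "circle_sde M F W K (sqrt 2 * \<epsilon>) x h H J V"
proof -
  interpret brownian_motion M F W by fact
  have h: "\<And>t. 0 \<le> t \<Longrightarrow> h t \<in> borel_measurable (F t)" "\<And>t \<omega>. 0 \<le> t \<Longrightarrow> \<omega> \<in> space M \<Longrightarrow> h t \<omega> \<in> circle"
    "AE \<omega> in M. continuous_on {0..} (\<lambda>t. h t \<omega>)" "AE \<omega> in M. h 0 \<omega> = x"
    using sol unfolding circle_sde_solution_def by blast+
  obtain I where I: "is_stratonovich_integral M F W h I" and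
    eq: "\<And>t. 0 \<le> t \<Longrightarrow> AE \<omega> in M.
           h t \<omega> = x + integral {0..t} (\<lambda>s. of_real K * (1 - (h s \<omega>)\<^sup>2))
                     + of_real (sqrt 2) * \<i> * of_real \<epsilon> * I t \<omega>"
    using sol unfolding circle_sde_solution_def by blast
  obtain J V where J: "\<And>t. 0 \<le> t \<Longrightarrow> is_ito_integral M F W h t (J t)" and V: "is_covariation M W h V"
    and IJV: "\<And>t. 0 \<le> t \<Longrightarrow> AE \<omega> in M. I t \<omega> = J t \<omega> + V t \<omega> / 2"
    using I unfolding is_stratonovich_integral_def by blast
  have hM: "h t \<in> borel_measurable M" if "0 \<le> t" for t using h(1)[OF that] by (rule measurable_F)
  obtain H where H: "\<And>t. H t \<in> borel_measurable M"
    "\<And>\<omega>. \<omega> \<in> space M \<Longrightarrow> continuous_on UNIV (\<lambda>t. H t \<omega>)"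
    "\<And>t \<omega>. \<omega> \<in> space M \<Longrightarrow> H t \<omega> \<in> circle" "AE \<omega> in M. \<forall>t\<ge>0. H t \<omega> = h t \<omega>"
    using continuous_version[OF hM h(3) h(2)] by blast
  have "circle_sde M F W K (sqrt 2 * \<epsilon>) x h H J V"
  proof (unfold_locales)
    fix t :: real assume t: "0 \<le> t"
    show "ito (\<lambda>z. indicator {0<..t} (snd z) * H (snd z) (fst z)) (J t)"
    proof (rule ito_of_is_ito_integral[OF J[OF t] measurable_continuous_process[OF H(1,2)]])
      show "AE \<omega> in M. \<forall>s\<in>{0<..t}. h s \<omega> = H (snd (\<omega>, s)) (fst (\<omega>, s))"
        using H(4) by eventually_elim auto
    qed
    show "AE \<omega> in M. h t \<omega> = x + integral {0..t} (\<lambda>s. of_real K * (1 - (H s \<omega>)\<^sup>2))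
      + \<i> * of_real (sqrt 2 * \<epsilon>) * (J t \<omega> + V t \<omega> / 2)"
      using eq[OF t] IJV[OF t] H(4)
    proof eventually_elim
      case (elim \<omega>)
      have "integral {0..t} (\<lambda>s. of_real K * (1 - (H s \<omega>)\<^sup>2)) = integral {0..t} (\<lambda>s. of_real K * (1 - (h s \<omega>)\<^sup>2))"
        by (rule Henstock_Kurzweil_Integration.integral_cong) (use elim(3) in auto)
      then show ?case using elim(1,2) by (simp only: of_real_mult mult_ac)
    qed
  qed (use assms h H V in auto)
  then show thesis by (rule that)
qed

context circle_sde
begin

section \<open>Sampling error of a solution on a grid\<close>

abbreviation HQ :: "'a \<times> real \<Rightarrow> complex" where
  "HQ \<equiv> \<lambda>z. H (snd z) (fst z)"

definition osc :: "real \<Rightarrow> 'a \<times> real \<Rightarrow> complex" where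
  "osc \<tau> z = H (snd z) (fst z) - H (grid_before \<tau> (snd z)) (fst z)"

text \<open>First powers make this additive over the cells and directly comparable with errors of
  Riemann sums; squares are dominated through the bound 2 on \<open>osc\<close>. It is only shown to
  vanish as \<tau> does, without a rate, by continuity of the paths.\<close>

definition gap :: "real \<Rightarrow> real set \<Rightarrow> ennreal" where
  "gap \<tau> S = (\<integral>\<^sup>+z. indicator S (snd z) * ennreal (cmod (osc \<tau> z)) \<partial>Q)"

lemma measurable_HQ [measurable]: "HQ \<in> borel_measurable Q"
  by (rule measurable_continuous_process[OF H_measurable H_continuous])

lemma measurable_osc [measurable]: "osc \<tau> \<in> borel_measurable Q"
  unfolding osc_def[abs_def]
  by (intro borel_measurable_diff measurable_HQ measurable_grid_process H_measurable)

lemma cmod_H: "\<omega> \<in> space M \<Longrightarrow> cmod (H t \<omega>) = 1"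
  using H_circle[of \<omega> t] by simp

lemma cmod_h: "0 \<le> t \<Longrightarrow> \<omega> \<in> space M \<Longrightarrow> cmod (h t \<omega>) = 1"
  using h_circle[of t \<omega>] by simp

lemma cmod_osc:
  assumes "fst z \<in> space M"
  shows "cmod (osc \<tau> z) \<le> 2"
  unfolding osc_def using norm_triangle_ineq4[of "HQ z" "H (grid_before \<tau> (snd z)) (fst z)"]
  by (simp add: cmod_H[OF assms])

lemma osc_tendsto:
  assumes "\<And>n. 0 < \<tau> n" "\<tau> \<longlonglongrightarrow> 0" "fst z \<in> space M"
  shows "(\<lambda>n. cmod (osc (\<tau> n) z)) \<longlonglongrightarrow> 0"
proof -
  have "isCont (\<lambda>t. H t (fst z)) (snd z)"
    using H_continuous[OF assms(3)] by (simp add: continuous_on_eq_continuous_at)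
  then have "(\<lambda>n. H (grid_before (\<tau> n) (snd z)) (fst z)) \<longlonglongrightarrow> H (snd z) (fst z)"
    by (rule isCont_tendsto_compose) (rule grid_before_tendsto[OF assms(1,2)])
  then have "(\<lambda>n. osc (\<tau> n) z) \<longlonglongrightarrow> HQ z - HQ z"
    unfolding osc_def by (intro tendsto_diff tendsto_const)
  then show ?thesis using tendsto_norm by fastforce
qed

lemma gap_tendsto:
  assumes \<tau>: "\<And>n. 0 < \<tau> n" "\<tau> \<longlonglongrightarrow> 0"
  shows "(\<lambda>n. gap (\<tau> n) {0<..T}) \<longlonglongrightarrow> 0"
proof -
  have "(\<lambda>n. gap (\<tau> n) {0<..T}) \<longlonglongrightarrow> (\<integral>\<^sup>+z. 0 \<partial>Q)"
    unfolding gap_def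
  proof (rule nn_integral_dominated_convergence[where w="\<lambda>z. 2 * indicator {0<..T} (snd z)"])
    have "(\<integral>\<^sup>+z. 2 * indicator {0<..T} (snd z) \<partial>Q) = (\<integral>\<^sup>+\<omega>. \<integral>\<^sup>+s. 2 * indicator {0<..T} s \<partial>lborel \<partial>M)"
      by (subst lborel.nn_integral_fst[symmetric]) auto
    also have "\<dots> = 2 * emeasure lborel {0<..T}"
      by (simp add: nn_integral_cmult emeasure_space_1)
    also have "\<dots> < \<infinity>"
    proof -
      have "emeasure lborel {0<..T} \<le> emeasure lborel {0..T}" by (intro emeasure_mono) auto
      also have "\<dots> < \<infinity>" by (simp add: emeasure_lborel_Icc_eq)
      finally show ?thesis by (simp add: ennreal_mult_less_top)
    qed
    finally show "(\<integral>\<^sup>+z. 2 * indicator {0<..T} (snd z) \<partial>Q) < \<infinity>" .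
    show "AE z in Q. indicator {0<..T} (snd z) * ennreal (cmod (osc (\<tau> n) z)) \<le> 2 * indicator {0<..T} (snd z)" for n
    proof (rule AE_I2)
      fix z assume "z \<in> space Q"
      then have "ennreal (cmod (osc (\<tau> n) z)) \<le> ennreal 2"
        by (intro ennreal_leI cmod_osc) (auto simp: space_pair_measure)
      then show "indicator {0<..T} (snd z) * ennreal (cmod (osc (\<tau> n) z)) \<le> 2 * indicator {0<..T} (snd z)"
        by (simp add: indicator_def)
    qed
    show "AE z in Q. (\<lambda>n. indicator {0<..T} (snd z) * ennreal (cmod (osc (\<tau> n) z))) \<longlonglongrightarrow> 0"
    proof (rule AE_I2)
      fix z assume "z \<in> space Q"
      then have "(\<lambda>n. ennreal (cmod (osc (\<tau> n) z))) \<longlonglongrightarrow> ennreal 0"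
        by (intro tendsto_ennrealI osc_tendsto \<tau>) (auto simp: space_pair_measure)
      then show "(\<lambda>n. indicator {0<..T} (snd z) * ennreal (cmod (osc (\<tau> n) z))) \<longlonglongrightarrow> 0"
        by (simp add: indicator_def)
    qed
  qed auto
  then show ?thesis by simp
qed

lemma gap_mono: "S \<subseteq> S' \<Longrightarrow> gap \<tau> S \<le> gap \<tau> S'"
  unfolding gap_def by (intro nn_integral_mono mult_right_mono) (auto simp: indicator_def)

lemma sum_gap:
  assumes "0 < \<tau>"
  shows "(\<Sum>j<n. gap \<tau> {real j * \<tau><..real (Suc j) * \<tau>}) = gap \<tau> {0<..real n * \<tau>}"
proof -
  have "(\<Sum>j<n. gap \<tau> {real j * \<tau><..real (Suc j) * \<tau>}) =
    (\<integral>\<^sup>+z. (\<Sum>j<n. indicator {real j * \<tau><..real (Suc j) * \<tau>} (snd z) * ennreal (cmod (osc \<tau> z))) \<partial>Q)"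
    unfolding gap_def by (subst nn_integral_sum) auto
  then show ?thesis by (simp only: gap_def sum_distrib_right[symmetric] sum_indicator_grid[OF assms])
qed

lemma sq_le_gap:
  assumes [measurable]: "Y \<in> borel_measurable Q" "S \<in> sets borel"
    and eq: "AE \<omega> in M. \<forall>s. Y (\<omega>, s) = indicator S s * osc \<tau> (\<omega>, s)"
  shows "sq Q Y \<le> 2 * gap \<tau> S"
proof -
  have "sq Q Y = (\<integral>\<^sup>+\<omega>. \<integral>\<^sup>+s. ennreal ((cmod (Y (\<omega>, s)))\<^sup>2) \<partial>lborel \<partial>M)"
    unfolding sq_def by (subst lborel.nn_integral_fst[symmetric]) auto
  also have "\<dots> \<le> (\<integral>\<^sup>+\<omega>. \<integral>\<^sup>+s. 2 * (indicator S s * ennreal (cmod (osc \<tau> (\<omega>, s)))) \<partial>lborel \<partial>M)"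
  proof (rule nn_integral_mono_AE, use eq AE_space in eventually_elim)
    case (elim \<omega>)
    show ?case
    proof (rule nn_integral_mono)
      fix s
      have "(cmod (osc \<tau> (\<omega>, s)))\<^sup>2 \<le> 2 * cmod (osc \<tau> (\<omega>, s))"
        using cmod_osc[of "(\<omega>, s)" \<tau>] elim(2) by (simp add: power2_eq_square mult_right_mono)
      then have "ennreal ((cmod (osc \<tau> (\<omega>, s)))\<^sup>2) \<le> 2 * ennreal (cmod (osc \<tau> (\<omega>, s)))"
        using ennreal_leI by (fastforce simp: ennreal_mult')
      then show "ennreal ((cmod (Y (\<omega>, s)))\<^sup>2) \<le> 2 * (indicator S s * ennreal (cmod (osc \<tau> (\<omega>, s))))"
        using elim(1) by (simp add: indicator_def)
    qed
  qed
  also have "\<dots> = (\<integral>\<^sup>+z. 2 * (indicator S (snd z) * ennreal (cmod (osc \<tau> z))) \<partial>Q)"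
    by (subst lborel.nn_integral_fst[symmetric]) auto
  also have "\<dots> = 2 * gap \<tau> S"
    unfolding gap_def by (rule nn_integral_cmult) measurable
  finally show ?thesis .
qed

lemma elementary_h:
  assumes "\<And>j. j < k \<Longrightarrow> 0 \<le> a j \<and> a j \<le> b j"
  shows "elementary k a b (\<lambda>j. h (a j))"
  unfolding elementary_def
  using assms h_adapted cmod_h by (auto simp: bounded_iff intro!: exI[of _ 1])

text \<open>The Riemann sum is the Ito integral of the sampled process, built from \<open>h\<close>,
  which is adapted, while the error is measured with \<open>H\<close>; the two agree off a null set.
  The constant is 4 from \<open>ito_bound\<close> times 2 from \<open>sq_le_gap\<close>.\<close>

lemma sq_ito_sum:
  assumes \<tau>: "0 < \<tau>"
  shows "sq M (\<lambda>\<omega>. J (real k * \<tau>) \<omega> - (\<Sum>j<k. h (real j * \<tau>) \<omega> *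
      of_real (W (real (Suc j) * \<tau>) \<omega> - W (real j * \<tau>) \<omega>))) \<le> 8 * gap \<tau> {0<..real k * \<tau>}"
proof -
  let ?a = "\<lambda>j. real j * \<tau>" and ?b = "\<lambda>j. real (Suc j) * \<tau>"
  let ?Y = "\<lambda>z. indicator {0<..real k * \<tau>} (snd z) * HQ z - step_process k ?a ?b (\<lambda>j. h (?a j)) z"
  have el: "elementary k ?a ?b (\<lambda>j. h (?a j))"
    using \<tau> by (intro elementary_h) (auto intro: mult_right_mono)
  have [measurable]: "step_process k ?a ?b (\<lambda>j. h (?a j)) \<in> borel_measurable Q"
    by (rule measurable_step_process[OF el])
  have "sq M (\<lambda>\<omega>. J (real k * \<tau>) \<omega> - step_integral k ?a ?b (\<lambda>j. h (?a j)) \<omega>) \<le> 4 * sq Q ?Y"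
    using \<tau> by (intro ito_bound ito_diff ito_step[OF el] J_ito) simp
  also have "sq Q ?Y \<le> 2 * gap \<tau> {0<..real k * \<tau>}"
  proof (rule sq_le_gap)
    show "AE \<omega> in M. \<forall>s. ?Y (\<omega>, s) = indicator {0<..real k * \<tau>} s * osc \<tau> (\<omega>, s)"
      using H_eq
    proof (eventually_elim, intro allI)
      fix \<omega> s assume \<omega>: "\<forall>t\<ge>0. H t \<omega> = h t \<omega>"
      have "step_process k ?a ?b (\<lambda>j. h (?a j)) (\<omega>, s) =
          (\<Sum>j<k. indicator {?a j<..?b j} s * H (grid_before \<tau> s) \<omega>)"
        unfolding step_process_def fst_conv snd_conv
      proof (rule sum.cong)
        fix j
        show "indicator {?a j<..?b j} s * h (?a j) \<omega> = indicator {?a j<..?b j} s * H (grid_before \<tau> s) \<omega>"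
          using \<omega> \<tau> grid_before_eq[OF \<tau>, of s j] by (cases "s \<in> {?a j<..?b j}") simp_all
      qed simp
      also have "\<dots> = indicator {0<..real k * \<tau>} s * H (grid_before \<tau> s) \<omega>"
        by (simp only: sum_distrib_right[symmetric] sum_indicator_grid[OF \<tau>])
      finally show "?Y (\<omega>, s) = indicator {0<..real k * \<tau>} s * osc \<tau> (\<omega>, s)"
        by (simp add: osc_def algebra_simps)
    qed
    show "?Y \<in> borel_measurable Q" by measurable
  qed simp
  finally show ?thesis by (simp add: step_integral_def mult.assoc[symmetric] mult_left_mono)
qed

text \<open>The local form for one cell. These bounds add up to the gap over the whole interval,
  whereas the global bound used in every cell would lose a factor equal to the number of
  cells.\<close>

lemma sq_ito_increment:
  assumes \<tau>: "0 < \<tau>"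
  shows "sq M (\<lambda>\<omega>. J (real (Suc k) * \<tau>) \<omega> - J (real k * \<tau>) \<omega> - h (real k * \<tau>) \<omega> *
      of_real (W (real (Suc k) * \<tau>) \<omega> - W (real k * \<tau>) \<omega>)) \<le> 8 * gap \<tau> {real k * \<tau><..real (Suc k) * \<tau>}"
proof -
  let ?s = "real k * \<tau>" and ?t = "real (Suc k) * \<tau>"
  have st: "0 \<le> ?s" "?s \<le> ?t" using \<tau> by (auto intro: mult_right_mono)
  let ?a = "\<lambda>_::nat. ?s" and ?b = "\<lambda>_::nat. ?t"
  let ?Y = "\<lambda>z. indicator {0<..?t} (snd z) * HQ z - indicator {0<..?s} (snd z) * HQ z
    - step_process 1 ?a ?b (\<lambda>j. h (?a j)) z"
  have el: "elementary 1 ?a ?b (\<lambda>j. h (?a j))"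
    using st by (intro elementary_h) auto
  have [measurable]: "step_process 1 ?a ?b (\<lambda>j. h (?a j)) \<in> borel_measurable Q"
    by (rule measurable_step_process[OF el])
  have "sq M (\<lambda>\<omega>. J ?t \<omega> - J ?s \<omega> - step_integral 1 ?a ?b (\<lambda>j. h (?a j)) \<omega>) \<le> 4 * sq Q ?Y"
    using st by (intro ito_bound ito_diff ito_step[OF el] J_ito) simp_all
  also have "sq Q ?Y \<le> 2 * gap \<tau> {?s<..?t}"
  proof (rule sq_le_gap)
    show "AE \<omega> in M. \<forall>s. ?Y (\<omega>, s) = indicator {?s<..?t} s * osc \<tau> (\<omega>, s)"
      using H_eq
    proof (eventually_elim, intro allI)
      fix \<omega> s assume \<omega>: "\<forall>t\<ge>0. H t \<omega> = h t \<omega>"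
      have "H ?s \<omega> = h ?s \<omega>" using \<omega> st by blast
      then show "?Y (\<omega>, s) = indicator {?s<..?t} s * osc \<tau> (\<omega>, s)"
        using st grid_before_eq[OF \<tau>, of s k] by (auto simp: step_process_def osc_def indicator_def)
    qed
    show "?Y \<in> borel_measurable Q" by measurable
  qed simp
  finally show ?thesis by (simp add: step_integral_def mult.assoc[symmetric] mult_left_mono)
qed

end

section \<open>The covariation of a solution with the Brownian motion\<close>

lemma integral_eq_lborel:
  fixes g :: "real \<Rightarrow> complex"
  assumes "continuous_on {a..b} g"
  shows "integral {a..b} g = (\<integral>s. indicator {a..b} s *\<^sub>R g s \<partial>lborel)"
    and "integrable lborel (\<lambda>s. indicator {a..b} s *\<^sub>R g s)"
  using set_borel_integral_eq_integral(2)[OF borel_integrable_atLeastAtMost'[OF assms]]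
    borel_integrable_atLeastAtMost'[OF assms]
  by (auto simp: set_lebesgue_integral_def set_integrable_def)

lemma norm_integral_le_nn_integral:
  fixes g :: "real \<Rightarrow> complex"
  assumes "continuous_on {a..b} g"
  shows "ennreal (cmod (integral {a..b} g)) \<le> (\<integral>\<^sup>+s. indicator {a<..b} s * ennreal (cmod (g s)) \<partial>lborel)"
proof -
  note i = integral_eq_lborel[OF assms]
  have "ennreal (cmod (integral {a..b} g)) \<le> ennreal (\<integral>s. cmod (indicator {a..b} s *\<^sub>R g s) \<partial>lborel)"
    unfolding i(1) by (intro ennreal_leI integral_norm_bound)
  also have "\<dots> = (\<integral>\<^sup>+s. ennreal (cmod (indicator {a..b} s *\<^sub>R g s)) \<partial>lborel)"
    by (intro nn_integral_eq_integral[symmetric] integrable_norm i(2)) auto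
  also have "\<dots> = (\<integral>\<^sup>+s. indicator {a<..b} s * ennreal (cmod (g s)) \<partial>lborel)"
    by (rule nn_integral_cong_AE, use AE_lborel_singleton[of a] in eventually_elim)
      (auto simp: indicator_def)
  finally show ?thesis .
qed

text \<open>On a cell the error is the integral of \<open>g s\<close> minus its value at the left
  end. For a path of \<open>H\<close> the right side is the pathwise form of \<open>gap\<close>, so
  one quantity controls time integrals and Ito integrals.\<close>

lemma riemann_error:
  fixes g :: "real \<Rightarrow> complex"
  assumes g: "continuous_on UNIV g" and \<tau>: "0 < \<tau>"
  shows "ennreal (cmod (integral {0..real k * \<tau>} g - (\<Sum>j<k. g (real j * \<tau>) * of_real \<tau>)))
    \<le> (\<integral>\<^sup>+s. indicator {0<..real k * \<tau>} s * ennreal (cmod (g s - g (grid_before \<tau> s))) \<partial>lborel)"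
proof (induction k)
  case (Suc k)
  let ?s = "real k * \<tau>" and ?t = "real (Suc k) * \<tau>"
  have st: "0 \<le> ?s" "?s \<le> ?t" "?t - ?s = \<tau>" using \<tau> by (auto simp: algebra_simps)
  have int: "g integrable_on {a..b}" for a b
    by (intro integrable_continuous_real continuous_on_subset[OF g]) auto
  have c: "continuous_on {?s..?t} (\<lambda>s. g s - g ?s)"
    by (intro continuous_intros continuous_on_subset[OF g]) auto
  have "integral {0..?t} g = integral {0..?s} g + integral {?s..?t} g"
    using Henstock_Kurzweil_Integration.integral_combine[OF st(1,2) int] by simp
  moreover have "integral {?s..?t} (\<lambda>s. g s - g ?s) = integral {?s..?t} g - g ?s * of_real \<tau>"
    using int st by (subst Henstock_Kurzweil_Integration.integral_diff) (auto simp: scaleR_conv_of_real mult.commute)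
  ultimately have "integral {0..?t} g - (\<Sum>j<Suc k. g (real j * \<tau>) * of_real \<tau>) =
      (integral {0..?s} g - (\<Sum>j<k. g (real j * \<tau>) * of_real \<tau>)) + integral {?s..?t} (\<lambda>s. g s - g ?s)"
    by simp
  then have "ennreal (cmod (integral {0..?t} g - (\<Sum>j<Suc k. g (real j * \<tau>) * of_real \<tau>))) \<le>
    ennreal (cmod (integral {0..?s} g - (\<Sum>j<k. g (real j * \<tau>) * of_real \<tau>))) +
    ennreal (cmod (integral {?s..?t} (\<lambda>s. g s - g ?s)))"
    by (simp add: ennreal_plus[symmetric] norm_triangle_ineq ennreal_leI del: ennreal_plus sum.lessThan_Suc)
  also have "\<dots> \<le> (\<integral>\<^sup>+s. indicator {0<..?s} s * ennreal (cmod (g s - g (grid_before \<tau> s))) \<partial>lborel) +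
     (\<integral>\<^sup>+s. indicator {?s<..?t} s * ennreal (cmod (g s - g (grid_before \<tau> s))) \<partial>lborel)"
  proof (intro add_mono Suc)
    have "ennreal (cmod (integral {?s..?t} (\<lambda>s. g s - g ?s))) \<le>
      (\<integral>\<^sup>+s. indicator {?s<..?t} s * ennreal (cmod (g s - g ?s)) \<partial>lborel)"
      by (rule norm_integral_le_nn_integral[OF c])
    also have "\<dots> = (\<integral>\<^sup>+s. indicator {?s<..?t} s * ennreal (cmod (g s - g (grid_before \<tau> s))) \<partial>lborel)"
    proof (rule nn_integral_cong)
      fix s
      show "indicator {?s<..?t} s * ennreal (cmod (g s - g ?s)) =
        indicator {?s<..?t} s * ennreal (cmod (g s - g (grid_before \<tau> s)))"
        using grid_before_eq[OF \<tau>, of s k] by (cases "s \<in> {?s<..?t}") simp_all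
    qed
    finally show "ennreal (cmod (integral {?s..?t} (\<lambda>s. g s - g ?s))) \<le>
      (\<integral>\<^sup>+s. indicator {?s<..?t} s * ennreal (cmod (g s - g (grid_before \<tau> s))) \<partial>lborel)" .
  qed
  also have "\<dots> = (\<integral>\<^sup>+s. indicator {0<..?s} s * ennreal (cmod (g s - g (grid_before \<tau> s))) +
     indicator {?s<..?t} s * ennreal (cmod (g s - g (grid_before \<tau> s))) \<partial>lborel)"
  proof -
    have [measurable]: "g \<in> borel_measurable borel" using g by (rule borel_measurable_continuous_onI)
    have [measurable]: "grid_before \<tau> \<in> borel_measurable borel" unfolding grid_before_def[abs_def] by measurable
    show ?thesis by (subst nn_integral_add) auto
  qed
  also have "\<dots> = (\<integral>\<^sup>+s. indicator {0<..?t} s * ennreal (cmod (g s - g (grid_before \<tau> s))) \<partial>lborel)"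
    using sum_indicator_grid[OF \<tau>, where k="Suc k" and 'b=ennreal] sum_indicator_grid[OF \<tau>, where k=k and 'b=ennreal]
    by (simp only: sum.lessThan_Suc distrib_right[symmetric])
  finally show ?case .
qed simp

text \<open>A metric for convergence in probability.\<close>

definition trunc :: "'b measure \<Rightarrow> ('b \<Rightarrow> complex) \<Rightarrow> ennreal" where
  "trunc N f = (\<integral>\<^sup>+z. min 1 (ennreal (cmod (f z))) \<partial>N)"

lemma trunc_add:
  assumes [measurable]: "f \<in> borel_measurable N" "g \<in> borel_measurable N"
  shows "trunc N (\<lambda>z. f z + g z) \<le> trunc N f + trunc N g"
proof -
  have "min 1 (ennreal (cmod (u + v))) \<le> min 1 (ennreal (cmod u)) + min 1 (ennreal (cmod v))" for u v
  proof -
    have "min 1 (cmod (u + v)) \<le> min 1 (cmod u) + min 1 (cmod v)"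
      using norm_triangle_ineq[of u v] norm_ge_zero[of u] norm_ge_zero[of v] unfolding min_def
      by (smt (verit))
    then have "ennreal (min 1 (cmod (u + v))) \<le> ennreal (min 1 (cmod u) + min 1 (cmod v))" by (rule ennreal_leI)
    then show ?thesis by (simp add: min_ennreal[symmetric])
  qed
  then have "trunc N (\<lambda>z. f z + g z) \<le> (\<integral>\<^sup>+z. min 1 (ennreal (cmod (f z))) + min 1 (ennreal (cmod (g z))) \<partial>N)"
    unfolding trunc_def by (intro nn_integral_mono)
  also have "\<dots> = trunc N f + trunc N g" unfolding trunc_def by (subst nn_integral_add) auto
  finally show ?thesis .
qed

lemma trunc_eq_0:
  assumes [measurable]: "f \<in> borel_measurable N" and "trunc N f = 0"
  shows "AE z in N. f z = 0"
proof -
  have "AE z in N. min 1 (ennreal (cmod (f z))) = 0"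
    using assms(2) unfolding trunc_def by (subst (asm) nn_integral_0_iff_AE) auto
  then show ?thesis by eventually_elim (auto simp: min_def split: if_splits)
qed

lemma trunc_le_nn_integral: "trunc N f \<le> (\<integral>\<^sup>+z. ennreal (cmod (f z)) \<partial>N)"
  unfolding trunc_def by (intro nn_integral_mono) simp

lemma (in prob_space) trunc_tendsto_AE:
  assumes [measurable]: "\<And>n. f n \<in> borel_measurable M" and lim: "AE z in M. (\<lambda>n. f n z) \<longlonglongrightarrow> 0"
  shows "(\<lambda>n. trunc M (f n)) \<longlonglongrightarrow> 0"
proof -
  have "(\<lambda>n. trunc M (f n)) \<longlonglongrightarrow> (\<integral>\<^sup>+z. 0 \<partial>M)"
    unfolding trunc_def
  proof (rule nn_integral_dominated_convergence[where w="\<lambda>_. 1"])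
    show "AE z in M. (\<lambda>n. min 1 (ennreal (cmod (f n z)))) \<longlonglongrightarrow> 0"
      using lim
    proof eventually_elim
      case (elim z)
      then have "(\<lambda>n. ennreal (cmod (f n z))) \<longlonglongrightarrow> ennreal (cmod 0)"
        by (intro tendsto_ennrealI tendsto_norm)
      then have "(\<lambda>n. min 1 (ennreal (cmod (f n z)))) \<longlonglongrightarrow> min 1 (ennreal (cmod 0))"
        by (intro tendsto_min tendsto_const)
      then show ?case by simp
    qed
  qed (auto simp: emeasure_space_1)
  then show ?thesis by simp
qed

text \<open>Pointwise, a number is at most \<open>\<delta>\<close> or at most its square over
  \<open>\<delta>\<close>. The form \<open>1 * \<delta>\<close> fits the pattern
  \<open>C * \<delta>\<close> of \<open>young_tendsto_0\<close>.\<close>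

lemma (in prob_space) trunc_le_sq:
  assumes [measurable]: "f \<in> borel_measurable M" and \<delta>: "0 < \<delta>"
  shows "trunc M f \<le> ennreal (1 * \<delta>) + ennreal (1 / \<delta>) * sq M f"
proof -
  have "min 1 (ennreal (cmod u)) \<le> ennreal \<delta> + ennreal (1 / \<delta>) * ennreal ((cmod u)\<^sup>2)" for u
  proof -
    have "cmod u \<le> \<delta> + (1 / \<delta>) * (cmod u)\<^sup>2"
    proof (cases "cmod u \<le> \<delta>")
      case False
      then have "cmod u * \<delta> \<le> cmod u * cmod u" by (intro mult_left_mono) auto
      then have "cmod u \<le> (1 / \<delta>) * (cmod u)\<^sup>2" using \<delta> by (simp add: field_simps power2_eq_square)
      then show ?thesis using \<delta> by linarith
    qed (use \<delta> in \<open>simp add: add_increasing2\<close>)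
    then have "ennreal (cmod u) \<le> ennreal (\<delta> + (1 / \<delta>) * (cmod u)\<^sup>2)" by (rule ennreal_leI)
    also have "\<dots> = ennreal \<delta> + ennreal (1 / \<delta>) * ennreal ((cmod u)\<^sup>2)"
      using \<delta> by (simp add: ennreal_mult'[symmetric])
    finally show ?thesis using min.coboundedI2 by blast
  qed
  then have "trunc M f \<le> (\<integral>\<^sup>+z. ennreal \<delta> + ennreal (1 / \<delta>) * ennreal ((cmod (f z))\<^sup>2) \<partial>M)"
    unfolding trunc_def by (intro nn_integral_mono)
  also have "\<dots> = ennreal (1 * \<delta>) + ennreal (1 / \<delta>) * sq M f"
    unfolding sq_def by (subst nn_integral_add) (auto simp: nn_integral_cmult emeasure_space_1)
  finally show ?thesis .
qed

text \<open>First \<delta> is fixed small, then \<open>n\<close> tends to infinity; the bad factor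
  \<open>D / \<delta>\<close> is constant by then.\<close>

lemma young_tendsto_0:
  fixes q e :: "nat \<Rightarrow> ennreal"
  assumes e: "e \<longlonglongrightarrow> 0" and C: "0 \<le> C" and q: "\<And>n \<delta>. 0 < \<delta> \<Longrightarrow> q n \<le> ennreal (C * \<delta>) + ennreal (D / \<delta>) * e n"
  shows "q \<longlonglongrightarrow> 0"
proof (rule order_tendstoI)
  fix a :: ennreal assume "0 < a"
  then obtain r where r: "0 < ennreal r" "ennreal r < a" "0 < r"
    using ennreal_rat_dense[of 0 a] by (metis dense ennreal_cases ennreal_less_zero_iff less_top_ennreal order.strict_trans zero_less_iff_neq_zero ennreal_eq_0_iff not_le top.not_eq_extremum)
  \<comment> \<open>Makes \<open>C * \<delta> \<le> r / 2\<close>; the added 1 covers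
    \<open>C = 0\<close>.\<close>
  define \<delta> where "\<delta> = r / (2 * (C + 1))"
  have \<delta>: "0 < \<delta>" using r C by (simp add: \<delta>_def)
  have "C * \<delta> \<le> r / 2" using r C by (simp add: \<delta>_def divide_simps)
  then have 1: "ennreal (C * \<delta>) \<le> ennreal (r / 2)" by (rule ennreal_leI)
  have "(\<lambda>n. ennreal (D / \<delta>) * e n) \<longlonglongrightarrow> ennreal (D / \<delta>) * 0"
    by (intro ennreal_tendsto_cmult e) simp
  then have "\<forall>\<^sub>F n in sequentially. ennreal (D / \<delta>) * e n < ennreal (r / 2)"
    using r by (intro order_tendstoD(2)) auto
  then show "\<forall>\<^sub>F n in sequentially. q n < a"
  proof eventually_elim
    case (elim n)
    have "q n \<le> ennreal (r / 2) + ennreal (r / 2)"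
      using q[OF \<delta>, of n] 1 elim by (meson add_mono less_imp_le order_trans)
    also have "\<dots> = ennreal r" using r by (simp add: ennreal_plus[symmetric] del: ennreal_plus)
    finally show ?case using r by simp
  qed
qed simp

context circle_sde
begin

section \<open>Covariation sums over uniform partitions\<close>

lemma measurable_h: "0 \<le> t \<Longrightarrow> h t \<in> borel_measurable M"
  using h_adapted measurable_F by blast

lemma measurable_J: "0 \<le> t \<Longrightarrow> J t \<in> borel_measurable M"
  using J_ito by (simp add: ito_def)

lemma measurable_V: "0 \<le> t \<Longrightarrow> V t \<in> borel_measurable M"
  using V_covariation by (simp add: is_covariation_def)

definition \<Delta> :: "(real \<Rightarrow> 'a \<Rightarrow> 'b::minus) \<Rightarrow> real \<Rightarrow> nat \<Rightarrow> 'a \<Rightarrow> 'b" where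
  "\<Delta> Y \<tau> k \<omega> = Y (real (Suc k) * \<tau>) \<omega> - Y (real k * \<tau>) \<omega>"

lemma measurable_\<Delta>:
  assumes "0 < \<tau>"
  shows "\<Delta> W \<tau> k \<in> borel_measurable M" "\<Delta> h \<tau> k \<in> borel_measurable M"
    "\<Delta> J \<tau> k \<in> borel_measurable M" "\<Delta> V \<tau> k \<in> borel_measurable M"
  unfolding \<Delta>_def[abs_def] using assms
  by (auto intro!: borel_measurable_diff measurable_W measurable_h measurable_J measurable_V)

lemma trunc_covariation_tendsto:
  assumes t: "0 < t"
  defines "\<tau> \<equiv> \<lambda>n. t / real (Suc n)"
  shows "(\<lambda>n. trunc M (\<lambda>\<omega>. V t \<omega> - (\<Sum>k<Suc n. \<Delta> h (\<tau> n) k \<omega> * of_real (\<Delta> W (\<tau> n) k \<omega>)))) \<longlonglongrightarrow> 0"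
proof (rule order_tendstoI)
  let ?S = "\<lambda>n \<omega>. \<Sum>k<Suc n. \<Delta> h (\<tau> n) k \<omega> * of_real (\<Delta> W (\<tau> n) k \<omega>)"
  have \<tau>: "0 < \<tau> n" for n using t by (simp add: \<tau>_def)
  have [measurable]: "V t \<in> borel_measurable M" using t by (intro measurable_V) simp
  have [measurable]: "?S n \<in> borel_measurable M" for n
    using measurable_\<Delta>[OF \<tau>] by measurable
  fix a :: ennreal assume "0 < a"
  then obtain r where r: "0 < r" "ennreal r < a"
    by (metis dense ennreal_cases ennreal_less_zero_iff less_top_ennreal order.strict_trans not_less_zero top.not_eq_extremum)
  have "\<forall>t\<ge>0. \<forall>a>0. \<forall>r>0. \<exists>\<delta>>0. \<forall>n p.
        is_partition t n p \<and> (\<forall>k<n. p (Suc k) - p k < \<delta>) \<longrightarrow>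
        measure M {\<omega> \<in> space M.
          cmod ((\<Sum>k<n. (h (p (Suc k)) \<omega> - h (p k) \<omega>) * of_real (W (p (Suc k)) \<omega> - W (p k) \<omega>))
            - V t \<omega>) > a} < r"
    using V_covariation unfolding is_covariation_def by blast
  \<comment> \<open>Half of \<open>r\<close> is used as size and half as probability: the truncated
    distance is at most \<open>r / 2\<close> off the bad event and at most 1 on it.\<close>
  moreover have "0 \<le> t" "0 < r / 2" using t r by auto
  ultimately obtain d where d: "0 < d" "\<And>n p. is_partition t n p \<Longrightarrow> (\<forall>k<n. p (Suc k) - p k < d) \<Longrightarrow>
        measure M {\<omega> \<in> space M.
          cmod ((\<Sum>k<n. (h (p (Suc k)) \<omega> - h (p k) \<omega>) * of_real (W (p (Suc k)) \<omega> - W (p k) \<omega>))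
            - V t \<omega>) > r / 2} < r / 2"
    by meson
  have "\<tau> \<longlonglongrightarrow> 0"
    unfolding \<tau>_def using LIMSEQ_Suc[OF lim_const_over_n[of t]] by simp
  then have "\<forall>\<^sub>F n in sequentially. \<tau> n < d" using d(1) by (rule order_tendstoD)
  then show "\<forall>\<^sub>F n in sequentially. trunc M (\<lambda>\<omega>. V t \<omega> - ?S n \<omega>) < a"
  proof eventually_elim
    case (elim n)
    let ?p = "\<lambda>k. real k * \<tau> n"
    define A where "A = {\<omega> \<in> space M. cmod (?S n \<omega> - V t \<omega>) > r / 2}"
    have [measurable]: "A \<in> sets M" unfolding A_def by measurable
    have "is_partition t (Suc n) ?p"
      using \<tau>[of n] by (auto simp: is_partition_def) (simp add: \<tau>_def)
    moreover have "\<forall>k<Suc n. ?p (Suc k) - ?p k < d" using elim by (auto simp: algebra_simps)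
    ultimately have m: "measure M A < r / 2"
      using d(2)[of "Suc n" ?p] by (simp only: \<Delta>_def A_def)
    have "trunc M (\<lambda>\<omega>. V t \<omega> - ?S n \<omega>) \<le> (\<integral>\<^sup>+\<omega>. ennreal (r / 2) + indicator A \<omega> \<partial>M)"
      unfolding trunc_def
    proof (rule nn_integral_mono)
      fix \<omega> assume \<omega>: "\<omega> \<in> space M"
      show "min 1 (ennreal (cmod (V t \<omega> - ?S n \<omega>))) \<le> ennreal (r / 2) + indicator A \<omega>"
      proof (cases "\<omega> \<in> A")
        case True
        then show ?thesis by (simp add: add_increasing min.coboundedI1)
      next
        case False
        then have "ennreal (cmod (V t \<omega> - ?S n \<omega>)) \<le> ennreal (r / 2)"
          using \<omega> by (intro ennreal_leI) (auto simp: norm_minus_commute A_def)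
        then show ?thesis using False by (simp add: min.coboundedI2)
      qed
    qed
    also have "\<dots> = ennreal (r / 2) + ennreal (measure M A)"
      by (subst nn_integral_add) (simp_all add: emeasure_space_1 emeasure_eq_measure[of A])
    also have "\<dots> \<le> ennreal (r / 2) + ennreal (r / 2)"
      using m by (intro add_mono ennreal_leI) auto
    also have "\<dots> = ennreal r" using r by (simp add: ennreal_plus[symmetric] del: ennreal_plus)
    finally show ?case using r by simp
  qed
qed simp

text \<open>Apart from \<open>\<i> * \<sigma> * J\<close>, the solution consists of a time integral
  and a multiple of \<open>V\<close>, both of bounded variation on \<open>[0, t]\<close>. The sum is
  at most this variation times the largest increment of \<open>W\<close>, which vanishes by uniform
  continuity.\<close>

lemma finite_variation_part_tendsto:
  assumes t: "0 < t"
  defines "\<tau> \<equiv> \<lambda>n. t / real (Suc n)"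
  shows "AE \<omega> in M. (\<lambda>n. \<Sum>k<Suc n. (\<Delta> h (\<tau> n) k \<omega> - \<i> * of_real \<sigma> * \<Delta> J (\<tau> n) k \<omega>) * of_real (\<Delta> W (\<tau> n) k \<omega>)) \<longlonglongrightarrow> 0"
proof -
  have \<tau>: "0 < \<tau> n" for n using t by (simp add: \<tau>_def)
  \<comment> \<open>The equation holds almost surely at each fixed time. The points of all grids are
    countably many, so one null set serves them all.\<close>
  have eq: "AE \<omega> in M. \<forall>n k. h (real k * \<tau> n) \<omega> = x + integral {0..real k * \<tau> n} (\<lambda>s. of_real K * (1 - (H s \<omega>)\<^sup>2))
      + \<i> * of_real \<sigma> * (J (real k * \<tau> n) \<omega> + V (real k * \<tau> n) \<omega> / 2)"
    using \<tau> by (simp only: AE_all_countable) (intro allI h_eq; simp add: less_imp_le)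
  have var: "AE \<omega> in M. \<forall>t\<ge>0. \<exists>B. \<forall>n p. is_partition t n p \<longrightarrow>
        (\<Sum>k<n. cmod (V (p (Suc k)) \<omega> - V (p k) \<omega>)) \<le> B"
    using V_covariation unfolding is_covariation_def by blast
  let ?A = "\<lambda>n k \<omega>. \<Delta> h (\<tau> n) k \<omega> - \<i> * of_real \<sigma> * \<Delta> J (\<tau> n) k \<omega>"
  show ?thesis
    using eq var continuous_paths AE_space
  proof eventually_elim
    case (elim \<omega>)
    let ?g = "\<lambda>s. of_real K * (1 - (H s \<omega>)\<^sup>2)"
    obtain B where B: "\<And>n p. is_partition t n p \<Longrightarrow> (\<Sum>k<n. cmod (V (p (Suc k)) \<omega> - V (p k) \<omega>)) \<le> B"
      using elim(2) t by (meson less_imp_le)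
    have cg: "continuous_on S ?g" for S
      by (intro continuous_intros continuous_on_subset[OF H_continuous[OF elim(4)]]) auto
    have ig: "?g integrable_on {a..b}" for a b by (rule integrable_continuous_real[OF cg])
    have part: "is_partition t (Suc n) (\<lambda>k. real k * \<tau> n)" for n
      using \<tau>[of n] by (auto simp: is_partition_def) (simp add: \<tau>_def)
    have inc: "cmod (?A n k \<omega>) \<le> 2 * K * \<tau> n + \<sigma> / 2 * cmod (\<Delta> V (\<tau> n) k \<omega>)" for n k
    proof -
      let ?s = "real k * \<tau> n" and ?t = "real (Suc k) * \<tau> n"
      have st: "0 \<le> ?s" "?s \<le> ?t" "?t - ?s = \<tau> n" using \<tau>[of n] by (auto simp: algebra_simps)
      have "integral {0..?t} ?g = integral {0..?s} ?g + integral {?s..?t} ?g"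
        using Henstock_Kurzweil_Integration.integral_combine[OF st(1,2) ig] by simp
      moreover have "h ?t \<omega> = x + integral {0..?t} ?g + \<i> * of_real \<sigma> * (J ?t \<omega> + V ?t \<omega> / 2)"
        "h ?s \<omega> = x + integral {0..?s} ?g + \<i> * of_real \<sigma> * (J ?s \<omega> + V ?s \<omega> / 2)"
        using elim(1) by blast+
      ultimately have "?A n k \<omega> =
        integral {?s..?t} ?g + \<i> * of_real (\<sigma> / 2) * \<Delta> V (\<tau> n) k \<omega>"
        unfolding \<Delta>_def by (simp add: algebra_simps diff_divide_distrib)
      also have "cmod \<dots> \<le> cmod (integral {?s..?t} ?g) + \<sigma> / 2 * cmod (\<Delta> V (\<tau> n) k \<omega>)"
        using \<sigma> by (intro order_trans[OF norm_triangle_ineq]) (simp add: norm_mult)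
      also have "cmod (integral {?s..?t} ?g) \<le> 2 * K * (?t - ?s)"
      proof (rule integral_bound[OF st(2) cg])
        fix s
        have "cmod (1 - (H s \<omega>)\<^sup>2) \<le> 2"
          using norm_triangle_ineq4[of 1 "(H s \<omega>)\<^sup>2"] cmod_H[OF elim(4)] by (simp add: norm_power)
        then have "K * cmod (1 - (H s \<omega>)\<^sup>2) \<le> K * 2" using K by (intro mult_left_mono) auto
        then show "cmod (?g s) \<le> 2 * K" using K by (simp add: norm_mult)
      qed
      finally show ?thesis using st by simp
    qed
    define C where "C = 2 * K * t + \<sigma> / 2 * B"
    have tot: "(\<Sum>k<Suc n. cmod (?A n k \<omega>)) \<le> C" for n
    proof -
      have "(\<Sum>k<Suc n. cmod (?A n k \<omega>)) \<le>
        (\<Sum>k<Suc n. 2 * K * \<tau> n + \<sigma> / 2 * cmod (\<Delta> V (\<tau> n) k \<omega>))" by (intro sum_mono inc)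
      also have "\<dots> = 2 * K * t + \<sigma> / 2 * (\<Sum>k<Suc n. cmod (\<Delta> V (\<tau> n) k \<omega>))"
        by (simp only: sum.distrib sum_distrib_left[symmetric]) (simp add: \<tau>_def)
      also have "\<dots> \<le> C" unfolding C_def \<Delta>_def
        using B[OF part, of n] \<sigma> by (intro add_left_mono mult_left_mono) auto
      finally show ?thesis .
    qed
    have "0 \<le> C" using tot[of 0] by (rule order_trans[rotated]) (intro sum_nonneg norm_ge_zero)
    have uc: "uniformly_continuous_on {0..t} (\<lambda>s. W s \<omega>)"
      by (intro compact_uniformly_continuous continuous_on_subset[OF elim(3)]) auto
    show ?case
    proof (rule LIMSEQ_I)
      fix r :: real assume r: "0 < r"
      define e where "e = r / (C + 1)"
      have e: "0 < e" "C * e < r" using r \<open>0 \<le> C\<close> by (auto simp: e_def field_simps)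
      obtain d where d: "0 < d" "\<And>u v. u \<in> {0..t} \<Longrightarrow> v \<in> {0..t} \<Longrightarrow> dist v u < d \<Longrightarrow> dist (W v \<omega>) (W u \<omega>) < e"
        using uc e(1) unfolding uniformly_continuous_on_def by blast
      have "\<tau> \<longlonglongrightarrow> 0"
        unfolding \<tau>_def using LIMSEQ_Suc[OF lim_const_over_n[of t]] by simp
      then have "\<forall>\<^sub>F n in sequentially. \<tau> n < d" using d(1) by (rule order_tendstoD)
      then obtain N where N: "\<And>n. N \<le> n \<Longrightarrow> \<tau> n < d" by (auto simp: eventually_sequentially)
      show "\<exists>no. \<forall>n\<ge>no. norm ((\<Sum>k<Suc n. ?A n k \<omega> * of_real (\<Delta> W (\<tau> n) k \<omega>)) - 0) < r"
      proof (intro exI[of _ N] allI impI)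
        fix n assume n: "N \<le> n"
        have dW: "\<bar>\<Delta> W (\<tau> n) k \<omega>\<bar> \<le> e" if "k < Suc n" for k
        proof -
          have tN: "real (Suc n) * \<tau> n = t" by (simp add: \<tau>_def)
          have "real (Suc k) * \<tau> n \<le> real (Suc n) * \<tau> n" "real k * \<tau> n \<le> real (Suc n) * \<tau> n"
            using that \<tau>[of n] by (intro mult_right_mono; simp)+
          then have "real (Suc k) * \<tau> n \<in> {0..t}" "real k * \<tau> n \<in> {0..t}"
            using \<tau>[of n] unfolding tN by auto
          moreover have "dist (real (Suc k) * \<tau> n) (real k * \<tau> n) < d"
            using N[OF n] \<tau>[of n] by (simp add: dist_real_def algebra_simps)
          ultimately show ?thesis using d(2) by (fastforce simp: \<Delta>_def dist_real_def)
        qed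
        have "cmod (\<Sum>k<Suc n. ?A n k \<omega> * of_real (\<Delta> W (\<tau> n) k \<omega>)) \<le>
          (\<Sum>k<Suc n. cmod (?A n k \<omega>) * e)"
          using dW by (intro sum_norm_le) (auto simp: norm_mult intro!: mult_left_mono)
        also have "\<dots> \<le> C * e"
          unfolding sum_distrib_right[symmetric] using tot[of n] e by (intro mult_right_mono) auto
        also have "\<dots> < r" by (rule e)
        finally show "norm ((\<Sum>k<Suc n. ?A n k \<omega> * of_real (\<Delta> W (\<tau> n) k \<omega>)) - 0) < r"
          by simp
      qed
    qed
  qed
qed

end

lemma (in brownian_motion) nn_integral_increment_power:
  assumes "0 \<le> s" "s < t" "even k"
  shows "(\<integral>\<^sup>+\<omega>. ennreal ((W t \<omega> - W s \<omega>) ^ k) \<partial>M) = ennreal (\<integral>w. w ^ k \<partial>gauss (t - s))"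
proof -
  have g: "(\<lambda>w::real. w ^ k) \<in> borel_measurable borel" by measurable
  show ?thesis
    using integral_increment[OF assms(1,2) g] gauss_moments(1)[of "t - s" k] assms
    by (subst nn_integral_eq_integral) (auto simp: zero_le_even_power)
qed

context circle_sde
begin

lemma sq_compensated_squares:
  assumes \<tau>: "0 < \<tau>" and c: "\<And>k. c k \<in> borel_measurable (F (real k * \<tau>))" "\<And>k \<omega>. \<omega> \<in> space M \<Longrightarrow> cmod (c k \<omega>) \<le> B"
  shows "sq M (\<lambda>\<omega>. \<Sum>k<n. c k \<omega> * of_real ((\<Delta> W \<tau> k \<omega>)\<^sup>2 - \<tau>)) \<le> ennreal (2 * \<tau>\<^sup>2 * (real n * B\<^sup>2))"
proof -
  have g: "(\<lambda>w::real. w\<^sup>2 - \<tau>) \<in> borel_measurable borel" by measurable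
  have "sq M (\<lambda>\<omega>. \<Sum>k<n. c k \<omega> * of_real ((\<Delta> W \<tau> k \<omega>)\<^sup>2 - \<tau>)) =
     ennreal (2 * \<tau>\<^sup>2 * (\<Sum>k<n. \<integral>\<omega>. (cmod (c k \<omega>))\<^sup>2 \<partial>M))"
    using martingale_sum(2,3)[where n=n and B=B, OF \<tau> g square_compensator[OF \<tau>] c]
    by (subst sq_eq_integral) (simp_all add: \<Delta>_def)
  also have "\<dots> \<le> ennreal (2 * \<tau>\<^sup>2 * (real n * B\<^sup>2))"
  proof (intro ennreal_leI mult_left_mono)
    have "(\<integral>\<omega>. (cmod (c k \<omega>))\<^sup>2 \<partial>M) \<le> B\<^sup>2" for k
    proof (rule integral_le_const)
      show b: "AE \<omega> in M. (cmod (c k \<omega>))\<^sup>2 \<le> B\<^sup>2" using c(2) by (auto intro!: power_mono)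
      show "integrable M (\<lambda>\<omega>. (cmod (c k \<omega>))\<^sup>2)"
        using measurable_F[OF c(1)] b by (intro integrable_const_bound[where B="B\<^sup>2"]) auto
    qed
    then show "(\<Sum>k<n. \<integral>\<omega>. (cmod (c k \<omega>))\<^sup>2 \<partial>M) \<le> real n * B\<^sup>2"
      using sum_bounded_above[of "{..<n}" "\<lambda>k. \<integral>\<omega>. (cmod (c k \<omega>))\<^sup>2 \<partial>M" "B\<^sup>2"] by simp
  qed simp
  finally show ?thesis .
qed

lemma nn_integral_riemann_error:
  assumes \<tau>: "0 < \<tau>" and L: "0 \<le> L" and A: "continuous_on UNIV A"
    and lip: "\<And>u v. u \<in> circle \<Longrightarrow> v \<in> circle \<Longrightarrow> cmod (A u - A v) \<le> L * cmod (u - v)"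
  shows "(\<integral>\<^sup>+\<omega>. ennreal (cmod (integral {0..real k * \<tau>} (\<lambda>s. A (H s \<omega>)) - (\<Sum>j<k. A (h (real j * \<tau>) \<omega>) * of_real \<tau>))) \<partial>M)
    \<le> ennreal L * gap \<tau> {0<..real k * \<tau>}"
proof -
  have "(\<integral>\<^sup>+\<omega>. ennreal (cmod (integral {0..real k * \<tau>} (\<lambda>s. A (H s \<omega>)) - (\<Sum>j<k. A (h (real j * \<tau>) \<omega>) * of_real \<tau>))) \<partial>M)
     \<le> (\<integral>\<^sup>+\<omega>. \<integral>\<^sup>+s. ennreal L * (indicator {0<..real k * \<tau>} s * ennreal (cmod (osc \<tau> (\<omega>, s)))) \<partial>lborel \<partial>M)"
  proof (rule nn_integral_mono_AE, use H_eq AE_space in eventually_elim)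
    case (elim \<omega>)
    have h: "h (real j * \<tau>) \<omega> = H (real j * \<tau>) \<omega>" for j using elim(1) \<tau> by simp
    have "continuous_on UNIV (\<lambda>s. A (H s \<omega>))"
      by (rule continuous_on_compose2[OF A H_continuous[OF elim(2)]]) simp
    from riemann_error[OF this \<tau>, of k]
    have "ennreal (cmod (integral {0..real k * \<tau>} (\<lambda>s. A (H s \<omega>)) - (\<Sum>j<k. A (h (real j * \<tau>) \<omega>) * of_real \<tau>)))
      \<le> (\<integral>\<^sup>+s. indicator {0<..real k * \<tau>} s * ennreal (cmod (A (H s \<omega>) - A (H (grid_before \<tau> s) \<omega>))) \<partial>lborel)"
      by (simp only: h)
    also have "\<dots> \<le> (\<integral>\<^sup>+s. ennreal L * (indicator {0<..real k * \<tau>} s * ennreal (cmod (osc \<tau> (\<omega>, s)))) \<partial>lborel)"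
    proof (rule nn_integral_mono)
      fix s
      have "ennreal (cmod (A (H s \<omega>) - A (H (grid_before \<tau> s) \<omega>))) \<le> ennreal (L * cmod (H s \<omega> - H (grid_before \<tau> s) \<omega>))"
        using elim(2) by (intro ennreal_leI lip H_circle)
      also have "\<dots> = ennreal L * ennreal (cmod (osc \<tau> (\<omega>, s)))"
        using L by (simp add: osc_def ennreal_mult')
      finally show "indicator {0<..real k * \<tau>} s * ennreal (cmod (A (H s \<omega>) - A (H (grid_before \<tau> s) \<omega>)))
        \<le> ennreal L * (indicator {0<..real k * \<tau>} s * ennreal (cmod (osc \<tau> (\<omega>, s))))"
        by (simp add: indicator_def)
    qed
    finally show ?case .
  qed
  also have "\<dots> = (\<integral>\<^sup>+z. ennreal L * (indicator {0<..real k * \<tau>} (snd z) * ennreal (cmod (osc \<tau> z))) \<partial>Q)"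
    by (subst lborel.nn_integral_fst[symmetric]) auto
  also have "\<dots> = ennreal L * gap \<tau> {0<..real k * \<tau>}"
    unfolding gap_def by (rule nn_integral_cmult) measurable
  finally show ?thesis .
qed

lemma measurable_time_integral:
  assumes A: "continuous_on UNIV A"
  shows "(\<lambda>\<omega>. integral {0..t} (\<lambda>s. A (H s \<omega>)) :: complex) \<in> borel_measurable M"
proof -
  have [measurable]: "A \<in> borel_measurable borel" using A by (rule borel_measurable_continuous_onI)
  have [measurable]: "(\<lambda>(\<omega>, s). H s \<omega>) \<in> borel_measurable Q"
    using measurable_HQ by (simp add: case_prod_beta')
  have "(\<lambda>\<omega>. \<integral>s. indicator {0..t} s *\<^sub>R A (H s \<omega>) \<partial>lborel) \<in> borel_measurable M" by measurable
  then show ?thesis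
  proof (rule measurable_cong[THEN iffD1, rotated])
    fix \<omega> assume "\<omega> \<in> space M"
    then have "continuous_on {0..t} (\<lambda>s. A (H s \<omega>))"
      by (intro continuous_on_subset[OF continuous_on_compose2[OF A H_continuous]]) auto
    then show "(\<integral>s. indicator {0..t} s *\<^sub>R A (H s \<omega>) \<partial>lborel) = integral {0..t} (\<lambda>s. A (H s \<omega>))"
      by (rule integral_eq_lborel(1)[symmetric])
  qed
qed

text \<open>The covariation of \<open>h\<close> and \<open>W\<close> only sees the martingale part \<open>\<i> \<sigma> J\<close> of \<open>h\<close>, whose increments
  are close to \<open>\<i> \<sigma> h \<Delta>W\<close>.\<close>

lemma covariation_eq:
  assumes t: "0 < t"
  shows "AE \<omega> in M. V t \<omega> = \<i> * of_real \<sigma> * integral {0..t} (\<lambda>s. H s \<omega>)"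
proof -
  define \<tau> where "\<tau> n = t / real (Suc n)" for n
  have \<tau>: "0 < \<tau> n" and N\<tau>: "real (Suc n) * \<tau> n = t" for n using t by (simp_all add: \<tau>_def)
  have \<tau>0: "\<tau> \<longlonglongrightarrow> 0"
    unfolding \<tau>_def using LIMSEQ_Suc[OF lim_const_over_n[of t]] by simp
  define L where "L \<omega> = \<i> * of_real \<sigma> * integral {0..t} (\<lambda>s. H s \<omega>)" for \<omega>
  have [measurable]: "L \<in> borel_measurable M"
    unfolding L_def using measurable_time_integral[of "\<lambda>z. z" t] by (intro borel_measurable_times) auto
  have [measurable]: "V t \<in> borel_measurable M" using t by (intro measurable_V) simp
  have [measurable]: "\<Delta> W (\<tau> n) k \<in> borel_measurable M" "\<Delta> h (\<tau> n) k \<in> borel_measurable M"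
    "\<Delta> J (\<tau> n) k \<in> borel_measurable M" "h (real k * \<tau> n) \<in> borel_measurable M" for n k
    using measurable_\<Delta>[OF \<tau>] \<tau>[of n] by (auto intro: measurable_h)
  \<comment> \<open>One error for each replacement: \<open>V\<close> by the covariation sum, the
    increment of \<open>h\<close> by that of its martingale part, the increment of \<open>J\<close>
    by \<open>h\<close> times that of \<open>W\<close>, the squared increment by \<tau>, and the
    Riemann sum by the integral.\<close>
  define Z0 where "Z0 n \<omega> = V t \<omega> - (\<Sum>k<Suc n. \<Delta> h (\<tau> n) k \<omega> * of_real (\<Delta> W (\<tau> n) k \<omega>))" for n \<omega>
  define Z1 where "Z1 n \<omega> = (\<Sum>k<Suc n. (\<Delta> h (\<tau> n) k \<omega> - \<i> * of_real \<sigma> * \<Delta> J (\<tau> n) k \<omega>) * of_real (\<Delta> W (\<tau> n) k \<omega>))" for n \<omega>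
  define D where "D n k \<omega> = \<Delta> J (\<tau> n) k \<omega> - h (real k * \<tau> n) \<omega> * of_real (\<Delta> W (\<tau> n) k \<omega>)" for n k \<omega>
  define Z2 where "Z2 n \<omega> = (\<Sum>k<Suc n. \<i> * of_real \<sigma> * D n k \<omega> * of_real (\<Delta> W (\<tau> n) k \<omega>))" for n \<omega>
  define Z3 where "Z3 n \<omega> = (\<Sum>k<Suc n. \<i> * of_real \<sigma> * h (real k * \<tau> n) \<omega> * of_real ((\<Delta> W (\<tau> n) k \<omega>)\<^sup>2 - \<tau> n))" for n \<omega>
  define Z4 where "Z4 n \<omega> = (\<Sum>k<Suc n. \<i> * of_real \<sigma> * h (real k * \<tau> n) \<omega> * of_real (\<tau> n)) - L \<omega>" for n \<omega>
  have [measurable]: "D n k \<in> borel_measurable M" for n k unfolding D_def by measurable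
  have [measurable]: "Z0 n \<in> borel_measurable M" "Z1 n \<in> borel_measurable M" "Z2 n \<in> borel_measurable M"
    "Z3 n \<in> borel_measurable M" "Z4 n \<in> borel_measurable M" for n
    unfolding Z0_def Z1_def Z2_def Z3_def Z4_def by measurable
  have decomp: "V t \<omega> - L \<omega> = Z0 n \<omega> + (Z1 n \<omega> + (Z2 n \<omega> + (Z3 n \<omega> + Z4 n \<omega>)))" for n \<omega>
  proof -
    have "Z1 n \<omega> + (Z2 n \<omega> + (Z3 n \<omega> + (\<Sum>k<Suc n. \<i> * of_real \<sigma> * h (real k * \<tau> n) \<omega> * of_real (\<tau> n)))) =
      (\<Sum>k<Suc n. \<Delta> h (\<tau> n) k \<omega> * of_real (\<Delta> W (\<tau> n) k \<omega>))"
      unfolding Z1_def Z2_def Z3_def D_def sum.distrib[symmetric]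
      by (intro sum.cong refl) (simp add: algebra_simps power2_eq_square)
    then show ?thesis by (simp add: Z0_def Z4_def algebra_simps)
  qed
  have T0: "(\<lambda>n. trunc M (Z0 n)) \<longlonglongrightarrow> 0"
    unfolding Z0_def[abs_def] \<tau>_def by (rule trunc_covariation_tendsto[OF t])
  have T1: "(\<lambda>n. trunc M (Z1 n)) \<longlonglongrightarrow> 0"
    using finite_variation_part_tendsto[OF t] by (intro trunc_tendsto_AE) (simp_all add: Z1_def \<tau>_def)
  have gap0: "(\<lambda>n. ennreal c * gap (\<tau> n) {0<..t}) \<longlonglongrightarrow> 0" for c
    using ennreal_tendsto_cmult[OF _ gap_tendsto[OF \<tau> \<tau>0, of t], of "ennreal c"] by simp
  have T2: "(\<lambda>n. trunc M (Z2 n)) \<longlonglongrightarrow> 0"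
  proof (rule young_tendsto_0[OF gap0[of "8 * \<sigma>"], of "\<sigma> * t" _ 1])
    fix n and \<delta> :: real assume \<delta>: "0 < \<delta>"
    \<comment> \<open>The product of the two increments is split with weight \<delta>. The squares
      of \<open>D\<close> sum up to the gap, which vanishes; the squared increments of
      \<open>W\<close> sum up to \<open>t\<close> in mean, which \<delta> makes small.\<close>
    have young: "ennreal (cmod (Z2 n \<omega>)) \<le> (\<Sum>k<Suc n. ennreal (\<sigma> / \<delta>) * ennreal ((cmod (D n k \<omega>))\<^sup>2) + ennreal (\<sigma> * \<delta>) * ennreal ((\<Delta> W (\<tau> n) k \<omega>)\<^sup>2))" for \<omega>
    proof -
      have "cmod (Z2 n \<omega>) \<le> (\<Sum>k<Suc n. \<sigma> / \<delta> * (cmod (D n k \<omega>))\<^sup>2 + \<sigma> * \<delta> * (\<Delta> W (\<tau> n) k \<omega>)\<^sup>2)"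
        unfolding Z2_def
      proof (rule sum_norm_le)
        fix k
        let ?u = "cmod (D n k \<omega>)" and ?w = "\<bar>\<Delta> W (\<tau> n) k \<omega>\<bar>"
        have "0 \<le> (?u - \<delta> * ?w)\<^sup>2" by simp
        then have "2 * (?u * ?w * \<delta>) \<le> ?u\<^sup>2 + \<delta>\<^sup>2 * ?w\<^sup>2" by (simp add: power2_diff power_mult_distrib algebra_simps)
        moreover have "0 \<le> ?u * ?w * \<delta>" using \<delta> by simp
        ultimately have "?u * ?w * \<delta> \<le> ?u\<^sup>2 + \<delta>\<^sup>2 * ?w\<^sup>2" by linarith
        then have "?u * ?w * \<delta> / \<delta> \<le> (?u\<^sup>2 + \<delta>\<^sup>2 * ?w\<^sup>2) / \<delta>" using \<delta> by (intro divide_right_mono) auto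
        then have "?u * ?w \<le> ?u\<^sup>2 / \<delta> + \<delta> * ?w\<^sup>2" using \<delta> by (simp add: add_divide_distrib power2_eq_square)
        then have "\<sigma> * (?u * ?w) \<le> \<sigma> * (?u\<^sup>2 / \<delta> + \<delta> * ?w\<^sup>2)" using \<sigma> by (intro mult_left_mono) auto
        then show "cmod (\<i> * of_real \<sigma> * D n k \<omega> * of_real (\<Delta> W (\<tau> n) k \<omega>)) \<le>
          \<sigma> / \<delta> * (cmod (D n k \<omega>))\<^sup>2 + \<sigma> * \<delta> * (\<Delta> W (\<tau> n) k \<omega>)\<^sup>2"
          using \<sigma> by (simp add: norm_mult algebra_simps)
      qed
      then have "ennreal (cmod (Z2 n \<omega>)) \<le> ennreal (\<Sum>k<Suc n. \<sigma> / \<delta> * (cmod (D n k \<omega>))\<^sup>2 + \<sigma> * \<delta> * (\<Delta> W (\<tau> n) k \<omega>)\<^sup>2)"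
        by (rule ennreal_leI)
      also have "\<dots> = (\<Sum>k<Suc n. ennreal (\<sigma> / \<delta> * (cmod (D n k \<omega>))\<^sup>2 + \<sigma> * \<delta> * (\<Delta> W (\<tau> n) k \<omega>)\<^sup>2))"
        using \<sigma> \<delta> by (intro sum_ennreal[symmetric]) auto
      also have "\<dots> = (\<Sum>k<Suc n. ennreal (\<sigma> / \<delta>) * ennreal ((cmod (D n k \<omega>))\<^sup>2) + ennreal (\<sigma> * \<delta>) * ennreal ((\<Delta> W (\<tau> n) k \<omega>)\<^sup>2))"
      proof (intro sum.cong refl)
        have "0 \<le> \<sigma> / \<delta>" "0 \<le> \<sigma> * \<delta>" using \<sigma> \<delta> by auto
        then show "ennreal (\<sigma> / \<delta> * (cmod (D n k \<omega>))\<^sup>2 + \<sigma> * \<delta> * (\<Delta> W (\<tau> n) k \<omega>)\<^sup>2) =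
          ennreal (\<sigma> / \<delta>) * ennreal ((cmod (D n k \<omega>))\<^sup>2) + ennreal (\<sigma> * \<delta>) * ennreal ((\<Delta> W (\<tau> n) k \<omega>)\<^sup>2)" for k
          by (simp only: ennreal_plus ennreal_mult mult_nonneg_nonneg zero_le_power2)
      qed
      finally show ?thesis .
    qed
    have "trunc M (Z2 n) \<le> (\<integral>\<^sup>+\<omega>. (\<Sum>k<Suc n. ennreal (\<sigma> / \<delta>) * ennreal ((cmod (D n k \<omega>))\<^sup>2) + ennreal (\<sigma> * \<delta>) * ennreal ((\<Delta> W (\<tau> n) k \<omega>)\<^sup>2)) \<partial>M)"
      by (rule order_trans[OF trunc_le_nn_integral]) (intro nn_integral_mono young)
    also have "\<dots> = (\<Sum>k<Suc n. ennreal (\<sigma> / \<delta>) * sq M (D n k) + ennreal (\<sigma> * \<delta>) * (\<integral>\<^sup>+\<omega>. ennreal ((\<Delta> W (\<tau> n) k \<omega>)\<^sup>2) \<partial>M))"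
      unfolding sq_def by (subst nn_integral_sum) (simp_all add: nn_integral_add nn_integral_cmult)
    also have "\<dots> \<le> (\<Sum>k<Suc n. ennreal (\<sigma> / \<delta>) * (8 * gap (\<tau> n) {real k * \<tau> n<..real (Suc k) * \<tau> n}) + ennreal (\<sigma> * \<delta>) * ennreal (\<tau> n))"
    proof (intro sum_mono add_mono mult_left_mono)
      fix k
      show "sq M (D n k) \<le> 8 * gap (\<tau> n) {real k * \<tau> n<..real (Suc k) * \<tau> n}"
        using sq_ito_increment[OF \<tau>, of k n] by (simp only: D_def[abs_def] \<Delta>_def)
      have "real (Suc k) * \<tau> n - real k * \<tau> n = \<tau> n" by (simp add: algebra_simps)
      then show "(\<integral>\<^sup>+\<omega>. ennreal ((\<Delta> W (\<tau> n) k \<omega>)\<^sup>2) \<partial>M) \<le> ennreal (\<tau> n)"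
        using nn_integral_increment_power[of "real k * \<tau> n" "real (Suc k) * \<tau> n" 2] \<tau>[of n]
          gauss_moments(3)[OF \<tau>[of n]]
        by (simp add: \<Delta>_def)
    qed auto
    also have "\<dots> = ennreal (\<sigma> / \<delta>) * (8 * gap (\<tau> n) {0<..t}) + ennreal (\<sigma> * \<delta>) * ennreal t"
    proof -
      have "(\<Sum>k<Suc n. ennreal (\<tau> n)) = ennreal t"
        using \<tau>[of n] N\<tau>[of n] by (simp only: sum_constant card_lessThan ennreal_of_nat_eq_real_of_nat ennreal_mult'[symmetric] of_nat_0_le_iff)
      then show ?thesis
        by (simp only: sum.distrib sum_distrib_left[symmetric] sum_gap[OF \<tau>] N\<tau>)
    qed
    also have "\<dots> = ennreal (\<sigma> * t * \<delta>) + ennreal (1 / \<delta>) * (ennreal (8 * \<sigma>) * gap (\<tau> n) {0<..t})"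
    proof -
      have "ennreal (\<sigma> / \<delta>) * 8 = ennreal (1 / \<delta>) * ennreal (8 * \<sigma>)"
        using \<sigma> \<delta> by (simp add: ennreal_mult'[symmetric] ennreal_numeral[symmetric] mult_ac del: ennreal_numeral)
      moreover have "ennreal (\<sigma> * \<delta>) * ennreal t = ennreal (\<sigma> * t * \<delta>)"
        using \<sigma> \<delta> t by (simp add: ennreal_mult'[symmetric] mult_ac)
      ultimately show ?thesis by (simp add: mult.assoc[symmetric] add.commute)
    qed
    finally show "trunc M (Z2 n) \<le> ennreal (\<sigma> * t * \<delta>) + ennreal (1 / \<delta>) * (ennreal (8 * \<sigma>) * gap (\<tau> n) {0<..t})" .
  qed (use \<sigma> t in simp)
  have T3: "(\<lambda>n. trunc M (Z3 n)) \<longlonglongrightarrow> 0"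
  proof (rule young_tendsto_0)
    fix n and \<delta> :: real assume \<delta>: "0 < \<delta>"
    have "sq M (Z3 n) \<le> ennreal (2 * (\<tau> n)\<^sup>2 * (real (Suc n) * \<sigma>\<^sup>2))"
      unfolding Z3_def[abs_def] using \<tau>[of n] \<sigma> h_adapted cmod_h
      by (intro sq_compensated_squares) (auto simp: norm_mult intro!: borel_measurable_times)
    also have "2 * (\<tau> n)\<^sup>2 * (real (Suc n) * \<sigma>\<^sup>2) = 2 * \<sigma>\<^sup>2 * t * \<tau> n"
    proof -
      have "2 * (\<tau> n)\<^sup>2 * (real (Suc n) * \<sigma>\<^sup>2) = 2 * \<sigma>\<^sup>2 * (real (Suc n) * \<tau> n) * \<tau> n"
        by (simp only: power2_eq_square mult_ac)
      then show ?thesis by (simp only: N\<tau>)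
    qed
    finally have "ennreal (1 / \<delta>) * sq M (Z3 n) \<le> ennreal (1 / \<delta>) * ennreal (2 * \<sigma>\<^sup>2 * t * \<tau> n)"
      by (rule mult_left_mono) simp
    then show "trunc M (Z3 n) \<le> ennreal (1 * \<delta>) + ennreal (1 / \<delta>) * ennreal (2 * \<sigma>\<^sup>2 * t * \<tau> n)"
      using trunc_le_sq[of "Z3 n" \<delta>] \<delta> by (meson add_left_mono order_trans \<open>Z3 n \<in> borel_measurable M\<close>)
  next
    have "(\<lambda>n. 2 * \<sigma>\<^sup>2 * t * \<tau> n) \<longlonglongrightarrow> 2 * \<sigma>\<^sup>2 * t * 0" by (intro tendsto_intros \<tau>0)
    then show "(\<lambda>n. ennreal (2 * \<sigma>\<^sup>2 * t * \<tau> n)) \<longlonglongrightarrow> 0" using tendsto_ennrealI by fastforce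
  qed simp
  have T4: "(\<lambda>n. trunc M (Z4 n)) \<longlonglongrightarrow> 0"
  proof (rule tendsto_sandwich[OF _ _ tendsto_const gap0[of \<sigma>]])
    show "\<forall>\<^sub>F n in sequentially. trunc M (Z4 n) \<le> ennreal \<sigma> * gap (\<tau> n) {0<..t}"
    proof (intro always_eventually allI)
      fix n
      have "trunc M (Z4 n) \<le> (\<integral>\<^sup>+\<omega>. ennreal (cmod (Z4 n \<omega>)) \<partial>M)" by (rule trunc_le_nn_integral)
      also have "\<dots> = (\<integral>\<^sup>+\<omega>. ennreal (cmod (integral {0..real (Suc n) * \<tau> n} (\<lambda>s. \<i> * of_real \<sigma> * H s \<omega>) -
         (\<Sum>j<Suc n. \<i> * of_real \<sigma> * h (real j * \<tau> n) \<omega> * of_real (\<tau> n)))) \<partial>M)"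
        unfolding Z4_def L_def N\<tau> by (simp only: norm_minus_commute integral_mult_right)
      also have "\<dots> \<le> ennreal \<sigma> * gap (\<tau> n) {0<..real (Suc n) * \<tau> n}"
      proof (rule nn_integral_riemann_error[OF \<tau>])
        show "cmod (\<i> * of_real \<sigma> * u - \<i> * of_real \<sigma> * v) \<le> \<sigma> * cmod (u - v)" for u v
          using \<sigma> by (simp add: right_diff_distrib[symmetric] norm_mult)
      qed (use \<sigma> in \<open>auto intro!: continuous_intros\<close>)
      finally show "trunc M (Z4 n) \<le> ennreal \<sigma> * gap (\<tau> n) {0<..t}" by (simp only: N\<tau>)
    qed
  qed simp
  \<comment> \<open>The left side does not depend on \<open>n\<close>, so it is 0 in the
    limit.\<close>
  have "trunc M (\<lambda>\<omega>. V t \<omega> - L \<omega>) \<le> trunc M (Z0 n) + (trunc M (Z1 n) + (trunc M (Z2 n) + (trunc M (Z3 n) + trunc M (Z4 n))))" for n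
    unfolding decomp[of _ n]
    by (intro order_trans[OF trunc_add] add_left_mono order_refl; measurable)
  moreover have "(\<lambda>n. trunc M (Z0 n) + (trunc M (Z1 n) + (trunc M (Z2 n) + (trunc M (Z3 n) + trunc M (Z4 n))))) \<longlonglongrightarrow> 0 + (0 + (0 + (0 + 0)))"
    by (intro tendsto_add T0 T1 T2 T3 T4)
  ultimately have "trunc M (\<lambda>\<omega>. V t \<omega> - L \<omega>) \<le> 0 + (0 + (0 + (0 + 0)))"
    by (intro LIMSEQ_le_const) auto
  then have "AE \<omega> in M. V t \<omega> - L \<omega> = 0" by (intro trunc_eq_0) auto
  then show ?thesis by eventually_elim (simp add: L_def)
qed

end

section \<open>Convergence of the Euler scheme\<close>

lemma continuous_on_abs_lipschitz:
  fixes f :: "complex \<Rightarrow> real"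
  assumes "\<And>u v. \<bar>f u - f v\<bar> \<le> L * cmod (u - v)" "0 \<le> L"
  shows "continuous_on UNIV f"
  by (rule lipschitz_on_continuous_on[of L]) (auto simp: lipschitz_on_def dist_real_def dist_norm assms)

text \<open>The induction is on the majorant \<open>\<alpha> + \<beta> * (\<Sum>j<k. d j)\<close>,
  which grows by a factor of at most \<open>1 + \<beta>\<close> per step; it is valid for infinite
  values too.\<close>

lemma gronwall_sum:
  fixes d :: "nat \<Rightarrow> ennreal"
  assumes "\<And>k. k \<le> n \<Longrightarrow> d k \<le> \<alpha> + \<beta> * (\<Sum>j<k. d j)"
  shows "d n \<le> \<alpha> * (1 + \<beta>) ^ n"
proof -
  have "\<alpha> + \<beta> * (\<Sum>j<k. d j) \<le> \<alpha> * (1 + \<beta>) ^ k" if "k \<le> n" for k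
    using that
  proof (induction k)
    case (Suc k)
    have "\<alpha> + \<beta> * (\<Sum>j<Suc k. d j) = (\<alpha> + \<beta> * (\<Sum>j<k. d j)) + \<beta> * d k"
      by (simp add: distrib_left add.assoc)
    also have "\<dots> \<le> (\<alpha> + \<beta> * (\<Sum>j<k. d j)) + \<beta> * (\<alpha> + \<beta> * (\<Sum>j<k. d j))"
      using assms[of k] Suc.prems by (intro add_left_mono mult_left_mono) auto
    also have "\<dots> = (1 + \<beta>) * (\<alpha> + \<beta> * (\<Sum>j<k. d j))" by (simp add: distrib_right)
    also have "\<dots> \<le> (1 + \<beta>) * (\<alpha> * (1 + \<beta>) ^ k)" using Suc by (intro mult_left_mono) auto
    finally show ?case by (simp add: mult_ac)
  qed simp
  then show ?thesis using assms[of n] by (meson order_refl order_trans)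
qed

context circle_sde
begin

text \<open>The drift of the Ito form. Half the covariation is \<open>\<i> * \<sigma> / 2\<close>
  times the time integral of \<open>h\<close>, and it is multiplied by
  \<open>\<i> * \<sigma>\<close> once more, whence the
  \<open>- \<sigma>\<^sup>2 / 2\<close>.\<close>

definition drift :: "complex \<Rightarrow> complex" where
  "drift z = of_real K * (1 - z\<^sup>2) - of_real (\<sigma>\<^sup>2 / 2) * z"

text \<open>Serves on the circle both as Lipschitz constant, where 2 bounds
  \<open>cmod (u + v)\<close>, and as bound of \<open>drift\<close> itself, where 2 bounds
  \<open>cmod (1 - u\<^sup>2)\<close>.\<close>

definition drift_lip :: real where
  "drift_lip = 2 * K + \<sigma>\<^sup>2 / 2"

lemma drift_lip_nonneg: "0 \<le> drift_lip"
  using K by (simp add: drift_lip_def)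

lemma continuous_drift: "continuous_on S drift"
  unfolding drift_def[abs_def] by (intro continuous_intros)

lemma measurable_drift [measurable]: "drift \<in> borel_measurable borel"
  by (intro borel_measurable_continuous_onI continuous_drift)

lemma drift_lipschitz:
  assumes "u \<in> circle" "v \<in> circle"
  shows "cmod (drift u - drift v) \<le> drift_lip * cmod (u - v)"
proof -
  have "drift u - drift v = - of_real K * ((u + v) * (u - v)) - of_real (\<sigma>\<^sup>2 / 2) * (u - v)"
    unfolding drift_def by (simp only: power2_eq_square[of u] power2_eq_square[of v]) algebra
  also have "cmod \<dots> \<le> K * (cmod (u + v) * cmod (u - v)) + \<sigma>\<^sup>2 / 2 * cmod (u - v)"
    using K by (intro order_trans[OF norm_triangle_ineq4]) (simp add: norm_mult del: of_real_divide of_real_power)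
  also have "\<dots> \<le> K * (2 * cmod (u - v)) + \<sigma>\<^sup>2 / 2 * cmod (u - v)"
    using K assms norm_triangle_ineq[of u v] by (intro add_right_mono mult_left_mono mult_right_mono) auto
  finally show ?thesis by (simp add: drift_lip_def algebra_simps)
qed

lemma cmod_drift:
  assumes "u \<in> circle"
  shows "cmod (drift u) \<le> drift_lip"
proof -
  have "cmod (drift u) \<le> K * cmod (1 - u\<^sup>2) + \<sigma>\<^sup>2 / 2 * cmod u"
    unfolding drift_def using K
    by (intro order_trans[OF norm_triangle_ineq4]) (simp add: norm_mult del: of_real_divide of_real_power)
  also have "cmod (1 - u\<^sup>2) \<le> 2"
    using norm_triangle_ineq4[of 1 "u\<^sup>2"] assms by (simp add: norm_power)
  finally show ?thesis using K assms by (simp add: drift_lip_def mult.commute)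
qed

lemma h_ito:
  assumes t: "0 < t"
  shows "AE \<omega> in M. h t \<omega> = x + integral {0..t} (\<lambda>s. drift (H s \<omega>)) + \<i> * of_real \<sigma> * J t \<omega>"
  using h_eq[OF less_imp_le[OF t]] covariation_eq[OF t] AE_space
proof eventually_elim
  case (elim \<omega>)
  have c: "continuous_on {0..t} (\<lambda>s. H s \<omega>)" by (rule continuous_on_subset[OF H_continuous[OF elim(3)]]) simp
  have "integral {0..t} (\<lambda>s. drift (H s \<omega>)) =
    integral {0..t} (\<lambda>s. of_real K * (1 - (H s \<omega>)\<^sup>2)) - integral {0..t} (\<lambda>s. of_real (\<sigma>\<^sup>2 / 2) * H s \<omega>)"
    unfolding drift_def
    by (intro Henstock_Kurzweil_Integration.integral_diff integrable_continuous_real continuous_intros c)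
  also have "integral {0..t} (\<lambda>s. of_real (\<sigma>\<^sup>2 / 2) * H s \<omega>) = of_real (\<sigma>\<^sup>2 / 2) * integral {0..t} (\<lambda>s. H s \<omega>)"
    by (rule Henstock_Kurzweil_Integration.integral_mult_right)
  moreover have "\<i> * of_real \<sigma> * (J t \<omega> + \<i> * of_real \<sigma> * I / 2) = \<i> * of_real \<sigma> * J t \<omega> - of_real (\<sigma>\<^sup>2 / 2) * I" for I
  proof -
    have "(\<i> * of_real \<sigma>) * (\<i> * of_real \<sigma>) / 2 = - of_real (\<sigma>\<^sup>2 / 2)"
      by (simp add: complex_eq_iff power2_eq_square)
    moreover have "s * (J t \<omega> + s * I / 2) = s * J t \<omega> + (s * s / 2) * I" for s
      by (simp add: algebra_simps)
    ultimately show ?thesis by (simp only: mult_minus_left) simp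
  qed
  ultimately show ?case
    unfolding elim(1) elim(2) by simp
qed

text \<open>The defect of \<open>Y\<close> in the discretised Ito equation in the plane. The Euler
  chain of angles, mapped to the circle, is not the Euler scheme of that equation; it and the
  sampled solution are both shown to have small defect, and then compared.\<close>

definition remainder :: "real \<Rightarrow> (nat \<Rightarrow> 'a \<Rightarrow> complex) \<Rightarrow> nat \<Rightarrow> 'a \<Rightarrow> complex" where
  "remainder \<tau> Y k \<omega> = Y k \<omega> - x - (\<Sum>j<k. drift (Y j \<omega>) * of_real \<tau>)
     - \<i> * of_real \<sigma> * (\<Sum>j<k. Y j \<omega> * of_real (\<Delta> W \<tau> j \<omega>))"

lemma measurable_remainder:
  assumes "0 < \<tau>" and [measurable]: "\<And>j. Y j \<in> borel_measurable M"
  shows "remainder \<tau> Y k \<in> borel_measurable M"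
proof -
  note [measurable] = measurable_\<Delta>(1)[OF assms(1)]
  show ?thesis unfolding remainder_def[abs_def] by measurable
qed

definition path_error :: "real \<Rightarrow> real \<Rightarrow> ennreal" where
  "path_error \<tau> T = ennreal (4 * drift_lip\<^sup>2 * T + 16 * \<sigma>\<^sup>2) * gap \<tau> {0<..T}"

lemma sq_remainder_h:
  assumes \<tau>: "0 < \<tau>" and kT: "real k * \<tau> \<le> T"
  shows "sq M (remainder \<tau> (\<lambda>k. h (real k * \<tau>)) k) \<le> path_error \<tau> T"
proof (cases "k = 0")
  \<comment> \<open>\<open>h_ito\<close> holds for positive times. At \<open>k = 0\<close> the
    remainder is \<open>h 0 - x\<close>, which vanishes almost surely.\<close>
  case True
  have "sq M (remainder \<tau> (\<lambda>k. h (real k * \<tau>)) k) = sq M (\<lambda>_. 0)"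
    using h_0 by (intro sq_cong_AE) (auto simp: remainder_def True)
  then show ?thesis by (simp add: sq_def)
next
  case False
  define t where "t = real k * \<tau>"
  have t: "0 < t" "t \<le> T" using False \<tau> kT by (auto simp: t_def)
  have T: "0 \<le> T" using t by simp
  define E where "E \<omega> = integral {0..t} (\<lambda>s. drift (H s \<omega>)) - (\<Sum>j<k. drift (h (real j * \<tau>) \<omega>) * of_real \<tau>)" for \<omega>
  define G where "G \<omega> = J t \<omega> - (\<Sum>j<k. h (real j * \<tau>) \<omega> * of_real (\<Delta> W \<tau> j \<omega>))" for \<omega>
  have [measurable]: "h (real j * \<tau>) \<in> borel_measurable M" "\<Delta> W \<tau> j \<in> borel_measurable M" "J t \<in> borel_measurable M" for j
    using \<tau> t by (auto intro: measurable_h measurable_\<Delta> measurable_J)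
  have [measurable]: "(\<lambda>\<omega>. integral {0..t} (\<lambda>s. drift (H s \<omega>))) \<in> borel_measurable M"
    by (intro measurable_time_integral continuous_drift)
  have [measurable]: "E \<in> borel_measurable M" "G \<in> borel_measurable M" unfolding E_def G_def by measurable
  have eq: "AE \<omega> in M. remainder \<tau> (\<lambda>k. h (real k * \<tau>)) k \<omega> = E \<omega> + \<i> * of_real \<sigma> * G \<omega>"
    using h_ito[OF t(1)]
  proof eventually_elim
    case (elim \<omega>)
    then show ?case
      unfolding remainder_def E_def G_def t_def right_diff_distrib by simp
  qed
  \<comment> \<open>The Riemann error is controlled only in mean; this uniform bound turns that into
    control of its square.\<close>
  have bound: "cmod (E \<omega>) \<le> 2 * drift_lip * T" if \<omega>: "\<omega> \<in> space M" for \<omega>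
  proof -
    have "continuous_on {0..t} (\<lambda>s. drift (H s \<omega>))"
      by (rule continuous_on_compose2[OF continuous_drift[of UNIV] continuous_on_subset[OF H_continuous[OF \<omega>]]]) auto
    then have "cmod (integral {0..t} (\<lambda>s. drift (H s \<omega>))) \<le> drift_lip * (t - 0)"
      using t \<omega> by (intro integral_bound cmod_drift H_circle) auto
    moreover have "cmod (\<Sum>j<k. drift (h (real j * \<tau>) \<omega>) * of_real \<tau>) \<le> (\<Sum>j<k. drift_lip * \<tau>)"
      using \<tau> \<omega> by (intro sum_norm_le) (auto simp: norm_mult intro!: mult_right_mono cmod_drift h_circle)
    moreover have "(\<Sum>j<k. drift_lip * \<tau>) = drift_lip * t" by (simp add: t_def)
    moreover have "drift_lip * t \<le> drift_lip * T" using t drift_lip_nonneg by (intro mult_left_mono)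
    ultimately have "cmod (integral {0..t} (\<lambda>s. drift (H s \<omega>))) \<le> drift_lip * T"
      "cmod (\<Sum>j<k. drift (h (real j * \<tau>) \<omega>) * of_real \<tau>) \<le> drift_lip * T" by (simp only: diff_zero, metis order_trans)+
    then show ?thesis
      unfolding E_def mult.assoc by (intro order_trans[OF norm_triangle_ineq4]) linarith
  qed
  have gap: "gap \<tau> {0<..t} \<le> gap \<tau> {0<..T}" using t by (intro gap_mono) auto
  have "sq M E \<le> (\<integral>\<^sup>+\<omega>. ennreal (2 * drift_lip * T) * ennreal (cmod (E \<omega>)) \<partial>M)"
    unfolding sq_def
  proof (rule nn_integral_mono)
    fix \<omega> assume "\<omega> \<in> space M"
    then have "(cmod (E \<omega>))\<^sup>2 \<le> 2 * drift_lip * T * cmod (E \<omega>)"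
      unfolding power2_eq_square by (intro mult_right_mono bound) auto
    then have "ennreal ((cmod (E \<omega>))\<^sup>2) \<le> ennreal (2 * drift_lip * T * cmod (E \<omega>))" by (rule ennreal_leI)
    then show "ennreal ((cmod (E \<omega>))\<^sup>2) \<le> ennreal (2 * drift_lip * T) * ennreal (cmod (E \<omega>))"
      using drift_lip_nonneg T by (simp only: ennreal_mult mult_nonneg_nonneg norm_ge_zero zero_le_numeral)
  qed
  also have "\<dots> = ennreal (2 * drift_lip * T) * (\<integral>\<^sup>+\<omega>. ennreal (cmod (E \<omega>)) \<partial>M)"
    by (rule nn_integral_cmult) measurable
  also have "\<dots> \<le> ennreal (2 * drift_lip * T) * (ennreal drift_lip * gap \<tau> {0<..T})"
  proof (rule mult_left_mono)
    have "(\<integral>\<^sup>+\<omega>. ennreal (cmod (E \<omega>)) \<partial>M) \<le> ennreal drift_lip * gap \<tau> {0<..t}"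
      unfolding E_def t_def
      by (rule nn_integral_riemann_error[OF \<tau> drift_lip_nonneg continuous_drift drift_lipschitz])
    also have "\<dots> \<le> ennreal drift_lip * gap \<tau> {0<..T}" by (intro mult_left_mono gap) simp
    finally show "(\<integral>\<^sup>+\<omega>. ennreal (cmod (E \<omega>)) \<partial>M) \<le> ennreal drift_lip * gap \<tau> {0<..T}" .
  qed simp
  also have "\<dots> = ennreal (2 * drift_lip\<^sup>2 * T) * gap \<tau> {0<..T}"
  proof -
    have "ennreal (2 * drift_lip * T) * ennreal drift_lip = ennreal (2 * drift_lip * T * drift_lip)"
      using drift_lip_nonneg T by (intro ennreal_mult[symmetric]) auto
    also have "2 * drift_lip * T * drift_lip = 2 * drift_lip\<^sup>2 * T" by (simp add: power2_eq_square)
    finally show ?thesis by (simp only: mult.assoc[symmetric])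
  qed
  finally have E: "sq M E \<le> ennreal (2 * drift_lip\<^sup>2 * T) * gap \<tau> {0<..T}" .
  have "sq M G \<le> 8 * gap \<tau> {0<..T}"
    using sq_ito_sum[OF \<tau>, of k] mult_left_mono[OF gap, of 8]
    unfolding G_def \<Delta>_def t_def by (meson order_trans zero_le)
  then have G: "sq M (\<lambda>\<omega>. \<i> * of_real \<sigma> * G \<omega>) \<le> ennreal (\<sigma>\<^sup>2) * (8 * gap \<tau> {0<..T})"
    using \<sigma> by (subst sq_cmult) (auto simp: norm_mult intro!: mult_left_mono)
  have "sq M (remainder \<tau> (\<lambda>k. h (real k * \<tau>)) k) = sq M (\<lambda>\<omega>. E \<omega> + \<i> * of_real \<sigma> * G \<omega>)"
    by (rule sq_cong_AE[OF eq])
  also have "\<dots> \<le> 2 * sq M E + 2 * sq M (\<lambda>\<omega>. \<i> * of_real \<sigma> * G \<omega>)" by (rule sq_add) measurable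
  also have "\<dots> \<le> 2 * (ennreal (2 * drift_lip\<^sup>2 * T) * gap \<tau> {0<..T}) + 2 * (ennreal (\<sigma>\<^sup>2) * (8 * gap \<tau> {0<..T}))"
    by (intro add_mono mult_left_mono E G) auto
  also have "\<dots> = (2 * ennreal (2 * drift_lip\<^sup>2 * T) + 16 * ennreal (\<sigma>\<^sup>2)) * gap \<tau> {0<..T}"
    by (simp only: distrib_right) (simp add: mult_ac)
  also have "2 * ennreal (2 * drift_lip\<^sup>2 * T) + 16 * ennreal (\<sigma>\<^sup>2) = ennreal (4 * drift_lip\<^sup>2 * T + 16 * \<sigma>\<^sup>2)"
  proof -
    have "2 * ennreal (2 * drift_lip\<^sup>2 * T) = ennreal (2 * (2 * drift_lip\<^sup>2 * T))"
      by (subst (2) ennreal_mult') (auto simp: ennreal_numeral)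
    moreover have "16 * ennreal (\<sigma>\<^sup>2) = ennreal (16 * \<sigma>\<^sup>2)" by (subst ennreal_mult') (auto simp: ennreal_numeral)
    ultimately show ?thesis using T by (simp add: ennreal_plus[symmetric] del: ennreal_plus)
  qed
  finally show ?thesis by (simp only: path_error_def)
qed

text \<open>Of the terms beyond drift and noise, only the one with \<open>w\<^sup>2 - \<tau>\<close>, which has mean zero, is of order \<open>\<tau>\<close>.\<close>

lemma euler_step_expansion:
  assumes \<tau>: "0 < \<tau>"
  shows "(cmod (cis (\<phi> - 2 * K * \<tau> * sin \<phi> + \<sigma> * w) - cis \<phi> - drift (cis \<phi>) * of_real \<tau>
     - \<i> * of_real \<sigma> * (cis \<phi> * of_real w) - (- of_real (\<sigma>\<^sup>2 / 2) * cis \<phi>) * of_real (w\<^sup>2 - \<tau>)))\<^sup>2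
   \<le> 96 * ((2 * K * \<tau>) ^ 6 + \<sigma> ^ 6 * w ^ 6) + 12 * K\<^sup>2 * \<sigma>\<^sup>2 * \<tau>\<^sup>2 * w\<^sup>2 + 12 * K ^ 4 * \<tau> ^ 4"
    (is "(cmod ?r)\<^sup>2 \<le> _")
proof -
  define X y u where "X = cis \<phi>" and "y = sin \<phi>" and "u = - 2 * K * \<tau> * y + \<sigma> * w"
  \<comment> \<open>The Taylor error of third order of \<open>cis u\<close>, where \<open>u\<close>
    is the whole increment of the angle.\<close>
  define e where "e = cis u - (1 + \<i> * of_real u - of_real (u\<^sup>2 / 2))"
  have y: "\<bar>y\<bar> \<le> 1" by (simp add: y_def)
  have e: "cmod e \<le> \<bar>u\<bar> ^ 3"
  proof -
    have "(\<Sum>k\<le>2. (\<i> * of_real u) ^ k / fact k) = 1 + \<i> * of_real u - of_real (u\<^sup>2 / 2)"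
      by (simp add: numeral_2_eq_2 power2_eq_square) (simp add: complex_eq_iff)
    then have "cmod e \<le> \<bar>u\<bar> ^ 3 / fact 3"
      using iexp_approx1[of u 2] by (simp add: e_def cis_conv_exp)
    also have "\<dots> \<le> \<bar>u\<bar> ^ 3" by (simp add: fact_numeral)
    finally show ?thesis .
  qed
  \<comment> \<open>On the circle \<open>1 - X\<^sup>2 = X * (cnj X - X)\<close> is tangential,
    which is the origin of \<open>- 2 * K * sin\<close> in the equation for the angle.\<close>
  have drift: "drift X = X * (- 2 * \<i> * of_real (K * y) - of_real (\<sigma>\<^sup>2 / 2))"
  proof -
    have "1 - X\<^sup>2 = X * (cnj X - X)"
      by (simp add: X_def cis_mult cis_cnj power2_eq_square algebra_simps)
    also have "cnj X - X = - 2 * \<i> * of_real y" by (simp add: X_def y_def complex_eq_iff)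
    finally have sq: "1 - X\<^sup>2 = X * (- 2 * \<i> * of_real y)" .
    show ?thesis unfolding drift_def sq by (simp add: algebra_simps)
  qed
  have "cis (\<phi> - 2 * K * \<tau> * sin \<phi> + \<sigma> * w) = X * cis u"
    by (simp add: X_def u_def y_def cis_mult algebra_simps)
  \<comment> \<open>In \<open>- u\<^sup>2 / 2\<close> the part
    \<open>- \<sigma>\<^sup>2 * w\<^sup>2 / 2\<close> splits into the Ito correction of the drift
    and the compensated term, both cancelled in \<open>?r\<close>. The mixed term and the squared
    drift remain.\<close>
  then have "?r = X * e + X * (of_real (2 * K * \<tau> * y * \<sigma> * w - 2 * K\<^sup>2 * \<tau>\<^sup>2 * y\<^sup>2))"
    unfolding X_def[symmetric] drift by (simp add: e_def u_def power2_eq_square field_simps)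
  also have "cmod \<dots> \<le> \<bar>u\<bar> ^ 3 + (2 * K * \<tau> * \<sigma> * \<bar>w\<bar> + 2 * K\<^sup>2 * \<tau>\<^sup>2)"
  proof (intro order_trans[OF norm_triangle_ineq] add_mono)
    show "cmod (X * e) \<le> \<bar>u\<bar> ^ 3" using e by (simp add: norm_mult X_def)
    have "\<bar>2 * K * \<tau> * y * \<sigma> * w\<bar> \<le> 2 * K * \<tau> * \<sigma> * \<bar>w\<bar>"
      using y K \<tau> \<sigma> mult_right_mono[OF y, of "2 * K * \<tau> * \<sigma> * \<bar>w\<bar>"] by (simp add: abs_mult mult_ac)
    moreover have "\<bar>2 * K\<^sup>2 * \<tau>\<^sup>2 * y\<^sup>2\<bar> \<le> 2 * K\<^sup>2 * \<tau>\<^sup>2"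
      using y by (simp add: abs_mult abs_square_le_1 mult_left_le)
    ultimately have "\<bar>2 * K * \<tau> * y * \<sigma> * w - 2 * K\<^sup>2 * \<tau>\<^sup>2 * y\<^sup>2\<bar> \<le> 2 * K * \<tau> * \<sigma> * \<bar>w\<bar> + 2 * K\<^sup>2 * \<tau>\<^sup>2"
      by (intro order_trans[OF abs_triangle_ineq4] add_mono)
    then show "cmod (X * of_real (2 * K * \<tau> * y * \<sigma> * w - 2 * K\<^sup>2 * \<tau>\<^sup>2 * y\<^sup>2)) \<le> 2 * K * \<tau> * \<sigma> * \<bar>w\<bar> + 2 * K\<^sup>2 * \<tau>\<^sup>2"
      by (simp only: norm_mult norm_of_real) (simp add: X_def)
  qed
  finally have r: "cmod ?r \<le> \<bar>u\<bar> ^ 3 + (2 * K * \<tau> * \<sigma> * \<bar>w\<bar> + 2 * K\<^sup>2 * \<tau>\<^sup>2)" .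
  \<comment> \<open>The two power inequalities account for the constants: \<open>96 = 3 * 32\<close>
    and \<open>12 = 3 * 4\<close>.\<close>
  have three: "(a + (b + c))\<^sup>2 \<le> 3 * a\<^sup>2 + 3 * b\<^sup>2 + 3 * c\<^sup>2" for a b c :: real
  proof -
    have "0 \<le> (a - b)\<^sup>2 + (b - c)\<^sup>2 + (a - c)\<^sup>2" by simp
    then show ?thesis by (simp add: power2_eq_square algebra_simps)
  qed
  have six: "(a + b) ^ 6 \<le> 32 * (a ^ 6 + b ^ 6)" for a b :: real
  proof -
    have cube: "(p + q) ^ 3 \<le> 4 * (p ^ 3 + q ^ 3)" if "0 \<le> p" "0 \<le> q" for p q :: real
    proof -
      have "0 \<le> 3 * ((p + q) * (p - q)\<^sup>2)" using that by simp
      also have "\<dots> = 4 * (p ^ 3 + q ^ 3) - (p + q) ^ 3" by (simp add: power2_eq_square power3_eq_cube algebra_simps)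
      finally show ?thesis by simp
    qed
    have "(a + b)\<^sup>2 \<le> 2 * (a\<^sup>2 + b\<^sup>2)" using sum_squares_bound[of a b] by (simp add: power2_sum)
    then have "((a + b)\<^sup>2) ^ 3 \<le> (2 * (a\<^sup>2 + b\<^sup>2)) ^ 3" by (intro power_mono) auto
    also have "\<dots> = 8 * (a\<^sup>2 + b\<^sup>2) ^ 3" by (simp only: power_mult_distrib) simp
    also have "\<dots> \<le> 8 * (4 * ((a\<^sup>2) ^ 3 + (b\<^sup>2) ^ 3))" by (intro mult_left_mono cube) auto
    finally show ?thesis by (simp add: power_mult[symmetric])
  qed
  have u6: "u ^ 6 \<le> 32 * ((2 * K * \<tau>) ^ 6 + \<sigma> ^ 6 * w ^ 6)"
  proof -
    have "u ^ 6 \<le> 32 * ((- 2 * K * \<tau> * y) ^ 6 + (\<sigma> * w) ^ 6)" unfolding u_def by (rule six)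
    also have "(- 2 * K * \<tau> * y) ^ 6 = (2 * K * \<tau>) ^ 6 * \<bar>y\<bar> ^ 6" by (simp add: power_mult_distrib power_even_abs)
    also have "\<dots> \<le> (2 * K * \<tau>) ^ 6 * 1" using y K \<tau> by (intro mult_left_mono power_le_one) auto
    finally show ?thesis by (simp add: power_mult_distrib)
  qed
  have "(cmod ?r)\<^sup>2 \<le> (\<bar>u\<bar> ^ 3 + (2 * K * \<tau> * \<sigma> * \<bar>w\<bar> + 2 * K\<^sup>2 * \<tau>\<^sup>2))\<^sup>2" using r by (intro power_mono) auto
  also have "\<dots> \<le> 3 * (\<bar>u\<bar> ^ 3)\<^sup>2 + 3 * (2 * K * \<tau> * \<sigma> * \<bar>w\<bar>)\<^sup>2 + 3 * (2 * K\<^sup>2 * \<tau>\<^sup>2)\<^sup>2" by (rule three)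
  also have "(\<bar>u\<bar> ^ 3)\<^sup>2 = u ^ 6" by (simp add: power_mult[symmetric] power_even_abs)
  also have "3 * (2 * K * \<tau> * \<sigma> * \<bar>w\<bar>)\<^sup>2 = 12 * K\<^sup>2 * \<sigma>\<^sup>2 * \<tau>\<^sup>2 * w\<^sup>2" by (simp add: power_mult_distrib)
  also have "3 * (2 * K\<^sup>2 * \<tau>\<^sup>2)\<^sup>2 = 12 * K ^ 4 * \<tau> ^ 4" by (simp add: power_mult_distrib power_mult[symmetric])
  finally show ?thesis using u6 by linarith
qed

section \<open>The Euler points as approximate solutions\<close>

definition euler_point :: "real \<Rightarrow> real \<Rightarrow> nat \<Rightarrow> 'a \<Rightarrow> complex" where
  "euler_point \<tau> \<theta> k \<omega> = cis (euler_angle K \<sigma> W \<tau> \<theta> k \<omega>)"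

lemma measurable_euler_point_F: "0 < \<tau> \<Longrightarrow> euler_point \<tau> \<theta> k \<in> borel_measurable (F (real k * \<tau>))"
  unfolding euler_point_def[abs_def]
  by (rule measurable_compose[OF measurable_euler_angle])
    (auto intro!: borel_measurable_continuous_onI continuous_intros)

lemma measurable_euler_point: "0 < \<tau> \<Longrightarrow> euler_point \<tau> \<theta> k \<in> borel_measurable M"
  using measurable_euler_point_F by (rule measurable_F)

text \<open>The bound of \<open>euler_step_expansion\<close> in mean, with moments
  \<open>\<tau>\<close> and \<open>15 * \<tau> ^ 3\<close> of orders 2 and 6 and with higher powers
  of \<tau> lowered to the third, as \<open>\<tau> \<le> 1\<close>.\<close>

definition euler_const :: real where
  "euler_const = 96 * (64 * K ^ 6 + 15 * \<sigma> ^ 6) + 12 * K\<^sup>2 * \<sigma>\<^sup>2 + 12 * K ^ 4"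

lemma euler_const_nonneg: "0 \<le> euler_const"
  using K \<sigma> by (simp add: euler_const_def)

definition scheme_error :: "real \<Rightarrow> real \<Rightarrow> ennreal" where
  "scheme_error \<tau> T = ennreal ((\<sigma> ^ 4 * T + 2 * euler_const * T\<^sup>2) * \<tau>)"

text \<open>The centred terms are of order \<tau> but orthogonal, so their sum has squared norm of
  order \<open>k * \<tau>\<^sup>2\<close>. The others have squared norm of order
  \<open>\<tau> ^ 3\<close>, and the crude factor \<open>k\<close> of \<open>sq_sum\<close> is
  affordable. Both totals are of order \<tau>.\<close>

lemma sq_remainder_euler:
  assumes \<tau>: "0 < \<tau>" "\<tau> \<le> 1" and kT: "real k * \<tau> \<le> T" and \<theta>: "cis \<theta> = x"
  shows "sq M (remainder \<tau> (euler_point \<tau> \<theta>) k) \<le> scheme_error \<tau> T"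
proof -
  let ?X = "euler_point \<tau> \<theta>"
  define c where "c j \<omega> = - of_real (\<sigma>\<^sup>2 / 2) * ?X j \<omega>" for j \<omega>
  define r where "r j \<omega> = ?X (Suc j) \<omega> - ?X j \<omega> - drift (?X j \<omega>) * of_real \<tau>
     - \<i> * of_real \<sigma> * (?X j \<omega> * of_real (\<Delta> W \<tau> j \<omega>)) - c j \<omega> * of_real ((\<Delta> W \<tau> j \<omega>)\<^sup>2 - \<tau>)" for j \<omega>
  note [measurable] = measurable_euler_point[OF \<tau>(1)] measurable_\<Delta>(1)[OF \<tau>(1)]
  have [measurable]: "c j \<in> borel_measurable M" for j unfolding c_def by measurable
  have [measurable]: "r j \<in> borel_measurable M" for j unfolding r_def by measurable
  have T: "0 \<le> T" using kT \<tau> by (meson mult_nonneg_nonneg of_nat_0_le_iff order_trans less_imp_le)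
  have "remainder \<tau> ?X k \<omega> = (\<Sum>j<k. c j \<omega> * of_real ((\<Delta> W \<tau> j \<omega>)\<^sup>2 - \<tau>)) + (\<Sum>j<k. r j \<omega>)" for \<omega>
  proof -
    have "?X k \<omega> - ?X 0 \<omega> = (\<Sum>j<k. ?X (Suc j) \<omega> - ?X j \<omega>)" by (rule sum_lessThan_telescope[symmetric])
    then show ?thesis
      by (simp add: remainder_def r_def sum.distrib sum_subtractf sum_distrib_left euler_point_def \<theta>)
  qed
  then have "sq M (remainder \<tau> ?X k) = sq M (\<lambda>\<omega>. (\<Sum>j<k. c j \<omega> * of_real ((\<Delta> W \<tau> j \<omega>)\<^sup>2 - \<tau>)) + (\<Sum>j<k. r j \<omega>))"
    by (simp add: sq_def)
  also have "\<dots> \<le> 2 * sq M (\<lambda>\<omega>. \<Sum>j<k. c j \<omega> * of_real ((\<Delta> W \<tau> j \<omega>)\<^sup>2 - \<tau>)) + 2 * sq M (\<lambda>\<omega>. \<Sum>j<k. r j \<omega>)"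
    by (rule sq_add) measurable
  also have "\<dots> \<le> 2 * ennreal (2 * \<tau>\<^sup>2 * (real k * (\<sigma>\<^sup>2 / 2)\<^sup>2)) + 2 * (of_nat k * (\<Sum>j<k. ennreal (euler_const * \<tau> ^ 3)))"
  proof (intro add_mono mult_left_mono)
    show "sq M (\<lambda>\<omega>. \<Sum>j<k. c j \<omega> * of_real ((\<Delta> W \<tau> j \<omega>)\<^sup>2 - \<tau>)) \<le> ennreal (2 * \<tau>\<^sup>2 * (real k * (\<sigma>\<^sup>2 / 2)\<^sup>2))"
    proof (rule sq_compensated_squares[OF \<tau>(1)])
      show "c j \<in> borel_measurable (F (real j * \<tau>))" for j
        unfolding c_def using measurable_euler_point_F[OF \<tau>(1)] by (intro borel_measurable_times) auto
      show "cmod (c j \<omega>) \<le> \<sigma>\<^sup>2 / 2" for j \<omega>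
        by (simp add: c_def norm_mult euler_point_def del: of_real_divide of_real_power)
    qed
    have r: "sq M (r j) \<le> ennreal (euler_const * \<tau> ^ 3)" for j
    proof -
      let ?w = "\<Delta> W \<tau> j"
      define a b d where "a = 96 * (2 * K * \<tau>) ^ 6 + 12 * K ^ 4 * \<tau> ^ 4"
        and "b = 96 * \<sigma> ^ 6" and "d = 12 * K\<^sup>2 * \<sigma>\<^sup>2 * \<tau>\<^sup>2"
      have pos: "0 \<le> a" "0 \<le> b" "0 \<le> d" using K \<sigma> \<tau> by (auto simp: a_def b_def d_def)
      have w6: "(\<integral>\<^sup>+\<omega>. ennreal (?w \<omega> ^ 6) \<partial>M) = ennreal (15 * \<tau> ^ 3)"
        and w2: "(\<integral>\<^sup>+\<omega>. ennreal ((?w \<omega>)\<^sup>2) \<partial>M) = ennreal \<tau>"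
      proof -
        have st: "0 \<le> real j * \<tau>" "real j * \<tau> < real (Suc j) * \<tau>" "real (Suc j) * \<tau> - real j * \<tau> = \<tau>"
          using \<tau> by (auto simp: algebra_simps)
        show "(\<integral>\<^sup>+\<omega>. ennreal (?w \<omega> ^ 6) \<partial>M) = ennreal (15 * \<tau> ^ 3)"
          unfolding \<Delta>_def nn_integral_increment_power[OF st(1,2), of 6, simplified even_numeral, OF TrueI] st(3)
          by (simp only: gauss_moments(5)[OF \<tau>(1)])
        show "(\<integral>\<^sup>+\<omega>. ennreal ((?w \<omega>)\<^sup>2) \<partial>M) = ennreal \<tau>"
          unfolding \<Delta>_def nn_integral_increment_power[OF st(1,2), of 2, simplified even_numeral, OF TrueI] st(3)
          by (simp only: gauss_moments(3)[OF \<tau>(1)])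
      qed
      have "sq M (r j) \<le> (\<integral>\<^sup>+\<omega>. ennreal a + (ennreal b * ennreal (?w \<omega> ^ 6) + ennreal d * ennreal ((?w \<omega>)\<^sup>2)) \<partial>M)"
        unfolding sq_def
      proof (rule nn_integral_mono)
        fix \<omega>
        have "(cmod (r j \<omega>))\<^sup>2 \<le> a + (b * ?w \<omega> ^ 6 + d * (?w \<omega>)\<^sup>2)"
          using euler_step_expansion[OF \<tau>(1), of "euler_angle K \<sigma> W \<tau> \<theta> j \<omega>" "?w \<omega>"]
          by (simp add: r_def c_def euler_point_def a_def b_def d_def \<Delta>_def algebra_simps)
        then have "ennreal ((cmod (r j \<omega>))\<^sup>2) \<le> ennreal (a + (b * ?w \<omega> ^ 6 + d * (?w \<omega>)\<^sup>2))" by (rule ennreal_leI)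
        also have "\<dots> = ennreal a + (ennreal b * ennreal (?w \<omega> ^ 6) + ennreal d * ennreal ((?w \<omega>)\<^sup>2))"
          using pos by (simp add: ennreal_plus ennreal_mult zero_le_even_power)
        finally show "ennreal ((cmod (r j \<omega>))\<^sup>2) \<le> ennreal a + (ennreal b * ennreal (?w \<omega> ^ 6) + ennreal d * ennreal ((?w \<omega>)\<^sup>2))" .
      qed
      also have "\<dots> = ennreal a + (ennreal b * ennreal (15 * \<tau> ^ 3) + ennreal d * ennreal \<tau>)"
        by (simp add: nn_integral_add nn_integral_cmult emeasure_space_1 w2 w6 del: ennreal_mult'')
      also have "ennreal a + (ennreal b * ennreal (15 * \<tau> ^ 3) + ennreal d * ennreal \<tau>) = ennreal (a + (b * (15 * \<tau> ^ 3) + d * \<tau>))"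
        using pos \<tau> by (simp add: ennreal_plus ennreal_mult)
      also have "\<dots> \<le> ennreal (euler_const * \<tau> ^ 3)"
      proof (rule ennreal_leI)
        have "\<tau> ^ 6 \<le> \<tau> ^ 3" "\<tau> ^ 4 \<le> \<tau> ^ 3" using \<tau> by (auto intro!: power_decreasing)
        then have "96 * (64 * K ^ 6) * \<tau> ^ 6 \<le> 96 * (64 * K ^ 6) * \<tau> ^ 3" "12 * K ^ 4 * \<tau> ^ 4 \<le> 12 * K ^ 4 * \<tau> ^ 3"
          using K by (intro mult_left_mono; simp)+
        moreover have "d * \<tau> = 12 * K\<^sup>2 * \<sigma>\<^sup>2 * \<tau> ^ 3" by (simp add: d_def power2_eq_square power3_eq_cube)
        ultimately show "a + (b * (15 * \<tau> ^ 3) + d * \<tau>) \<le> euler_const * \<tau> ^ 3"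
          by (simp add: a_def b_def euler_const_def power_mult_distrib algebra_simps)
      qed
      finally show ?thesis .
    qed
    show "sq M (\<lambda>\<omega>. \<Sum>j<k. r j \<omega>) \<le> of_nat k * (\<Sum>j<k. ennreal (euler_const * \<tau> ^ 3))"
      by (rule order_trans[OF sq_sum]) (auto intro!: mult_left_mono sum_mono r simp del: sum_ennreal sum_constant)
  qed auto
  also have "\<dots> = ennreal (\<sigma> ^ 4 * (real k * \<tau>) * \<tau> + 2 * euler_const * (real k * \<tau>)\<^sup>2 * \<tau>)"
  proof -
    have "2 * ennreal (2 * \<tau>\<^sup>2 * (real k * (\<sigma>\<^sup>2 / 2)\<^sup>2)) = ennreal (\<sigma> ^ 4 * (real k * \<tau>) * \<tau>)"
    proof -
      have "2 * ennreal (2 * \<tau>\<^sup>2 * (real k * (\<sigma>\<^sup>2 / 2)\<^sup>2)) = ennreal (2 * (2 * \<tau>\<^sup>2 * (real k * (\<sigma>\<^sup>2 / 2)\<^sup>2)))"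
        by (subst (2) ennreal_mult') (auto simp: ennreal_numeral)
      also have "2 * (2 * \<tau>\<^sup>2 * (real k * (\<sigma>\<^sup>2 / 2)\<^sup>2)) = \<sigma> ^ 4 * (real k * \<tau>) * \<tau>"
        by (simp add: power2_eq_square power4_eq_xxxx)
      finally show ?thesis .
    qed
    moreover have "2 * (of_nat k * (\<Sum>j<k. ennreal (euler_const * \<tau> ^ 3))) = ennreal (2 * euler_const * (real k * \<tau>)\<^sup>2 * \<tau>)"
    proof -
      have "2 * (of_nat k * (\<Sum>j<k. ennreal (euler_const * \<tau> ^ 3))) =
          ennreal 2 * (ennreal (real k) * (ennreal (real k) * ennreal (euler_const * \<tau> ^ 3)))"
        by (simp only: sum_constant card_lessThan ennreal_of_nat_eq_real_of_nat) (simp add: ennreal_numeral)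
      also have "\<dots> = ennreal (2 * (real k * (real k * (euler_const * \<tau> ^ 3))))"
        by (simp only: ennreal_mult' of_nat_0_le_iff zero_le_numeral)
      also have "2 * (real k * (real k * (euler_const * \<tau> ^ 3))) = 2 * euler_const * (real k * \<tau>)\<^sup>2 * \<tau>"
        by (simp add: power2_eq_square power3_eq_cube)
      finally show ?thesis .
    qed
    ultimately show ?thesis
      using \<tau> \<sigma> euler_const_nonneg by (simp only:) (rule ennreal_plus[symmetric]; simp)
  qed
  also have "\<dots> \<le> ennreal ((\<sigma> ^ 4 * T + 2 * euler_const * T\<^sup>2) * \<tau>)"
    unfolding distrib_right using \<tau> kT \<sigma> euler_const_nonneg
    by (intro ennreal_leI add_mono mult_right_mono mult_left_mono power_mono) auto
  finally show ?thesis by (simp only: scheme_error_def)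
qed

section \<open>Comparison of the solution with the scheme\<close>

lemma sq_martingale_part:
  assumes \<tau>: "0 < \<tau>" and c: "\<And>k. c k \<in> borel_measurable (F (real k * \<tau>))" "\<And>k \<omega>. \<omega> \<in> space M \<Longrightarrow> cmod (c k \<omega>) \<le> B"
  shows "sq M (\<lambda>\<omega>. \<Sum>j<k. c j \<omega> * of_real (\<Delta> W \<tau> j \<omega>)) = ennreal \<tau> * (\<Sum>j<k. sq M (c j))"
proof -
  have i: "integrable M (\<lambda>\<omega>. (cmod (c j \<omega>))\<^sup>2)" for j
  proof (rule integrable_const_bound[where B="B\<^sup>2"])
    show "AE \<omega> in M. norm ((cmod (c j \<omega>))\<^sup>2) \<le> B\<^sup>2"
      using c(2)[of _ j] by (intro AE_I2) (simp add: power_mono)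
    show "(\<lambda>\<omega>. (cmod (c j \<omega>))\<^sup>2) \<in> borel_measurable M"
      using measurable_F[OF c(1)[of j]] by measurable
  qed
  have g: "(\<lambda>w::real. w) \<in> borel_measurable borel" "integrable (gauss \<tau>) (\<lambda>w. w)"
    using gauss_moments(1)[OF \<tau>, of 1] by (measurable, simp only: power_one_right)
  note ms = martingale_sum(2,3)[where n=k and B=B, OF \<tau> g gauss_moments(1)[OF \<tau>, of 2]
      gauss_moments(2,3)[OF \<tau>] c]
  have "sq M (\<lambda>\<omega>. \<Sum>j<k. c j \<omega> * of_real (\<Delta> W \<tau> j \<omega>)) = ennreal (\<tau> * (\<Sum>j<k. \<integral>\<omega>. (cmod (c j \<omega>))\<^sup>2 \<partial>M))"
    by (subst sq_eq_integral) (simp_all only: \<Delta>_def ms)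
  also have "\<dots> = ennreal \<tau> * (\<Sum>j<k. ennreal (\<integral>\<omega>. (cmod (c j \<omega>))\<^sup>2 \<partial>M))"
    using \<tau> by (simp add: ennreal_mult' sum_nonneg)
  finally show ?thesis using i by (simp only: sq_eq_integral)
qed

lemma sq_euler_error:
  assumes \<tau>: "0 < \<tau>" "\<tau> \<le> 1" and n: "real n * \<tau> = T" and \<theta>: "cis \<theta> = x"
  shows "sq M (\<lambda>\<omega>. h T \<omega> - euler_point \<tau> \<theta> n \<omega>) \<le>
    (8 * path_error \<tau> T + 8 * scheme_error \<tau> T) * (1 + ennreal ((2 * T * drift_lip\<^sup>2 + 4 * \<sigma>\<^sup>2) * \<tau>)) ^ n"
proof -
  let ?X = "euler_point \<tau> \<theta>" and ?h = "\<lambda>k. h (real k * \<tau>)"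
  define D where "D k \<omega> = ?h k \<omega> - ?X k \<omega>" for k \<omega>
  have T: "0 \<le> T" using n \<tau> by auto
  have nn: "0 \<le> real j * \<tau>" for j using \<tau> by simp
  have mF: "?h j \<in> borel_measurable (F (real j * \<tau>))" "?X j \<in> borel_measurable (F (real j * \<tau>))" for j
    using nn h_adapted measurable_euler_point_F[OF \<tau>(1)] by auto
  have [measurable]: "?h j \<in> borel_measurable M" "?X j \<in> borel_measurable M" "\<Delta> W \<tau> j \<in> borel_measurable M" for j
    using mF[THEN measurable_F] measurable_\<Delta>(1)[OF \<tau>(1)] by auto
  have DF: "D j \<in> borel_measurable (F (real j * \<tau>))" for j
    unfolding D_def using mF by (intro borel_measurable_diff)
  have [measurable]: "D j \<in> borel_measurable M" for j using DF by (rule measurable_F)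
  have X_circle: "?X j \<omega> \<in> circle" for j \<omega> by (simp add: euler_point_def)
  have D2: "cmod (D j \<omega>) \<le> 2" if "\<omega> \<in> space M" for j \<omega>
    using norm_triangle_ineq4[of "?h j \<omega>" "?X j \<omega>"] cmod_h[OF nn that] X_circle[of j \<omega>] by (simp add: D_def)
  let ?\<alpha> = "8 * path_error \<tau> T + 8 * scheme_error \<tau> T"
    and ?\<beta> = "ennreal ((2 * T * drift_lip\<^sup>2 + 4 * \<sigma>\<^sup>2) * \<tau>)"
  have "sq M (D k) \<le> ?\<alpha> + ?\<beta> * (\<Sum>j<k. sq M (D j))" if k: "k \<le> n" for k
  proof -
    have kT: "real k * \<tau> \<le> T" using k \<tau> unfolding n[symmetric] by (intro mult_right_mono) auto
    define A where "A \<omega> = (\<Sum>j<k. (drift (?h j \<omega>) - drift (?X j \<omega>)) * of_real \<tau>)" for \<omega>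
    define B where "B \<omega> = (\<Sum>j<k. D j \<omega> * of_real (\<Delta> W \<tau> j \<omega>))" for \<omega>
    define R where "R \<omega> = remainder \<tau> ?h k \<omega> - remainder \<tau> ?X k \<omega>" for \<omega>
    have [measurable]: "A \<in> borel_measurable M" "B \<in> borel_measurable M" unfolding A_def B_def by measurable
    have [measurable]: "remainder \<tau> ?h k \<in> borel_measurable M" "remainder \<tau> ?X k \<in> borel_measurable M"
      using \<tau> by (auto intro!: measurable_remainder)
    have [measurable]: "R \<in> borel_measurable M" unfolding R_def by measurable
    \<comment> \<open>The difference of the two discrete equations. The noise coefficient is linear,
      so \<open>B\<close> is a martingale sum in the previous errors themselves, and Gronwall
      applies to their squared norms.\<close>
    have "D k \<omega> = A \<omega> + (\<i> * of_real \<sigma> * B \<omega> + R \<omega>)" for \<omega>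
      by (simp add: D_def A_def B_def R_def remainder_def left_diff_distrib sum_subtractf right_diff_distrib)
    then have "sq M (D k) = sq M (\<lambda>\<omega>. A \<omega> + (\<i> * of_real \<sigma> * B \<omega> + R \<omega>))" by (simp add: sq_def)
    also have "\<dots> \<le> 2 * sq M A + 2 * sq M (\<lambda>\<omega>. \<i> * of_real \<sigma> * B \<omega> + R \<omega>)" by (rule sq_add) measurable
    also have "\<dots> \<le> 2 * sq M A + 2 * (2 * sq M (\<lambda>\<omega>. \<i> * of_real \<sigma> * B \<omega>) + 2 * sq M R)"
      by (intro add_mono mult_left_mono sq_add order_refl) auto
    also have "\<dots> \<le> 2 * (ennreal (T * drift_lip\<^sup>2 * \<tau>) * (\<Sum>j<k. sq M (D j)))
      + 2 * (2 * (ennreal (\<sigma>\<^sup>2) * (ennreal \<tau> * (\<Sum>j<k. sq M (D j))))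
           + 2 * (2 * path_error \<tau> T
              + 2 * scheme_error \<tau> T))"
    proof (intro add_mono mult_left_mono)
      have "sq M A \<le> of_nat k * (\<Sum>j<k. sq M (\<lambda>\<omega>. (drift (?h j \<omega>) - drift (?X j \<omega>)) * of_real \<tau>))"
        unfolding A_def[abs_def] by (rule sq_sum) measurable
      also have "\<dots> \<le> of_nat k * (\<Sum>j<k. ennreal (drift_lip\<^sup>2 * \<tau>\<^sup>2) * sq M (D j))"
      proof (intro mult_left_mono sum_mono)
        fix j
        have "sq M (\<lambda>\<omega>. (drift (?h j \<omega>) - drift (?X j \<omega>)) * of_real \<tau>) \<le> sq M (\<lambda>\<omega>. of_real (drift_lip * \<tau>) * D j \<omega>)"
        proof (rule sq_mono_AE, rule AE_I2)
          fix \<omega> assume "\<omega> \<in> space M"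
          then have "cmod (drift (?h j \<omega>) - drift (?X j \<omega>)) \<le> drift_lip * cmod (D j \<omega>)"
            unfolding D_def by (intro drift_lipschitz h_circle nn X_circle)
          then have "cmod (drift (?h j \<omega>) - drift (?X j \<omega>)) * \<tau> \<le> drift_lip * cmod (D j \<omega>) * \<tau>"
            using \<tau> by (intro mult_right_mono) auto
          then show "cmod ((drift (?h j \<omega>) - drift (?X j \<omega>)) * of_real \<tau>) \<le> cmod (of_real (drift_lip * \<tau>) * D j \<omega>)"
            using \<tau> drift_lip_nonneg by (simp add: norm_mult abs_mult mult_ac)
        qed
        also have "\<dots> = ennreal (drift_lip\<^sup>2 * \<tau>\<^sup>2) * sq M (D j)"
          by (subst sq_cmult) (auto simp: norm_mult power_mult_distrib)
        finally show "sq M (\<lambda>\<omega>. (drift (?h j \<omega>) - drift (?X j \<omega>)) * of_real \<tau>) \<le> ennreal (drift_lip\<^sup>2 * \<tau>\<^sup>2) * sq M (D j)" .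
      qed simp
      also have "\<dots> = ennreal (real k * (drift_lip\<^sup>2 * \<tau>\<^sup>2)) * (\<Sum>j<k. sq M (D j))"
      proof -
        have "ennreal (real k * (drift_lip\<^sup>2 * \<tau>\<^sup>2)) = of_nat k * ennreal (drift_lip\<^sup>2 * \<tau>\<^sup>2)"
          by (simp only: ennreal_of_nat_eq_real_of_nat ennreal_mult'[OF of_nat_0_le_iff])
        then show ?thesis by (simp only: sum_distrib_left[symmetric] mult.assoc)
      qed
      also have "\<dots> \<le> ennreal (T * drift_lip\<^sup>2 * \<tau>) * (\<Sum>j<k. sq M (D j))"
      proof (intro mult_right_mono ennreal_leI)
        have "real k * (drift_lip\<^sup>2 * \<tau>\<^sup>2) = (real k * \<tau>) * (drift_lip\<^sup>2 * \<tau>)" by (simp add: power2_eq_square)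
        also have "\<dots> \<le> T * (drift_lip\<^sup>2 * \<tau>)" using kT \<tau> by (intro mult_right_mono) auto
        finally show "real k * (drift_lip\<^sup>2 * \<tau>\<^sup>2) \<le> T * drift_lip\<^sup>2 * \<tau>" by (simp only: mult.assoc)
      qed simp
      finally show "sq M A \<le> ennreal (T * drift_lip\<^sup>2 * \<tau>) * (\<Sum>j<k. sq M (D j))" .
      have "sq M (\<lambda>\<omega>. \<i> * of_real \<sigma> * B \<omega>) = ennreal (\<sigma>\<^sup>2) * sq M B"
        by (subst sq_cmult) (auto simp: norm_mult)
      also have "sq M B = ennreal \<tau> * (\<Sum>j<k. sq M (D j))"
        unfolding B_def[abs_def] by (rule sq_martingale_part[OF \<tau>(1) DF D2])
      finally show "sq M (\<lambda>\<omega>. \<i> * of_real \<sigma> * B \<omega>) \<le> ennreal (\<sigma>\<^sup>2) * (ennreal \<tau> * (\<Sum>j<k. sq M (D j)))" by simp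
      have "sq M R \<le> 2 * sq M (remainder \<tau> ?h k) + 2 * sq M (remainder \<tau> ?X k)"
        unfolding R_def[abs_def] by (rule sq_diff) measurable
      also have "\<dots> \<le> 2 * path_error \<tau> T
              + 2 * scheme_error \<tau> T"
        by (intro add_mono mult_left_mono sq_remainder_h sq_remainder_euler \<tau> kT \<theta>) auto
      finally show "sq M R \<le> 2 * path_error \<tau> T
              + 2 * scheme_error \<tau> T" .
    qed auto
    also have "\<dots> = ?\<alpha> + ?\<beta> * (\<Sum>j<k. sq M (D j))"
    proof -
      have "ennreal ((2 * T * drift_lip\<^sup>2 + 4 * \<sigma>\<^sup>2) * \<tau>) = ennreal 2 * ennreal (T * drift_lip\<^sup>2 * \<tau>) + ennreal 4 * (ennreal (\<sigma>\<^sup>2) * ennreal \<tau>)"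
        using T \<tau> by (simp add: ennreal_mult[symmetric] ennreal_plus[symmetric] distrib_right mult.assoc
          del: ennreal_plus ennreal_numeral)
      then have b: "?\<beta> = 2 * ennreal (T * drift_lip\<^sup>2 * \<tau>) + 4 * (ennreal (\<sigma>\<^sup>2) * ennreal \<tau>)"
        by (simp only: ennreal_numeral)
      have "2 * (p * S) + 2 * (2 * (q * (r * S)) + 2 * (2 * u + 2 * v)) = (8 * u + 8 * v) + (2 * p + 4 * (q * r)) * S"
        for p q r S u v :: ennreal
        by (simp only: distrib_left distrib_right) (simp add: mult.assoc[symmetric] add_ac)
      then show ?thesis unfolding b .
    qed
    finally show ?thesis .
  qed
  from gronwall_sum[of n "\<lambda>k. sq M (D k)", OF this]
  show ?thesis by (simp add: D_def[abs_def] n)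
qed

lemma euler_tendsto:
  assumes T: "0 < T" and \<theta>: "cis \<theta> = x"
  defines "\<tau> \<equiv> \<lambda>n. T / real (Suc n)"
  shows "(\<lambda>n. sq M (\<lambda>\<omega>. h T \<omega> - euler_point (\<tau> n) \<theta> (Suc n) \<omega>)) \<longlonglongrightarrow> 0"
proof -
  define b where "b = 2 * T * drift_lip\<^sup>2 + 4 * \<sigma>\<^sup>2"
  have b: "0 \<le> b" using T by (simp add: b_def)
  have \<tau>: "0 < \<tau> n" and N\<tau>: "real (Suc n) * \<tau> n = T" for n using T by (simp_all add: \<tau>_def)
  have \<tau>0: "\<tau> \<longlonglongrightarrow> 0"
    unfolding \<tau>_def using LIMSEQ_Suc[OF lim_const_over_n[of T]] by simp
  let ?\<alpha> = "\<lambda>n. 8 * path_error (\<tau> n) T + 8 * scheme_error (\<tau> n) T"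
  show ?thesis
  proof (rule tendsto_sandwich[of "\<lambda>_. 0" _ _ "\<lambda>n. ennreal (exp (b * T)) * ?\<alpha> n"])
    have "\<forall>\<^sub>F n in sequentially. \<tau> n < 1" using \<tau>0 by (rule order_tendstoD) simp
    then show "\<forall>\<^sub>F n in sequentially. sq M (\<lambda>\<omega>. h T \<omega> - euler_point (\<tau> n) \<theta> (Suc n) \<omega>) \<le> ennreal (exp (b * T)) * ?\<alpha> n"
    proof eventually_elim
      case (elim n)
      \<comment> \<open>The Gronwall factor is bounded by \<open>exp (b * T)\<close> for all step
        sizes, so only the two vanishing remainders matter.\<close>
      have "(1 + ennreal (b * \<tau> n)) ^ Suc n = ennreal ((1 + b * \<tau> n) ^ Suc n)"
        using b \<tau>[of n] by (simp add: ennreal_power[symmetric] ennreal_plus del: power_Suc)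
      also have "\<dots> \<le> ennreal (exp (b * \<tau> n) ^ Suc n)"
        using b \<tau>[of n] by (intro ennreal_leI power_mono) auto
      also have "exp (b * \<tau> n) ^ Suc n = exp (b * T)"
        unfolding exp_of_nat_mult[symmetric] N\<tau>[of n, symmetric] by (simp only: mult_ac)
      finally have "?\<alpha> n * (1 + ennreal (b * \<tau> n)) ^ Suc n \<le> ?\<alpha> n * ennreal (exp (b * T))"
        by (rule mult_left_mono) simp
      with sq_euler_error[OF \<tau> less_imp_le[OF elim] N\<tau> \<theta>] show ?case
        unfolding b_def by (simp only: mult.commute[of "ennreal (exp _)"])
    qed
    have "(\<lambda>n. (\<sigma> ^ 4 * T + 2 * euler_const * T\<^sup>2) * \<tau> n) \<longlonglongrightarrow> (\<sigma> ^ 4 * T + 2 * euler_const * T\<^sup>2) * 0"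
      by (intro tendsto_intros \<tau>0)
    then have 2: "(\<lambda>n. ennreal ((\<sigma> ^ 4 * T + 2 * euler_const * T\<^sup>2) * \<tau> n)) \<longlonglongrightarrow> 0"
      using tendsto_ennrealI by fastforce
    have "(\<lambda>n. ennreal (exp (b * T)) * ?\<alpha> n) \<longlonglongrightarrow> ennreal (exp (b * T)) * (8 * (ennreal (4 * drift_lip\<^sup>2 * T + 16 * \<sigma>\<^sup>2) * 0) + 8 * 0)"
      unfolding path_error_def scheme_error_def
      by (intro ennreal_tendsto_cmult tendsto_add gap_tendsto \<tau> \<tau>0 2) (auto simp: less_top[symmetric])
    then show "(\<lambda>n. ennreal (exp (b * T)) * ?\<alpha> n) \<longlonglongrightarrow> 0" by simp
  qed simp_all
qed

text \<open>The limit is taken along operators that know only the starting angle, not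
  \<open>W\<close> or the solution: this determines the law of \<open>h T\<close> and makes
  solutions from different points comparable.\<close>

lemma expectation_tendsto:
  fixes f :: "complex \<Rightarrow> real"
  assumes T: "0 < T" and \<theta>: "cis \<theta> = x"
    and f: "\<And>z. f z \<in> {0..1}" and lip: "\<And>u v. \<bar>f u - f v\<bar> \<le> Lp * cmod (u - v)" and Lp: "0 \<le> Lp"
  shows "(\<lambda>n. (step_op K \<sigma> (T / real (Suc n)) ^^ Suc n) (\<lambda>\<phi>. f (cis \<phi>)) \<theta>) \<longlonglongrightarrow> (\<integral>\<omega>. f (h T \<omega>) \<partial>M)"
proof -
  define \<tau> where "\<tau> n = T / real (Suc n)" for n
  have \<tau>: "0 < \<tau> n" for n using T by (simp add: \<tau>_def)
  let ?X = "\<lambda>n. euler_point (\<tau> n) \<theta> (Suc n)"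
  have "continuous_on UNIV f" by (rule continuous_on_abs_lipschitz[OF lip Lp])
  then have [measurable]: "f \<in> borel_measurable borel" by (rule borel_measurable_continuous_onI)
  have [measurable]: "h T \<in> borel_measurable M" "?X n \<in> borel_measurable M" for n
    using T measurable_h measurable_euler_point[OF \<tau>] by auto
  have cis_f: "(\<lambda>\<phi>. f (cis \<phi>)) \<in> borel_measurable borel"
    by (intro measurable_compose[OF borel_measurable_continuous_onI[of cis]]) (auto intro!: continuous_intros)
  have int: "integrable M (\<lambda>\<omega>. f (g \<omega>))" if "g \<in> borel_measurable M" for g
  proof (rule integrable_const_bound[where B=1])
    show "AE \<omega> in M. norm (f (g \<omega>)) \<le> 1" using f by (intro AE_I2) (simp add: abs_le_iff)
    show "(\<lambda>\<omega>. f (g \<omega>)) \<in> borel_measurable M" using that by measurable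
  qed
  define q where "q n = \<bar>(\<integral>\<omega>. f (h T \<omega>) \<partial>M) - (\<integral>\<omega>. f (?X n \<omega>) \<partial>M)\<bar>" for n
  have "(\<lambda>n. ennreal (q n)) \<longlonglongrightarrow> 0"
  proof (rule young_tendsto_0)
    show "(\<lambda>n. sq M (\<lambda>\<omega>. h T \<omega> - ?X n \<omega>)) \<longlonglongrightarrow> 0"
      unfolding \<tau>_def by (rule euler_tendsto[OF T \<theta>])
    show "0 \<le> Lp" by (rule Lp)
    fix n and \<delta> :: real assume \<delta>: "0 < \<delta>"
    have pw: "\<bar>f u - f v\<bar> \<le> Lp * \<delta> + Lp / \<delta> * (cmod (u - v))\<^sup>2" for u v
    proof -
      have "cmod (u - v) \<le> \<delta> + (cmod (u - v))\<^sup>2 / \<delta>"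
      proof (cases "cmod (u - v) \<le> \<delta>")
        case True
        then show ?thesis using \<delta> by (intro add_increasing2) auto
      next
        case False
        then have "cmod (u - v) * \<delta> \<le> cmod (u - v) * cmod (u - v)" by (intro mult_left_mono) auto
        then have "cmod (u - v) \<le> (cmod (u - v))\<^sup>2 / \<delta>" using \<delta> by (simp add: pos_le_divide_eq power2_eq_square)
        then show ?thesis using \<delta> by linarith
      qed
      then have "Lp * cmod (u - v) \<le> Lp * (\<delta> + (cmod (u - v))\<^sup>2 / \<delta>)" using Lp by (rule mult_left_mono)
      then show ?thesis using lip[of u v] by (simp add: distrib_left)
    qed
    have "ennreal (q n) \<le> ennreal (\<integral>\<omega>. \<bar>f (h T \<omega>) - f (?X n \<omega>)\<bar> \<partial>M)"
    proof (rule ennreal_leI)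
      have "q n = \<bar>\<integral>\<omega>. f (h T \<omega>) - f (?X n \<omega>) \<partial>M\<bar>" unfolding q_def by (simp add: int)
      also have "\<dots> \<le> (\<integral>\<omega>. \<bar>f (h T \<omega>) - f (?X n \<omega>)\<bar> \<partial>M)" by (rule integral_abs_bound)
      finally show "q n \<le> (\<integral>\<omega>. \<bar>f (h T \<omega>) - f (?X n \<omega>)\<bar> \<partial>M)" .
    qed
    also have "\<dots> = (\<integral>\<^sup>+\<omega>. ennreal \<bar>f (h T \<omega>) - f (?X n \<omega>)\<bar> \<partial>M)"
      by (intro nn_integral_eq_integral[symmetric] integrable_abs Bochner_Integration.integrable_diff int) auto
    also have "\<dots> \<le> (\<integral>\<^sup>+\<omega>. ennreal (Lp * \<delta>) + ennreal (Lp / \<delta>) * ennreal ((cmod (h T \<omega> - ?X n \<omega>))\<^sup>2) \<partial>M)"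
    proof (rule nn_integral_mono)
      fix \<omega>
      have "ennreal \<bar>f (h T \<omega>) - f (?X n \<omega>)\<bar> \<le> ennreal (Lp * \<delta> + Lp / \<delta> * (cmod (h T \<omega> - ?X n \<omega>))\<^sup>2)"
        by (rule ennreal_leI[OF pw])
      also have "\<dots> = ennreal (Lp * \<delta>) + ennreal (Lp / \<delta>) * ennreal ((cmod (h T \<omega> - ?X n \<omega>))\<^sup>2)"
      proof -
        have "0 \<le> Lp * \<delta>" "0 \<le> Lp / \<delta>" using Lp \<delta> by auto
        then show ?thesis by (simp only: ennreal_plus ennreal_mult mult_nonneg_nonneg zero_le_power2)
      qed
      finally show "ennreal \<bar>f (h T \<omega>) - f (?X n \<omega>)\<bar> \<le> ennreal (Lp * \<delta>) + ennreal (Lp / \<delta>) * ennreal ((cmod (h T \<omega> - ?X n \<omega>))\<^sup>2)" .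
    qed
    also have "\<dots> = ennreal (Lp * \<delta>) + ennreal (Lp / \<delta>) * sq M (\<lambda>\<omega>. h T \<omega> - ?X n \<omega>)"
      unfolding sq_def by (subst nn_integral_add) (simp_all add: nn_integral_cmult emeasure_space_1)
    finally show "ennreal (q n) \<le> ennreal (Lp * \<delta>) + ennreal (Lp / \<delta>) * sq M (\<lambda>\<omega>. h T \<omega> - ?X n \<omega>)" .
  qed
  then have "(\<lambda>n. ennreal (q n)) \<longlonglongrightarrow> ennreal 0" by simp
  then have "q \<longlonglongrightarrow> 0" by (rule tendsto_ennrealD) (auto simp: q_def)
  then have "(\<lambda>n. (\<integral>\<omega>. f (?X n \<omega>) \<partial>M)) \<longlonglongrightarrow> (\<integral>\<omega>. f (h T \<omega>) \<partial>M)"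
    unfolding q_def by (subst (asm) abs_minus_commute) (simp add: LIM_zero_iff tendsto_rabs_zero_iff)
  moreover have "(\<integral>\<omega>. f (?X n \<omega>) \<partial>M) = (step_op K \<sigma> (T / real (Suc n)) ^^ Suc n) (\<lambda>\<phi>. f (cis \<phi>)) \<theta>" for n
    using expectation_euler_angle[OF K \<sigma> \<tau>[of n] cis_f, of 0 1 \<theta> "Suc n"] f
    by (simp only: euler_point_def \<tau>_def)
  ultimately show ?thesis by simp
qed

end

section \<open>Convergence in total variation\<close>

text \<open>The solutions themselves are not coupled: each expectation is a limit of iterates of the
  same operators at its own angle, and the contraction acts on these. Only step numbers divisible by
  \<open>m\<close> are used, so that the time splits into \<open>m\<close> equal blocks.\<close>

lemma expectation_contraction:
  fixes f :: "complex \<Rightarrow> real"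
  assumes 1: "circle_sde M F W K \<sigma> x h H J V" and 2: "circle_sde M F W K \<sigma> x' h' H' J' V'" and T: "1 \<le> T"
    and f: "\<And>z. f z \<in> {0..1}" and lip: "\<And>u v. \<bar>f u - f v\<bar> \<le> Lp * cmod (u - v)" and Lp: "0 \<le> Lp"
  shows "(\<integral>\<omega>. f (h T \<omega>) \<partial>M) - (\<integral>\<omega>. f (h' T \<omega>) \<partial>M) \<le> (1 - overlap K \<sigma>) ^ nat \<lfloor>T\<rfloor>"
proof -
  interpret A: circle_sde M F W K \<sigma> x h H J V by fact
  interpret B: circle_sde M F W K \<sigma> x' h' H' J' V' by fact
  have T0: "0 < T" using T by simp
  obtain \<theta> \<theta>' where \<theta>: "cis \<theta> = x" "cis \<theta>' = x'"
    using A.x B.x cis_Arg[of x] cis_Arg[of x'] by (metis complex_norm_eq_1_exp cis_conv_exp dist_0_norm mem_sphere)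
  define m where "m = nat \<lfloor>T\<rfloor>"
  have m: "1 \<le> m" "real m \<le> T" "T < real m + 1" unfolding m_def using T by (auto simp: le_nat_iff)
  \<comment> \<open>In \<open>expectation_tendsto\<close> the number of steps is the successor of
    the index, hence the \<open>- 1\<close>. A block of \<open>Suc n\<close> steps lasts
    \<open>T / m\<close>, which lies in \<open>[1, 2]\<close> because
    \<open>m \<le> T < m + 1\<close>.\<close>
  define r where "r n = Suc n * m - 1" for n
  have Suc_r: "Suc (r n) = Suc n * m" for n using m by (simp add: r_def)
  have r: "strict_mono r"
  proof (rule strict_monoI_Suc)
    fix n
    have "Suc (r n) < Suc (r (Suc n))" unfolding Suc_r using m by simp
    then show "r n < r (Suc n)" by simp
  qed
  let ?E = "\<lambda>\<theta> n. (step_op K \<sigma> (T / real (Suc n)) ^^ Suc n) (\<lambda>\<phi>. f (cis \<phi>)) \<theta>"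
  have lim: "(\<lambda>n. ?E \<theta> (r n) - ?E \<theta>' (r n)) \<longlonglongrightarrow> (\<integral>\<omega>. f (h T \<omega>) \<partial>M) - (\<integral>\<omega>. f (h' T \<omega>) \<partial>M)"
    using LIMSEQ_subseq_LIMSEQ[OF A.expectation_tendsto[OF T0 \<theta>(1) f lip Lp] r]
      LIMSEQ_subseq_LIMSEQ[OF B.expectation_tendsto[OF T0 \<theta>(2) f lip Lp] r]
    by (intro tendsto_diff) (simp_all only: o_def)
  have "?E \<theta> (r n) - ?E \<theta>' (r n) \<le> (1 - overlap K \<sigma>) ^ m" for n
  proof -
    define \<tau> where "\<tau> = T / real (Suc n * m)"
    have "0 < Suc n * m" using m by simp
    then have \<tau>: "0 < \<tau>"
      unfolding \<tau>_def using T0 by (intro divide_pos_pos) (simp_all only: of_nat_0_less_iff)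
    interpret euler_step K \<sigma> \<tau> using A.K A.\<sigma> \<tau> by unfold_locales
    have s: "real (Suc n) * \<tau> = T / real m" unfolding \<tau>_def of_nat_mult by (simp del: of_nat_Suc)
    have "continuous_on UNIV f" by (rule continuous_on_abs_lipschitz[OF lip Lp])
    then have "continuous_on UNIV (\<lambda>\<phi>. f (cis \<phi>))"
      by (rule continuous_on_compose2) (auto intro!: continuous_intros)
    then have mf: "(\<lambda>\<phi>. f (cis \<phi>)) \<in> borel_measurable borel" by (rule borel_measurable_continuous_onI)
    have "(P ^^ (Suc n * m)) (\<lambda>\<phi>. f (cis \<phi>)) \<theta> - (P ^^ (Suc n * m)) (\<lambda>\<phi>. f (cis \<phi>)) \<theta>' \<le> (1 - overlap K \<sigma>) ^ m"
    proof (rule contraction_iterate[OF mf])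
      have "cis (\<phi> + 2 * pi) = cis \<phi>" for \<phi> by (simp add: complex_eq_iff)
      then show "f (cis (\<phi> + 2 * pi)) = f (cis \<phi>)" for \<phi> by simp
      show "1 \<le> real (Suc n) * \<tau>" "real (Suc n) * \<tau> \<le> 2"
        unfolding s using m by (simp_all add: divide_simps)
    qed (rule f)
    then show ?thesis by (simp only: Suc_r \<tau>_def)
  qed
  then show ?thesis unfolding m_def[symmetric] by (intro LIMSEQ_le_const2[OF lim]) auto
qed

text \<open>A right inverse of \<open>cis\<close> on the circle, in a form whose measurability is
  plain: clamping the real part makes the arccosine continuous on the whole plane.\<close>

definition angle :: "complex \<Rightarrow> real" where
  "angle z = (if 0 \<le> Im z then 1 else - 1) * arccos (max (- 1) (min 1 (Re z)))"

lemma measurable_angle [measurable]: "angle \<in> borel_measurable borel"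
proof -
  have "continuous_on UNIV (\<lambda>z. arccos (max (- 1) (min 1 (Re z))))"
    by (intro continuous_on_arccos continuous_intros) auto
  then have [measurable]: "(\<lambda>z. arccos (max (- 1) (min 1 (Re z)))) \<in> borel_measurable borel"
    by (rule borel_measurable_continuous_onI)
  show ?thesis unfolding angle_def[abs_def] by measurable
qed

lemma cis_angle:
  assumes "z \<in> circle"
  shows "cis (angle z) = z"
proof -
  have 1: "(Re z)\<^sup>2 + (Im z)\<^sup>2 = 1" using assms by (simp add: cmod_def)
  have "\<bar>Re z\<bar> \<le> 1" using abs_Re_le_cmod[of z] assms by simp
  then have Re: "- 1 \<le> Re z" "Re z \<le> 1" by auto
  have "sqrt (1 - (Re z)\<^sup>2) = \<bar>Im z\<bar>" using 1 by (metis add_diff_cancel_left' real_sqrt_abs)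
  then show ?thesis
    using Re by (auto simp: complex_eq_iff angle_def sin_arccos cos_arccos)
qed

text \<open>Lipschitz functions decrease to the indicator of a closed set, so the bound holds for
  closed sets; inner regularity carries it to Borel sets.\<close>

lemma measure_diff_le_of_lipschitz:
  fixes \<mu> \<nu> :: "complex measure"
  assumes "prob_space \<mu>" "prob_space \<nu>" and sets: "sets \<mu> = sets borel" "sets \<nu> = sets borel"
    and e: "\<And>f Lp. (\<And>z. f z \<in> {0..1}) \<Longrightarrow> (\<And>u v. \<bar>f u - f v\<bar> \<le> Lp * cmod (u - v)) \<Longrightarrow> 0 \<le> Lp \<Longrightarrow>
      \<bar>(\<integral>z. f z \<partial>\<mu>) - (\<integral>z. f z \<partial>\<nu>)\<bar> \<le> e" and A: "A \<in> sets borel"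
  shows "\<bar>measure \<mu> A - measure \<nu> A\<bar> \<le> e"
proof -
  interpret \<mu>: prob_space \<mu> by fact
  interpret \<nu>: prob_space \<nu> by fact
  have e0: "0 \<le> e" using e[of "\<lambda>_. 0" 0] by simp
  have closed: "\<bar>measure \<mu> B - measure \<nu> B\<bar> \<le> e" if B: "closed B" for B
  proof (cases "B = {}")
    \<comment> \<open>The empty set is separate because \<open>infdist z {} = 0\<close> by
      convention, which would make every \<open>f k\<close> constantly 1.\<close>
    case False
    define f where "f k z = max 0 (1 - real k * infdist z B)" for k and z :: complex
    have f01: "f k z \<in> {0..1}" for k z by (simp add: f_def infdist_nonneg)
    have lip: "\<bar>f k u - f k v\<bar> \<le> real k * cmod (u - v)" for k u v
    proof -
      have "\<bar>infdist u B - infdist v B\<bar> \<le> cmod (u - v)" using infdist_triangle_abs[of u B v] by (simp add: dist_norm)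
      then have "real k * \<bar>infdist u B - infdist v B\<bar> \<le> real k * cmod (u - v)" by (intro mult_left_mono) auto
      then have "\<bar>real k * infdist u B - real k * infdist v B\<bar> \<le> real k * cmod (u - v)"
        by (simp add: abs_mult right_diff_distrib[symmetric])
      then show ?thesis by (auto simp: f_def max_def)
    qed
    have cf: "continuous_on UNIV (f k)" for k unfolding f_def[abs_def] by (intro continuous_intros)
    have lim: "(\<lambda>k. f k z) \<longlonglongrightarrow> indicator B z" for z
    proof (cases "z \<in> B")
      case True
      then show ?thesis by (simp add: f_def)
    next
      case z: False
      then have pos: "0 < infdist z B" using B False in_closed_iff_infdist_zero[OF B False, of z] infdist_nonneg[of z B] by linarith
      then obtain k0 where k0: "1 < real k0 * infdist z B" using reals_Archimedean3 by blast
      have "f k z = 0" if "k0 \<le> k" for k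
      proof -
        have "real k0 * infdist z B \<le> real k * infdist z B" using that pos by (intro mult_right_mono) auto
        then show ?thesis using k0 by (simp add: f_def)
      qed
      then have "\<forall>\<^sub>F k in sequentially. f k z = 0" by (auto simp: eventually_sequentially)
      then show ?thesis using z by (simp add: tendsto_eventually)
    qed
    have conv: "(\<lambda>k. \<integral>z. f k z \<partial>\<nu>) \<longlonglongrightarrow> measure \<nu> B" if \<nu>: "prob_space \<nu>" "sets \<nu> = sets borel" for \<nu>
    proof -
      interpret prob_space \<nu> by fact
      have "(\<lambda>k. \<integral>z. f k z \<partial>\<nu>) \<longlonglongrightarrow> (\<integral>z. indicator B z \<partial>\<nu>)"
      proof (rule integral_dominated_convergence[where w="\<lambda>_. 1"])
        show "f k \<in> borel_measurable \<nu>" for k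
          using borel_measurable_continuous_onI[OF cf] measurable_cong_sets[OF \<nu>(2) refl] by blast
        show "indicator B \<in> borel_measurable \<nu>" using B \<nu> by (intro borel_measurable_indicator) auto
        show "AE z in \<nu>. norm (f k z) \<le> 1" for k using f01[of k] by (intro AE_I2) (simp add: abs_le_iff)
      qed (use lim in auto)
      then show ?thesis using B \<nu> by simp
    qed
    have "(\<lambda>k. \<bar>(\<integral>z. f k z \<partial>\<mu>) - (\<integral>z. f k z \<partial>\<nu>)\<bar>) \<longlonglongrightarrow> \<bar>measure \<mu> B - measure \<nu> B\<bar>"
      by (intro tendsto_rabs tendsto_diff conv assms)
    then show ?thesis using e[OF f01 lip] by (intro LIMSEQ_le_const2) auto
  qed (simp add: e0)
  have inner: "\<exists>C. compact C \<and> C \<subseteq> A \<and> measure \<nu> A \<le> measure \<nu> C + d" if "prob_space \<nu>" "sets \<nu> = sets borel" "0 < d" for d \<nu>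
  proof -
    interpret prob_space \<nu> by fact
    have "emeasure \<nu> A = (SUP C\<in>{C. C \<subseteq> A \<and> compact C}. emeasure \<nu> C)"
      using that A by (intro inner_regular) (auto simp: emeasure_space_1)
    \<comment> \<open>Subtraction stops at 0, so the strict inequality fails for a null set; a set
      of measure at most \<open>d\<close> is approximated by the empty set.\<close>
    moreover have "emeasure \<nu> A - ennreal d < emeasure \<nu> A \<or> measure \<nu> A \<le> d"
      using that(3) by (simp add: emeasure_eq_measure ennreal_minus) (metis ennreal_less_iff diff_ge_0_iff_ge diff_less_eq less_add_same_cancel1 linorder_le_cases)
    ultimately consider C where "C \<subseteq> A" "compact C" "emeasure \<nu> A - ennreal d < emeasure \<nu> C" | "measure \<nu> A \<le> d"
      by (auto simp: less_SUP_iff)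
    then show ?thesis
    proof cases
      case 1
      then have "measure \<nu> A - d < measure \<nu> C \<or> measure \<nu> A - d \<le> 0"
        using that(3) by (auto simp: emeasure_eq_measure ennreal_minus ennreal_less_iff)
      then show ?thesis using 1 measure_nonneg[of \<nu> C] by (intro exI[of _ C]) linarith
    next
      case 2
      then show ?thesis by (intro exI[of _ "{}"]) simp
    qed
  qed
  show ?thesis
  proof (rule field_le_epsilon)
    fix d :: real assume d: "0 < d"
    obtain C where C: "compact C" "C \<subseteq> A" "measure \<mu> A \<le> measure \<mu> C + d"
      using inner[OF assms(1) sets(1) d] by blast
    obtain D where D: "compact D" "D \<subseteq> A" "measure \<nu> A \<le> measure \<nu> D + d"
      using inner[OF assms(2) sets(2) d] by blast
    \<comment> \<open>One set inside \<open>A\<close> has to be close to it for both measures at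
      once; the union of the two approximations is.\<close>
    have cl: "closed (C \<union> D)" using C D by (auto intro: compact_imp_closed)
    have ms: "C \<union> D \<in> sets borel" "A \<in> sets borel" using cl A by auto
    have "measure \<mu> C \<le> measure \<mu> (C \<union> D)" "measure \<mu> (C \<union> D) \<le> measure \<mu> A"
      using ms C D by (auto intro!: \<mu>.finite_measure_mono simp: sets)
    moreover have "measure \<nu> D \<le> measure \<nu> (C \<union> D)" "measure \<nu> (C \<union> D) \<le> measure \<nu> A"
      using ms C D by (auto intro!: \<nu>.finite_measure_mono simp: sets)
    ultimately show "\<bar>measure \<mu> A - measure \<nu> A\<bar> \<le> e + d"
      using closed[OF cl] C(3) D(3) by linarith
  qed
qed

theorem proposition3:
  fixes K \<epsilon> :: real
    and M :: "'a measure" and F :: "real \<Rightarrow> 'a measure" and W :: "real \<Rightarrow> 'a \<Rightarrow> real"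
    and h :: "complex \<Rightarrow> real \<Rightarrow> 'a \<Rightarrow> complex" and \<mu> :: "complex measure"
  assumes "K > 0" and "\<epsilon> > 0"
    and "brownian_motion M F W"
    and "\<And>x. x \<in> circle \<Longrightarrow> circle_sde_solution K \<epsilon> M F W x (h x)"
    and "invariant_prob M h \<mu>"
  shows "\<exists>C>0. \<exists>\<gamma>>0. \<forall>x\<in>circle. \<forall>t\<ge>1.
    tv_dist (transition_law M h t x) \<mu> \<le> C * exp (- \<gamma> * t)"
proof -
  define \<sigma> where "\<sigma> = sqrt 2 * \<epsilon>"
  define c where "c = 1 - overlap K \<sigma>"
  have c: "0 < c" "c < 1" using overlap[of K \<sigma>] by (auto simp: c_def)
  interpret brownian_motion M F W by fact
  have sde: "\<exists>H J V. circle_sde M F W K \<sigma> x (h x) H J V" if "x \<in> circle" for x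
    using circle_sde_exists[OF assms(1,2) that assms(3) assms(4)[OF that]] unfolding \<sigma>_def by metis
  have \<mu>: "prob_space \<mu>" "sets \<mu> = sets circle_borel"
    and inv: "\<And>t f. 0 \<le> t \<Longrightarrow> f \<in> borel_measurable circle_borel \<Longrightarrow> bounded (f ` circle) \<Longrightarrow>
        (\<integral>x. transition_op M h t f x \<partial>\<mu>) = (\<integral>x. f x \<partial>\<mu>)"
    using assms(5) unfolding invariant_prob_def by blast+
  interpret \<mu>: prob_space \<mu> by fact
  have space_\<mu>: "space \<mu> = circle" using sets_eq_imp_space_eq[OF \<mu>(2)] by (simp add: space_restrict_space)
  have bound: "tv_dist (transition_law M h t x) \<mu> \<le> c ^ nat \<lfloor>t\<rfloor>" if x: "x \<in> circle" and t: "1 \<le> t" for x t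
  proof -
    have hm: "h x t \<in> borel_measurable M" and hc: "\<omega> \<in> space M \<Longrightarrow> h x t \<omega> \<in> circle" for \<omega>
    proof -
      have "h x t \<in> borel_measurable (F t)" "\<omega> \<in> space M \<Longrightarrow> h x t \<omega> \<in> circle"
        using assms(4)[OF x] t unfolding circle_sde_solution_def by auto
      then show "h x t \<in> borel_measurable M" "\<omega> \<in> space M \<Longrightarrow> h x t \<omega> \<in> circle" by (auto intro: measurable_F)
    qed
    have hr: "h x t \<in> measurable M circle_borel" using hm hc by (intro measurable_restrict_space2) auto
    have id: "(\<lambda>z. z) \<in> measurable \<mu> borel"
      unfolding measurable_cong_sets[OF \<mu>(2) refl] by (intro measurable_restrict_space1) simp
    \<comment> \<open>Both laws are moved to the plane, where distance functions and inner
      regularity are at hand; Borel subsets of the circle keep their measure.\<close>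
    let ?\<nu> = "distr M borel (h x t)" and ?\<mu> = "distr \<mu> borel (\<lambda>z. z)"
    have "\<bar>measure ?\<nu> A - measure ?\<mu> A\<bar> \<le> c ^ nat \<lfloor>t\<rfloor>" if A: "A \<in> sets borel" for A
    proof (rule measure_diff_le_of_lipschitz[OF _ _ _ _ _ A])
      show "prob_space ?\<nu>" using hm by (rule prob_space_distr)
      show "prob_space ?\<mu>" using id by (rule \<mu>.prob_space_distr)
      fix f :: "complex \<Rightarrow> real" and Lp :: real
      assume f: "\<And>z. f z \<in> {0..1}" and lip: "\<And>u v. \<bar>f u - f v\<bar> \<le> Lp * cmod (u - v)" and Lp: "0 \<le> Lp"
      have "continuous_on UNIV f" by (rule continuous_on_abs_lipschitz[OF lip Lp])
      then have mf[measurable]: "f \<in> borel_measurable borel" by (rule borel_measurable_continuous_onI)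
      define g where "g y = (\<integral>\<omega>. f (h y t \<omega>) \<partial>M)" for y
      have diff: "g y - g z \<le> c ^ nat \<lfloor>t\<rfloor>" if yz: "y \<in> circle" "z \<in> circle" for y z
      proof -
        obtain H J V H' J' V' where "circle_sde M F W K \<sigma> y (h y) H J V" "circle_sde M F W K \<sigma> z (h z) H' J' V'"
          using sde[OF yz(1)] sde[OF yz(2)] by blast
        from expectation_contraction[OF this t f lip Lp] show ?thesis by (simp add: g_def c_def)
      qed
      have g_lim: "(\<lambda>n. (step_op K \<sigma> (t / real (Suc n)) ^^ Suc n) (\<lambda>\<phi>. f (cis \<phi>)) (angle y)) \<longlonglongrightarrow> g y" if y: "y \<in> circle" for y
      proof -
        obtain H J V where "circle_sde M F W K \<sigma> y (h y) H J V" using sde[OF y] by blast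
        then interpret circle_sde M F W K \<sigma> y "h y" H J V .
        show ?thesis unfolding g_def using t by (intro expectation_tendsto[OF _ cis_angle[OF y] f lip Lp]) simp
      qed
      \<comment> \<open>Nothing is assumed about how the solutions depend on the starting point;
        measurability comes from the Euler operators composed with \<open>angle\<close>.\<close>
      have gm: "g \<in> borel_measurable \<mu>"
      proof (rule borel_measurable_LIMSEQ_real)
        show "(\<lambda>n. (step_op K \<sigma> (t / real (Suc n)) ^^ Suc n) (\<lambda>\<phi>. f (cis \<phi>)) (angle y)) \<longlonglongrightarrow> g y" if "y \<in> space \<mu>" for y
          using that g_lim by (simp add: space_\<mu>)
        fix n
        interpret euler_step K \<sigma> "t / real (Suc n)" using assms(1,2) t by unfold_locales (auto simp: \<sigma>_def)
        have "(\<lambda>\<phi>. f (cis \<phi>)) \<in> borel_measurable borel"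
          by (intro measurable_compose[OF borel_measurable_continuous_onI[of cis] mf]) (auto intro!: continuous_intros)
        then have "(step_op K \<sigma> (t / real (Suc n)) ^^ Suc n) (\<lambda>\<phi>. f (cis \<phi>)) \<in> borel_measurable borel"
          by (rule measurable_iterate)
        then show "(\<lambda>y. (step_op K \<sigma> (t / real (Suc n)) ^^ Suc n) (\<lambda>\<phi>. f (cis \<phi>)) (angle y)) \<in> borel_measurable \<mu>"
          by (rule measurable_compose[OF measurable_compose[OF id measurable_angle]])
      qed
      have g01: "\<bar>g y\<bar> \<le> 1" if "y \<in> circle" for y
      proof -
        have "\<bar>g y\<bar> \<le> (\<integral>\<omega>. \<bar>f (h y t \<omega>)\<bar> \<partial>M)" unfolding g_def by (rule integral_abs_bound)
        \<comment> \<open>In the non-integrable case the integral is 0 by convention, which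
          satisfies the bound as well.\<close>
        also have "\<dots> \<le> 1"
        proof (cases "integrable M (\<lambda>\<omega>. \<bar>f (h y t \<omega>)\<bar>)")
          case True
          then show ?thesis using f by (intro integral_le_const) (auto simp: abs_le_iff)
        qed (simp add: not_integrable_integral_eq)
        finally show ?thesis .
      qed
      have gi: "integrable \<mu> g"
        using gm g01 by (intro \<mu>.integrable_const_bound[where B=1] AE_I2) (auto simp: space_\<mu>)
      have "(\<integral>y. transition_op M h t f y \<partial>\<mu>) = (\<integral>y. f y \<partial>\<mu>)"
      proof (rule inv)
        show "f \<in> borel_measurable circle_borel" by (rule measurable_restrict_space1[OF mf])
        show "bounded (f ` circle)" using f by (auto simp: bounded_iff intro!: exI[of _ 1])
      qed (use t in simp)
      then have inv_g: "(\<integral>y. g y \<partial>\<mu>) = (\<integral>y. f y \<partial>\<mu>)" by (simp add: transition_op_def g_def)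
      \<comment> \<open>The bound is averaged over the other starting point with respect to \<mu>;
        by invariance the average of \<open>g\<close> is that of \<open>f\<close>.\<close>
      have "(\<integral>y. g y \<partial>\<mu>) \<le> g x + c ^ nat \<lfloor>t\<rfloor>"
        using gi diff[OF _ x] by (intro \<mu>.integral_le_const AE_I2) (auto simp: space_\<mu> algebra_simps)
      moreover have "g x - c ^ nat \<lfloor>t\<rfloor> \<le> (\<integral>y. g y \<partial>\<mu>)"
        using gi diff[OF x] by (intro \<mu>.integral_ge_const AE_I2) (auto simp: space_\<mu> algebra_simps)
      ultimately have "\<bar>g x - (\<integral>y. f y \<partial>\<mu>)\<bar> \<le> c ^ nat \<lfloor>t\<rfloor>" unfolding inv_g by linarith
      then show "\<bar>(\<integral>z. f z \<partial>?\<nu>) - (\<integral>z. f z \<partial>?\<mu>)\<bar> \<le> c ^ nat \<lfloor>t\<rfloor>"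
        using hm id by (simp add: integral_distr g_def)
    qed auto
    note diff = this
    show ?thesis
      unfolding tv_dist_def
    proof (rule cSUP_least)
      show "sets (transition_law M h t x) \<noteq> {}" using sets.empty_sets by blast
      fix \<Gamma> assume "\<Gamma> \<in> sets (transition_law M h t x)"
      then have G: "\<Gamma> \<in> sets circle_borel" by (simp add: transition_law_def)
      then have Gb: "\<Gamma> \<in> sets borel" "\<Gamma> \<subseteq> circle" by (auto simp: sets_restrict_space)
      have "measure (transition_law M h t x) \<Gamma> = measure ?\<nu> \<Gamma>"
        unfolding transition_law_def using G Gb hm hr by (simp add: measure_distr)
      moreover have "measure \<mu> \<Gamma> = measure ?\<mu> \<Gamma>"
        using Gb id by (simp add: measure_distr space_\<mu> Int_absorb2)
      ultimately show "\<bar>measure (transition_law M h t x) \<Gamma> - measure \<mu> \<Gamma>\<bar> \<le> c ^ nat \<lfloor>t\<rfloor>"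
        using diff[OF Gb(1)] by simp
    qed
  qed
  show ?thesis
  proof (intro exI conjI ballI allI impI)
    \<comment> \<open>The rate is that of \<open>c ^ nat \<lfloor>t\<rfloor>\<close>; the factor
      \<open>inverse c\<close> makes up for rounding \<open>t\<close> down by less than 1.\<close>
    show "0 < inverse c" "0 < - ln c" using c by auto
    fix x :: complex and t :: real assume x: "x \<in> circle" and t: "1 \<le> t"
    have "c ^ nat \<lfloor>t\<rfloor> = exp (ln c * real (nat \<lfloor>t\<rfloor>))"
      using c by (simp add: exp_of_nat2_mult)
    also have "\<dots> \<le> exp (ln c * (t - 1))"
    proof -
      have "t - 1 \<le> real (nat \<lfloor>t\<rfloor>)" using t by linarith
      moreover have "ln c \<le> 0" using c by simp
      ultimately show ?thesis by (simp add: mult_left_mono_neg)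
    qed
    also have "\<dots> = inverse c * exp (- (- ln c) * t)"
      using c by (simp add: right_diff_distrib exp_diff field_simps)
    finally show "tv_dist (transition_law M h t x) \<mu> \<le> inverse c * exp (- (- ln c) * t)"
      using bound[OF x t] by simp
  qed
qed

end
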